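(* Let $1\to U\to E\to G\to1$ be a short exact sequence of groups. Assume that $H_1E$ is finitely generated and $H_2E$ is finite. Then there is an exact sequence $$\widehat U_E\longrightarrow\widehat E\longrightarrow\mathbb Z_\infty G\longrightarrow1.$$
   Context: $H_*E=H_*(E,\mathbb Z)$. For a group $G$: $\gamma_1G=G$, $\gamma_{n+1}G=[\gamma_nG,G]$, and $\widehat G=\varprojlim_nG/\gamma_nG$. For a normal subgroup $U$ of $E$: $\gamma_1(U,E)=U$, $\gamma_{n+1}(U,E)=[\gamma_n(U,E),E]$, and $\widehat U_E=\varprojlim_nU/\gamma_n(U,E)$. The map $\widehat U_E\to\widehat E$ is induced by the inclusion $U\subseteq E$. $\mathbb Z_\infty G:=\pi_1(\mathbb Z_\infty BG)$, where $\mathbb Z_\infty X$ denotes the Bousfield–Kan $\mathbb Z$-completion of a space $X$. Using the model $\mathbb Z_\infty X_\bullet\simeq\overline{\mathcal W}(\widehat{\mathcal GX_\bullet})$ for a reduced simplicial set $X_\bullet$ ($\mathcal G$ is Kan's loop group, $\overline{\mathcal W}$ its right adjoint, completion applied dimensionwise), one has $\mathbb Z_\infty G=\pi_0(\widehat F_\bullet)$ with $F_\bullet=\mathcal G\overline{\mathcal W}G$ a free simplicial resolution of $G$, and the augmentation $F_\bullet\to G$ induces the natural map $\mathbb Z_\infty G\to\widehat G$. Under the hypotheses on $E$ the natural map $\mathbb Z_\infty E\to\widehat E$ is an isomorphism, and the map $\widehat E\to\mathbb Z_\infty G$ is the composite of its inverse with $\mathbb Z_\infty E\to\mathbb Z_\infty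 G$. *)

theory Defs
  imports "HOL-Algebra.Free_Abelian_Groups" "HOL-Algebra.Generated_Groups"
begin

section \<open>Relative lower central series and completion\<close>

definition commutator_subgroup ::
    "('a, 'm) monoid_scheme \<Rightarrow> 'a set \<Rightarrow> 'a set \<Rightarrow> 'a set" where
  "commutator_subgroup E H K =
     generate E (\<Union>h\<in>H. \<Union>k\<in>K. {h \<otimes>\<^bsub>E\<^esub> k \<otimes>\<^bsub>E\<^esub> inv\<^bsub>E\<^esub> h \<otimes>\<^bsub>E\<^esub> inv\<^bsub>E\<^esub> k})"

text \<open>The index is shifted: \<open>rel_lcs E U n\<close> is $\gamma_{n+1}(U,E)$.\<close>

primrec rel_lcs :: "('a, 'm) monoid_scheme \<Rightarrow> 'a set \<Rightarrow> nat \<Rightarrow> 'a set" where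
  "rel_lcs E U 0 = U"
| "rel_lcs E U (Suc n) = commutator_subgroup E (rel_lcs E U n) (carrier E)"

definition completion_quot ::
    "('a, 'm) monoid_scheme \<Rightarrow> 'a set \<Rightarrow> nat \<Rightarrow> 'a set monoid" where
  "completion_quot E U n = (E\<lparr>carrier := U\<rparr>) Mod (rel_lcs E U n)"

text \<open>The inverse limit of the quotients of \<open>U\<close> by the \<open>rel_lcs E U n\<close>. The transition map
  sends a coset of \<open>rel_lcs E U (Suc n)\<close> to the unique coset of \<open>rel_lcs E U n\<close> containing it.\<close>

definition completion :: "('a, 'm) monoid_scheme \<Rightarrow> 'a set \<Rightarrow> (nat \<Rightarrow> 'a set) monoid" where
  "completion E U =
     \<lparr>carrier = {x. (\<forall>n. x n \<in> carrier (completion_quot E U n)) \<and> (\<forall>n. x (Suc n) \<subseteq> x n)},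
      monoid.mult = (\<lambda>x y n. x n \<otimes>\<^bsub>completion_quot E U n\<^esub> y n),
      monoid.one = (\<lambda>n. \<one>\<^bsub>completion_quot E U n\<^esub>)\<rparr>"

abbreviation hat :: "('a, 'm) monoid_scheme \<Rightarrow> (nat \<Rightarrow> 'a set) monoid" where
  "hat G \<equiv> completion G (carrier G)"

text \<open>The map of completions into \<open>completion E U\<close> induced by a homomorphism \<open>f\<close>: a coset \<open>C\<close> goes
  to the coset of \<open>rel_lcs E U n\<close> that contains \<open>f ` C\<close>.\<close>

definition completion_map ::
    "('b, 'm) monoid_scheme \<Rightarrow> 'b set \<Rightarrow> ('a \<Rightarrow> 'b) \<Rightarrow> (nat \<Rightarrow> 'a set) \<Rightarrow> nat \<Rightarrow> 'b set" where
  "completion_map E U f x = (\<lambda>n. rel_lcs E U n <#>\<^bsub>E\<^esub> (f ` x n))"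


section \<open>Simplicial sets and simplicial groups\<close>

text \<open>\<open>face X n i\<close> is $d_i : X_n \to X_{n-1}$ and \<open>degen X n i\<close> is $s_i : X_n \to X_{n+1}$.
  A map of simplicial sets is given by its components, as a function of the dimension.\<close>

record 'a sset =
  simplices :: "nat \<Rightarrow> 'a set"
  face :: "nat \<Rightarrow> nat \<Rightarrow> 'a \<Rightarrow> 'a"
  degen :: "nat \<Rightarrow> nat \<Rightarrow> 'a \<Rightarrow> 'a"

record 'a sgroup =
  level :: "nat \<Rightarrow> 'a monoid"
  gface :: "nat \<Rightarrow> nat \<Rightarrow> 'a \<Rightarrow> 'a"
  gdegen :: "nat \<Rightarrow> nat \<Rightarrow> 'a \<Rightarrow> 'a"

definition const_sgroup :: "'a monoid \<Rightarrow> 'a sgroup" where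
  "const_sgroup G = \<lparr>level = (\<lambda>n. G), gface = (\<lambda>n i x. x), gdegen = (\<lambda>n i x. x)\<rparr>"

definition completion_sgroup :: "'a sgroup \<Rightarrow> (nat \<Rightarrow> 'a set) sgroup" where
  "completion_sgroup K =
     \<lparr>level = (\<lambda>n. hat (level K n)),
      gface = (\<lambda>n i. completion_map (level K (n - 1)) (carrier (level K (n - 1))) (gface K n i)),
      gdegen = (\<lambda>n i. completion_map (level K (Suc n)) (carrier (level K (Suc n))) (gdegen K n i))\<rparr>"

definition completion_sgroup_map ::
    "'b sgroup \<Rightarrow> (nat \<Rightarrow> 'a \<Rightarrow> 'b) \<Rightarrow> nat \<Rightarrow> (nat \<Rightarrow> 'a set) \<Rightarrow> nat \<Rightarrow> 'b set" where
  "completion_sgroup_map L f n = completion_map (level L n) (carrier (level L n)) (f n)"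


section \<open>The functor W-bar\<close>

text \<open>An $n$-simplex is a list $[g_{n-1},\dots,g_0]$ with $g_j \in K_j$, so that a list entry lies in
  the dimension given by the number of entries after it. Writing out the recursions gives
  \begin{itemize}
  \item $d_0(g_{n-1},\dots,g_0) = (g_{n-2},\dots,g_0)$,
  \item $d_i(g_{n-1},\dots,g_0) =
    (d_{i-1}g_{n-1},\dots,d_1g_{n-i+1},\, d_0g_{n-i}\cdot g_{n-i-1},\, g_{n-i-2},\dots,g_0)$
    for $0<i<n$,
  \item $d_n(g_{n-1},\dots,g_0) = (d_{n-1}g_{n-1},\dots,d_1g_1)$,
  \item $s_i(g_{n-1},\dots,g_0) = (s_{i-1}g_{n-1},\dots,s_0g_{n-i},\, 1,\, g_{n-i-1},\dots,g_0)$.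
  \end{itemize}
  For a constant simplicial group this is the nerve, i.e. the classifying space.\<close>

fun wbar_face :: "'a sgroup \<Rightarrow> nat \<Rightarrow> 'a list \<Rightarrow> 'a list" where
  "wbar_face K i [] = []"
| "wbar_face K 0 (g # gs) = gs"
| "wbar_face K (Suc 0) [g] = []"
| "wbar_face K (Suc 0) (g # h # gs) =
     (gface K (Suc (length gs)) 0 g \<otimes>\<^bsub>level K (length gs)\<^esub> h) # gs"
| "wbar_face K (Suc (Suc i)) (g # gs) = gface K (length gs) (Suc i) g # wbar_face K (Suc i) gs"

fun wbar_degen :: "'a sgroup \<Rightarrow> nat \<Rightarrow> 'a list \<Rightarrow> 'a list" where
  "wbar_degen K 0 gs = \<one>\<^bsub>level K (length gs)\<^esub> # gs"
| "wbar_degen K (Suc i) [] = []"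
| "wbar_degen K (Suc i) (g # gs) = gdegen K (length gs) i g # wbar_degen K i gs"

definition wbar :: "'a sgroup \<Rightarrow> 'a list sset" where
  "wbar K =
     \<lparr>simplices = (\<lambda>n. {gs. length gs = n \<and> (\<forall>j<n. gs ! j \<in> carrier (level K (n - 1 - j)))}),
      face = (\<lambda>n. wbar_face K),
      degen = (\<lambda>n. wbar_degen K)\<rparr>"

primrec wbar_map_list :: "(nat \<Rightarrow> 'a \<Rightarrow> 'b) \<Rightarrow> 'a list \<Rightarrow> 'b list" where
  "wbar_map_list f [] = []"
| "wbar_map_list f (g # gs) = f (length gs) g # wbar_map_list f gs"

definition wbar_map :: "(nat \<Rightarrow> 'a \<Rightarrow> 'b) \<Rightarrow> nat \<Rightarrow> 'a list \<Rightarrow> 'b list" where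
  "wbar_map f n = wbar_map_list f"

abbreviation BG :: "'a monoid \<Rightarrow> 'a list sset" where
  "BG G \<equiv> wbar (const_sgroup G)"


section \<open>Integral homology\<close>

definition simplicial_boundary :: "'a sset \<Rightarrow> nat \<Rightarrow> ('a \<Rightarrow>\<^sub>0 int) \<Rightarrow> ('a \<Rightarrow>\<^sub>0 int)" where
  "simplicial_boundary X n =
     (if n = 0 then (\<lambda>c. 0)
      else frag_extend (\<lambda>x. \<Sum>i\<le>n. frag_cmul ((-1) ^ i) (frag_of (face X n i x))))"

definition simplicial_cycles :: "'a sset \<Rightarrow> nat \<Rightarrow> ('a \<Rightarrow>\<^sub>0 int) set" where
  "simplicial_cycles X n =
     {c \<in> carrier (free_Abelian_group (simplices X n)). simplicial_boundary X n c = 0}"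

definition simplicial_boundaries :: "'a sset \<Rightarrow> nat \<Rightarrow> ('a \<Rightarrow>\<^sub>0 int) set" where
  "simplicial_boundaries X n =
     simplicial_boundary X (Suc n) ` carrier (free_Abelian_group (simplices X (Suc n)))"

definition simplicial_homology :: "nat \<Rightarrow> 'a sset \<Rightarrow> ('a \<Rightarrow>\<^sub>0 int) set monoid" where
  "simplicial_homology n X =
     (free_Abelian_group (simplices X n))\<lparr>carrier := simplicial_cycles X n\<rparr>
       Mod (simplicial_boundaries X n)"

text \<open>The simplicial chain complex of the nerve is the bar complex of the group with trivial
  integer coefficients.\<close>

definition group_homology :: "nat \<Rightarrow> 'a monoid \<Rightarrow> ('a list \<Rightarrow>\<^sub>0 int) set monoid" where
  "group_homology n E = simplicial_homology n (BG E)"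

definition finitely_generated_group :: "('a, 'm) monoid_scheme \<Rightarrow> bool" where
  "finitely_generated_group G \<longleftrightarrow> (\<exists>S. finite S \<and> S \<subseteq> carrier G \<and> generate G S = carrier G)"


section \<open>Free groups\<close>

text \<open>A letter \<open>(True, x)\<close> stands for the generator \<open>x\<close> and \<open>(False, x)\<close> for its inverse. The
  elements of the free group are the reduced words.\<close>

type_synonym 'x fword = "(bool \<times> 'x) list"

definition inverse_letters :: "bool \<times> 'x \<Rightarrow> bool \<times> 'x \<Rightarrow> bool" where
  "inverse_letters a b \<longleftrightarrow> snd a = snd b \<and> fst a \<noteq> fst b"

definition letter_mult :: "bool \<times> 'x \<Rightarrow> 'x fword \<Rightarrow> 'x fword" where
  "letter_mult a w = (case w of [] \<Rightarrow> [a] | b # v \<Rightarrow> if inverse_letters a b then v else a # w)"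

definition free_group :: "'x set \<Rightarrow> 'x fword monoid" where
  "free_group S =
     \<lparr>carrier = {w. snd ` set w \<subseteq> S \<and> successively (\<lambda>a b. \<not> inverse_letters a b) w},
      monoid.mult = (\<lambda>u v. foldr letter_mult u v),
      monoid.one = []\<rparr>"

text \<open>The homomorphism to \<open>H\<close> that extends a map \<open>f\<close> defined on the generators.\<close>

definition free_lift :: "('b, 'm) monoid_scheme \<Rightarrow> ('x \<Rightarrow> 'b) \<Rightarrow> 'x fword \<Rightarrow> 'b" where
  "free_lift H f w =
     foldr (\<lambda>(b, x) y. (if b then f x else inv\<^bsub>H\<^esub> (f x)) \<otimes>\<^bsub>H\<^esub> y) w \<one>\<^bsub>H\<^esub>"


section \<open>Kan's loop group of a reduced simplicial set\<close>

text \<open>In dimension $n$ the loop group is generated by $X_{n+1}$ subject to the relations $s_0y = 1$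
  for $y \in X_n$. It is realized as the free group on the complement of $s_0X_n$, and
  \<open>loop_gen X n x\<close> is the class $[x]$ of \<open>x\<close> (trivial for $x\in s_0X_n$). Then
  $d_0[x] = [d_1x][d_0x]^{-1}$, $d_i[x]=[d_{i+1}x]$ for $i>0$ and $s_i[x] = [s_{i+1}x]$, which is
  the convention that makes it left adjoint to \<open>wbar\<close> as defined above.\<close>

definition loop_level :: "'x sset \<Rightarrow> nat \<Rightarrow> 'x fword monoid" where
  "loop_level X n = free_group (simplices X (Suc n) - degen X n 0 ` simplices X n)"

definition loop_gen :: "'x sset \<Rightarrow> nat \<Rightarrow> 'x \<Rightarrow> 'x fword" where
  "loop_gen X n x = (if x \<in> degen X n 0 ` simplices X n then [] else [(True, x)])"

definition loop_face_gen :: "'x sset \<Rightarrow> nat \<Rightarrow> nat \<Rightarrow> 'x \<Rightarrow> 'x fword" where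
  "loop_face_gen X n i x =
     (if i = 0
      then loop_gen X (n - 1) (face X (Suc n) 1 x) \<otimes>\<^bsub>loop_level X (n - 1)\<^esub>
             inv\<^bsub>loop_level X (n - 1)\<^esub> (loop_gen X (n - 1) (face X (Suc n) 0 x))
      else loop_gen X (n - 1) (face X (Suc n) (Suc i) x))"

definition loop_group :: "'x sset \<Rightarrow> 'x fword sgroup" where
  "loop_group X =
     \<lparr>level = loop_level X,
      gface = (\<lambda>n i. free_lift (loop_level X (n - 1)) (loop_face_gen X n i)),
      gdegen = (\<lambda>n i. free_lift (loop_level X (Suc n))
                        (\<lambda>x. loop_gen X (Suc n) (degen X (Suc n) (Suc i) x)))\<rparr>"

definition loop_group_map ::
    "'y sset \<Rightarrow> (nat \<Rightarrow> 'x \<Rightarrow> 'y) \<Rightarrow> nat \<Rightarrow> 'x fword \<Rightarrow> 'y fword" where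
  "loop_group_map Y f n = free_lift (loop_level Y n) (\<lambda>x. loop_gen Y n (f (Suc n) x))"


section \<open>Fundamental group of a Kan complex\<close>

definition loops :: "'a sset \<Rightarrow> 'a \<Rightarrow> 'a set" where
  "loops X v = {x \<in> simplices X 1. face X 1 0 x = v \<and> face X 1 1 x = v}"

definition loop_homotopy :: "'a sset \<Rightarrow> 'a \<Rightarrow> ('a \<times> 'a) set" where
  "loop_homotopy X v =
     {(x, y). x \<in> loops X v \<and> y \<in> loops X v \<and>
        (\<exists>s\<in>simplices X 2. face X 2 0 s = degen X 0 0 v \<and> face X 2 1 s = x \<and> face X 2 2 s = y)}"

text \<open>The product of the classes of \<open>x\<close> and \<open>y\<close> is the class of \<open>face X 2 1 s\<close>, where \<open>s\<close> is a
  2-simplex with \<open>face X 2 2 s = x\<close> and \<open>face X 2 0 s = y\<close>. In a Kan complex the edges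
  \<open>face X 2 1 s\<close> arising from all choices of representatives and fillers form exactly one class.\<close>

definition pi1 :: "'a sset \<Rightarrow> 'a \<Rightarrow> 'a set monoid" where
  "pi1 X v =
     \<lparr>carrier = loops X v // loop_homotopy X v,
      monoid.mult = (\<lambda>A B. {face X 2 1 s |s. s \<in> simplices X 2 \<and> face X 2 2 s \<in> A \<and> face X 2 0 s \<in> B}),
      monoid.one = loop_homotopy X v `` {degen X 0 0 v}\<rparr>"

definition pi1_map :: "'b sset \<Rightarrow> 'b \<Rightarrow> (nat \<Rightarrow> 'a \<Rightarrow> 'b) \<Rightarrow> 'a set \<Rightarrow> 'b set" where
  "pi1_map Y w f A = loop_homotopy Y w `` (f 1 ` A)"


section \<open>Integral completion of spaces and of groups\<close>

text \<open>The Bousfield--Kan $\mathbb Z$-completion of a reduced simplicial set, in the model obtained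
  from the loop group by dimensionwise completion.\<close>

definition Z_completion :: "'x sset \<Rightarrow> (nat \<Rightarrow> 'x fword set) list sset" where
  "Z_completion X = wbar (completion_sgroup (loop_group X))"

definition Z_completion_map ::
    "'y sset \<Rightarrow> (nat \<Rightarrow> 'x \<Rightarrow> 'y) \<Rightarrow> nat \<Rightarrow> (nat \<Rightarrow> 'x fword set) list \<Rightarrow> (nat \<Rightarrow> 'y fword set) list" where
  "Z_completion_map Y f = wbar_map (completion_sgroup_map (loop_group Y) (loop_group_map Y f))"

text \<open>The list \<open>[]\<close> is the only vertex of \<open>wbar K\<close>.\<close>

definition Z_inf :: "'a monoid \<Rightarrow> (nat \<Rightarrow> 'a list fword set) list set monoid" where
  "Z_inf G = pi1 (Z_completion (BG G)) []"

definition Z_inf_map ::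
    "'b monoid \<Rightarrow> ('a \<Rightarrow> 'b) \<Rightarrow>
     (nat \<Rightarrow> 'a list fword set) list set \<Rightarrow> (nat \<Rightarrow> 'b list fword set) list set" where
  "Z_inf_map G p = pi1_map (Z_completion (BG G)) [] (Z_completion_map (BG G) (wbar_map (\<lambda>n. p)))"

text \<open>The augmentation of the free resolution \<open>loop_group (BG G)\<close> of \<open>G\<close>, i.e. the counit of the
  adjunction: in every dimension it sends the class of a simplex $(g_n,\dots,g_0)$ to $g_n$.\<close>

definition augmentation :: "'a monoid \<Rightarrow> nat \<Rightarrow> 'a list fword \<Rightarrow> 'a" where
  "augmentation G n = free_lift G hd"

text \<open>A 1-simplex of \<open>Z_completion (BG G)\<close> is a one-element list \<open>[k]\<close> with \<open>k\<close> in the completion of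
  \<open>loop_level (BG G) 0\<close>; the natural map sends the class of \<open>[k]\<close> to the image of \<open>k\<close> under the
  completed augmentation, which is the same for all representatives.\<close>

definition Z_inf_to_hat ::
    "'a monoid \<Rightarrow> (nat \<Rightarrow> 'a list fword set) list set \<Rightarrow> nat \<Rightarrow> 'a set" where
  "Z_inf_to_hat G A =
     the_elem ((\<lambda>ks. completion_map G (carrier G) (augmentation G 0) (hd ks)) ` A)"

text \<open>Meaningful when \<open>Z_inf_to_hat E\<close> is an isomorphism.\<close>

definition hat_to_Z_inf ::
    "'a monoid \<Rightarrow> 'b monoid \<Rightarrow> ('a \<Rightarrow> 'b) \<Rightarrow> (nat \<Rightarrow> 'a set) \<Rightarrow> (nat \<Rightarrow> 'b list fword set) list set" where
  "hat_to_Z_inf E G p x = Z_inf_map G p (inv_into (carrier (Z_inf E)) (Z_inf_to_hat E) x)"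

end

theory Submission
  imports Defs "HOL-Algebra.Multiplicative_Group"
begin

text \<open>Let $F$ be the free group on the nontrivial elements of $E$ and $R$ the kernel of $F \to E$.
  In the split simplicial group $F_1 \to F_0$ the intersections of the kernel of $d_1$ with the lower
  central series are its relative lower central series, so $\mathbb Z_\infty E$ is the quotient of
  $\widehat F$ by the image of $\widehat R_F$, and likewise for $G$. Comparing the free groups on $E$
  and on $G$, both the kernel of $\widehat E \to \mathbb Z_\infty G$ and the image of $\widehat U_E$
  become the image of $\widehat S_F$, where $S$ is the kernel of $F \to G$, once
  $\mathbb Z_\infty E \to \widehat E$ is injective.

  Injectivity holds as soon as the groups
  $D_n = (R \cap \gamma_n F)/\gamma_n(R, F)$ are finite, by a compactness argument. By Hopf's formula
  $D_2$ is a quotient of $H_2 E$. For the step from $n$ to $n + 1$ one uses pairs of endomorphisms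
  $a, d$ of $F$ that agree modulo $R$ and such that $a$ induces multiplication by $e$ on $F_{ab}$:
  they agree modulo $\gamma_{n+1}(R, F)$ on $\gamma_{n+1} F$, while on $\gamma_n(R, F)$ their
  difference is the $e^n$-th power up to commutators with elements of $d(F)$. Taking $d$ trivial on
  $R$ modulo $[F, F]$ bounds the exponent of
  $(\gamma_n(R, F) \cap \gamma_{n+1} F)/\gamma_{n+1}(R, F)$; taking $e = 1$ and $d(F)$ finitely
  generated shows that this group lies in a finitely generated abelian one.\<close>

section \<open>Commutators and the relative lower central series\<close>

text \<open>An element of the completion of F that dies in that of E is given by words u_n whose
  images lie in gamma_n E. A factor in gamma_n F moves u_n into R, but the new words are coherent
  only modulo gamma_n F, not modulo gamma_n(R, F); D_n measures the gap. For a split surjection the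
  gap vanishes, which settles d_1 and the comparison of the two free groups, but F -> E need not
  split. The basis of F is as large as E, so F and R need not be finitely generated, and finiteness
  has to come from E_ab and D_2. As a finitely generated abelian group is free up to torsion, F_ab
  -> E_ab has a section up to a power e. Composing it with F_ab -> E_ab and lifting to F gives the d
  that is trivial on R modulo [F, F]. Torsion of E_ab forces e > 1, so this d bounds the exponent
  only. For finite generation another d rewrites each basis element through lifts of finitely many
  generators of E_ab, which permits e = 1. Each layer is thus finitely generated and of bounded
  exponent, hence finite, and D_(n+1) is assembled from D_n and one layer.\<close>

declare rel_lcs.simps(2) [simp del]

definition commutator :: "('a, 'm) monoid_scheme \<Rightarrow> 'a \<Rightarrow> 'a \<Rightarrow> 'a" where
  "commutator E x y = x \<otimes>\<^bsub>E\<^esub> y \<otimes>\<^bsub>E\<^esub> inv\<^bsub>E\<^esub> x \<otimes>\<^bsub>E\<^esub> inv\<^bsub>E\<^esub> y"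

context group
begin

lemma inv_cancel_left:
  assumes "x \<in> carrier G" "y \<in> carrier G"
  shows "inv x \<otimes> (x \<otimes> y) = y" "x \<otimes> (inv x \<otimes> y) = y"
  using assms by (simp_all flip: m_assoc)

lemmas word_simps = m_assoc inv_mult_group inv_cancel_left

lemma commutator_closed [simp, intro]:
  "\<lbrakk>x \<in> carrier G; y \<in> carrier G\<rbrakk> \<Longrightarrow> commutator G x y \<in> carrier G"
  by (simp add: commutator_def)

lemma commutator_eq_one_iff:
  assumes "x \<in> carrier G" "y \<in> carrier G"
  shows "commutator G x y = \<one> \<longleftrightarrow> x \<otimes> y = y \<otimes> x"
  using assms inv_solve_right'[of \<one> "x \<otimes> y \<otimes> inv x" y] inv_solve_right'[of y "x \<otimes> y" x]
  by (auto simp: commutator_def)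

lemma inv_commutator:
  assumes "x \<in> carrier G" "y \<in> carrier G"
  shows "inv (commutator G x y) = commutator G y x"
  using assms by (simp add: commutator_def word_simps)

text \<open>The identity [x y, z] = x [y, z] x^-1 [x, z] loses its conjugation once x commutes with
  [y, z]. This is how commutators become bilinear in quotients where they are central.\<close>

lemma commutator_mult_left:
  assumes "x \<in> carrier G" "y \<in> carrier G" "z \<in> carrier G"
    and "x \<otimes> commutator G y z = commutator G y z \<otimes> x"
  shows "commutator G (x \<otimes> y) z = commutator G y z \<otimes> commutator G x z"
proof -
  have "commutator G (x \<otimes> y) z = x \<otimes> commutator G y z \<otimes> inv x \<otimes> commutator G x z"
    using assms(1-3) by (simp add: commutator_def word_simps)
  also have "\<dots> = commutator G y z \<otimes> commutator G x z"
    unfolding assms(4) using assms(1-3) by (simp add: m_assoc)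
  finally show ?thesis .
qed

lemma commutator_mult_right:
  assumes "x \<in> carrier G" "y \<in> carrier G" "z \<in> carrier G"
    and "y \<otimes> commutator G x z = commutator G x z \<otimes> y"
  shows "commutator G x (y \<otimes> z) = commutator G x y \<otimes> commutator G x z"
proof -
  have "commutator G x (y \<otimes> z) = commutator G x y \<otimes> (y \<otimes> commutator G x z \<otimes> inv y)"
    using assms(1-3) by (simp add: commutator_def word_simps)
  also have "\<dots> = commutator G x y \<otimes> commutator G x z"
    unfolding assms(4) using assms(1-3) by (simp add: m_assoc)
  finally show ?thesis .
qed

lemma commutes_mult:
  assumes "x \<in> carrier G" "y \<in> carrier G" "z \<in> carrier G"
    and "x \<otimes> z = z \<otimes> x" "y \<otimes> z = z \<otimes> y"
  shows "(x \<otimes> y) \<otimes> z = z \<otimes> (x \<otimes> y)"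
  using assms by (metis m_assoc)

lemma commutes_inv:
  assumes "x \<in> carrier G" "z \<in> carrier G" "x \<otimes> z = z \<otimes> x"
  shows "inv x \<otimes> z = z \<otimes> inv x"
proof -
  have "inv x \<otimes> z = inv x \<otimes> (z \<otimes> x) \<otimes> inv x" using assms(1,2) by (simp add: word_simps)
  also have "\<dots> = z \<otimes> inv x" unfolding assms(3)[symmetric] using assms(1,2) by (simp add: word_simps)
  finally show ?thesis .
qed

lemma commutator_pow_left:
  assumes "x \<in> carrier G" "z \<in> carrier G"
    and "\<And>y. y \<in> carrier G \<Longrightarrow> y \<otimes> commutator G x z = commutator G x z \<otimes> y"
  shows "commutator G (x [^] (n::nat)) z = commutator G x z [^] n"
proof (induction n)
  case 0
  then show ?case using assms by (simp add: commutator_def)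
next
  case (Suc n)
  have "commutator G (x [^] Suc n) z = commutator G x z \<otimes> commutator G (x [^] n) z"
    using assms(1,2) assms(3)[of "x [^] n"] by (simp add: commutator_mult_left)
  then show ?case using Suc assms(1,2) by (simp add: nat_pow_Suc2[symmetric] del: nat_pow_Suc)
qed

lemma commutator_pow_right:
  assumes "x \<in> carrier G" "z \<in> carrier G"
    and "\<And>y. y \<in> carrier G \<Longrightarrow> y \<otimes> commutator G x z = commutator G x z \<otimes> y"
  shows "commutator G x (z [^] (n::nat)) = commutator G x z [^] n"
proof (induction n)
  case 0
  then show ?case using assms by (simp add: commutator_def)
next
  case (Suc n)
  have "commutator G x (z [^] Suc n) = commutator G x (z [^] n) \<otimes> commutator G x z"
    using assms(1,2) assms(3)[of "z [^] n"] by (simp add: commutator_mult_right)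
  then show ?case using Suc by simp
qed

text \<open>A form of the three subgroups lemma. With P = [b^-1, t] and Q = [a^-1, t], conjugating t
  by b a and by a b gives the same element \<open>P \<otimes> Q \<otimes> t\<close>, so t commutes
  with a b (b a)^-1, which is [a, b].\<close>

lemma commutator_commutes:
  assumes "a \<in> carrier G" "b \<in> carrier G" "t \<in> carrier G"
    and q: "\<And>y. y \<in> carrier G \<Longrightarrow> y \<otimes> commutator G t (inv a) = commutator G t (inv a) \<otimes> y"
    and p: "a \<otimes> commutator G (inv b) t = commutator G (inv b) t \<otimes> a"
  shows "t \<otimes> commutator G a b = commutator G a b \<otimes> t"
proof -
  note c = assms(1-3)
  define P where "P = commutator G (inv b) t"
  define Q where "Q = inv (commutator G t (inv a))"
  have PQ: "P \<in> carrier G" "Q \<in> carrier G" using c by (auto simp: P_def Q_def)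
  have Qc: "Q \<otimes> y = y \<otimes> Q" if "y \<in> carrier G" for y
    unfolding Q_def using c that q[OF that] by (intro commutes_inv) auto
  have Pa: "inv a \<otimes> P = P \<otimes> inv a"
    using c PQ p by (intro commutes_inv) (auto simp: P_def)
  have tb: "inv b \<otimes> t = P \<otimes> t \<otimes> inv b"
    using c by (simp add: P_def commutator_def word_simps)
  have ta: "inv a \<otimes> t = Q \<otimes> t \<otimes> inv a"
    using c by (simp add: Q_def commutator_def word_simps)
  have "inv a \<otimes> inv b \<otimes> t = inv a \<otimes> (P \<otimes> t \<otimes> inv b)"
    using c tb by (simp add: m_assoc)
  also have "\<dots> = inv a \<otimes> P \<otimes> t \<otimes> inv b" using c PQ by (simp add: m_assoc)
  also have "\<dots> = P \<otimes> (inv a \<otimes> t) \<otimes> inv b" using c PQ by (simp add: Pa m_assoc)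
  also have "\<dots> = (P \<otimes> Q) \<otimes> t \<otimes> inv a \<otimes> inv b" using c PQ by (simp add: ta m_assoc)
  finally have 1: "inv (b \<otimes> a) \<otimes> t \<otimes> (b \<otimes> a) = P \<otimes> Q \<otimes> t"
    using c PQ by (simp add: word_simps)
  have "inv b \<otimes> inv a \<otimes> t = inv b \<otimes> (Q \<otimes> t \<otimes> inv a)"
    using c ta by (simp add: m_assoc)
  also have "\<dots> = (inv b \<otimes> Q) \<otimes> t \<otimes> inv a" using c PQ by (simp add: m_assoc)
  also have "\<dots> = Q \<otimes> (inv b \<otimes> t) \<otimes> inv a" using c PQ by (simp add: Qc[symmetric] m_assoc)
  also have "\<dots> = (Q \<otimes> P) \<otimes> t \<otimes> inv b \<otimes> inv a" using c PQ by (simp add: tb m_assoc)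
  finally have 2: "inv (a \<otimes> b) \<otimes> t \<otimes> (a \<otimes> b) = P \<otimes> Q \<otimes> t"
    using c PQ by (simp add: word_simps Qc)
  have "t \<otimes> (a \<otimes> b \<otimes> inv (b \<otimes> a)) = a \<otimes> b \<otimes> (inv (a \<otimes> b) \<otimes> t \<otimes> (a \<otimes> b)) \<otimes> inv (b \<otimes> a)"
    using c by (simp add: word_simps)
  also have "\<dots> = a \<otimes> b \<otimes> inv (b \<otimes> a) \<otimes> t"
    unfolding 2 1[symmetric] using c by (simp add: word_simps)
  also have "a \<otimes> b \<otimes> inv (b \<otimes> a) = commutator G a b" using c by (simp add: commutator_def word_simps)
  finally show ?thesis .
qed

end

lemma commutator_subgroup_alt:
  "commutator_subgroup E H K = generate E (\<Union>h\<in>H. \<Union>k\<in>K. {commutator E h k})"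
  by (simp add: commutator_subgroup_def commutator_def)

lemma (in group_hom) hom_commutator [simp]:
  "\<lbrakk>x \<in> carrier G; y \<in> carrier G\<rbrakk> \<Longrightarrow> h (commutator G x y) = commutator H (h x) (h y)"
  by (simp add: commutator_def)

context normal
begin

lemma group_hom_Mod: "group_hom G (G Mod H) (\<lambda>x. H #> x)"
  using r_coset_hom_Mod factorgroup_is_group by (simp add: group_hom_def group_hom_axioms_def)

lemma Mod_eq_one_iff:
  assumes "x \<in> carrier G"
  shows "H #> x = \<one>\<^bsub>G Mod H\<^esub> \<longleftrightarrow> x \<in> H"
  using assms coset_join1[OF _ assms] coset_join2[OF assms] subgroup_axioms subset by (metis one_FactGroup)

lemma Mod_eq_iff:
  assumes "x \<in> carrier G" "y \<in> carrier G"
  shows "H #> x = H #> y \<longleftrightarrow> x \<otimes> inv y \<in> H"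
proof -
  interpret q: group_hom G "G Mod H" "\<lambda>x. H #> x" by (rule group_hom_Mod)
  have "x \<otimes> inv y \<in> H \<longleftrightarrow> (H #> x) \<otimes>\<^bsub>G Mod H\<^esub> inv\<^bsub>G Mod H\<^esub> (H #> y) = \<one>\<^bsub>G Mod H\<^esub>"
    using Mod_eq_one_iff[of "x \<otimes> inv y"] q.hom_mult[of x "inv y"] q.hom_inv[of y] assms
    by (metis inv_closed m_closed)
  also have "\<dots> \<longleftrightarrow> H #> x = H #> y"
    using q.H.inv_solve_right'[of "\<one>\<^bsub>G Mod H\<^esub>" "H #> x" "H #> y"] q.hom_closed assms
    by (metis q.H.l_one q.H.one_closed)
  finally show ?thesis by simp
qed

lemma commutator_mem:
  assumes "x \<in> H" "y \<in> carrier G"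
  shows "commutator G x y \<in> H" "commutator G y x \<in> H"
proof -
  have "x \<otimes> (y \<otimes> inv x \<otimes> inv y) \<in> H" "(y \<otimes> x \<otimes> inv y) \<otimes> inv x \<in> H"
    using assms inv_op_closed2 by (auto intro: m_closed)
  then show "commutator G x y \<in> H" "commutator G y x \<in> H"
    using assms subset by (auto simp: commutator_def m_assoc[symmetric] subset_iff)
qed

end

context group begin

lemma Mod_commutes_iff:
  assumes "N \<lhd> G" "x \<in> carrier G" "y \<in> carrier G"
  shows "(N #> x) \<otimes>\<^bsub>G Mod N\<^esub> (N #> y) = (N #> y) \<otimes>\<^bsub>G Mod N\<^esub> (N #> x) \<longleftrightarrow> commutator G x y \<in> N"
proof -
  interpret N: normal N G by fact
  interpret q: group_hom G "G Mod N" "\<lambda>x. N #> x" by (rule N.group_hom_Mod)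
  show ?thesis
    using q.H.commutator_eq_one_iff[of "N #> x" "N #> y"] assms N.Mod_eq_one_iff[of "commutator G x y"]
    by (metis commutator_closed q.hom_closed q.hom_commutator)
qed

text \<open>Conjugation permutes the generating commutators.\<close>

lemma commutator_subgroup_normal:
  assumes "H \<lhd> G" "K \<lhd> G"
  shows "commutator_subgroup G H K \<lhd> G"
  unfolding commutator_subgroup_alt
proof (rule normal_generateI)
  interpret H: normal H G by fact
  interpret K: normal K G by fact
  show "(\<Union>h\<in>H. \<Union>k\<in>K. {commutator G h k}) \<subseteq> carrier G" by auto
  fix h g assume "h \<in> (\<Union>h\<in>H. \<Union>k\<in>K. {commutator G h k})" and g: "g \<in> carrier G"
  then obtain a b where ab: "a \<in> H" "b \<in> K" "h = commutator G a b" by auto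
  have "g \<otimes> h \<otimes> inv g = commutator G (g \<otimes> a \<otimes> inv g) (g \<otimes> b \<otimes> inv g)"
    using ab g by (simp add: commutator_def word_simps)
  then show "g \<otimes> h \<otimes> inv g \<in> (\<Union>h\<in>H. \<Union>k\<in>K. {commutator G h k})"
    using H.inv_op_closed2[OF g ab(1)] K.inv_op_closed2[OF g ab(2)] by blast
qed

lemma rel_lcs_normal: "U \<lhd> G \<Longrightarrow> rel_lcs G U n \<lhd> G"
  by (induction n) (auto simp: rel_lcs.simps(2) intro: commutator_subgroup_normal normal_self)

lemma rel_lcs_commutator:
  assumes "x \<in> rel_lcs G U n" "y \<in> carrier G"
  shows "commutator G x y \<in> rel_lcs G U (Suc n)"
  using assms by (auto simp: rel_lcs.simps(2) commutator_subgroup_alt intro!: generate.incl)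

lemma rel_lcs_Suc_subset:
  assumes "U \<lhd> G"
  shows "rel_lcs G U (Suc n) \<subseteq> rel_lcs G U n"
proof -
  interpret N: normal "rel_lcs G U n" G using rel_lcs_normal[OF assms] .
  show ?thesis
    unfolding rel_lcs.simps commutator_subgroup_alt
    by (rule generate_subgroup_incl) (auto intro: N.commutator_mem N.subgroup_axioms)
qed

lemma rel_lcs_antimono:
  assumes "U \<lhd> G" "m \<le> n"
  shows "rel_lcs G U n \<subseteq> rel_lcs G U m"
  using assms(2) by (rule lift_Suc_antimono_le[where f="rel_lcs G U", OF rel_lcs_Suc_subset[OF assms(1)]])

lemma rel_lcs_subset: "U \<lhd> G \<Longrightarrow> rel_lcs G U n \<subseteq> U"
  using rel_lcs_antimono[of U 0 n] by simp

lemma rel_lcs_carrier: "U \<lhd> G \<Longrightarrow> rel_lcs G U n \<subseteq> carrier G"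
  by (meson normal_imp_subgroup rel_lcs_normal subgroup.subset)

lemma rel_lcs_mono:
  assumes "U \<subseteq> V"
  shows "rel_lcs G U n \<subseteq> rel_lcs G V n"
proof (induction n)
  case (Suc n)
  then show ?case unfolding rel_lcs.simps commutator_subgroup_alt by (intro mono_generate) blast
qed (use assms in simp)

lemma rel_lcs_Suc_subsetI:
  assumes "subgroup N G" "\<And>t f. \<lbrakk>t \<in> rel_lcs G U n; f \<in> carrier G\<rbrakk> \<Longrightarrow> commutator G t f \<in> N"
  shows "rel_lcs G U (Suc n) \<subseteq> N"
  unfolding rel_lcs.simps commutator_subgroup_alt
  using assms by (intro generate_subgroup_incl) auto

text \<open>The preimage of a centralizer in the quotient by N. Being a subgroup, it allows
  commutator conditions to be checked on generators.\<close>

lemma centralizer_mod_subgroup: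
  assumes "N \<lhd> G" "T \<subseteq> carrier G"
  shows "subgroup {z \<in> carrier G. \<forall>t\<in>T. commutator G t z \<in> N} G"
proof -
  interpret N: normal N G by fact
  interpret q: group_hom G "G Mod N" "\<lambda>x. N #> x" by (rule N.group_hom_Mod)
  have eq: "commutator G t z \<in> N \<longleftrightarrow> (N #> z) \<otimes>\<^bsub>G Mod N\<^esub> (N #> t) = (N #> t) \<otimes>\<^bsub>G Mod N\<^esub> (N #> z)"
    if "t \<in> T" "z \<in> carrier G" for t z
    using Mod_commutes_iff[OF assms(1), of t z] that assms(2) by (metis subsetD)
  show ?thesis
  proof (rule subgroupI)
    show "{z \<in> carrier G. \<forall>t\<in>T. commutator G t z \<in> N} \<noteq> {}"
      using assms(2) by (auto simp: commutator_def subset_iff N.one_closed intro!: exI[of _ \<one>])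
    fix a assume a: "a \<in> {z \<in> carrier G. \<forall>t\<in>T. commutator G t z \<in> N}"
    have "commutator G t (inv a) \<in> N" if "t \<in> T" for t
    proof -
      have "t \<in> carrier G" "a \<in> carrier G" using that a assms(2) by auto
      then show ?thesis
        using eq[OF that] a that q.H.commutes_inv[of "N #> a" "N #> t"] q.hom_closed q.hom_inv
        by (metis (no_types, lifting) inv_closed mem_Collect_eq)
    qed
    then show "inv a \<in> {z \<in> carrier G. \<forall>t\<in>T. commutator G t z \<in> N}"
      using a by simp
    fix b assume b: "b \<in> {z \<in> carrier G. \<forall>t\<in>T. commutator G t z \<in> N}"
    have "commutator G t (a \<otimes> b) \<in> N" if "t \<in> T" for t
    proof -
      have "t \<in> carrier G" "a \<in> carrier G" "b \<in> carrier G" using that a b assms(2) by auto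
      note c = this
      have "(N #> x) \<otimes>\<^bsub>G Mod N\<^esub> (N #> t) = (N #> t) \<otimes>\<^bsub>G Mod N\<^esub> (N #> x)" if "x \<in> {a, b}" for x
        using eq[OF \<open>t \<in> T\<close>, of x] that c a b \<open>t \<in> T\<close> by blast
      then have "(N #> (a \<otimes> b)) \<otimes>\<^bsub>G Mod N\<^esub> (N #> t) = (N #> t) \<otimes>\<^bsub>G Mod N\<^esub> (N #> (a \<otimes> b))"
        unfolding q.hom_mult[OF c(2,3)]
        by (intro q.H.commutes_mult) (use c in \<open>auto simp del: mult_FactGroup\<close>)
      then show ?thesis using eq[OF that, of "a \<otimes> b"] c by blast
    qed
    then show "a \<otimes> b \<in> {z \<in> carrier G. \<forall>t\<in>T. commutator G t z \<in> N}"
      using a b by simp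
  qed auto
qed

text \<open>Induction on j, for all i at once. For a generator [a, b] of the next term the
  hypothesis is used for [t, a^-1] at index i and for [[b^-1, t], a] at index i + 1;
  \<open>commutator_commutes\<close> in the quotient then handles [t, [a, b]]. The
  \<open>Suc\<close> is the index shift: in unshifted numbering the indices simply add.\<close>

lemma rel_lcs_commutator_lcs:
  assumes U: "U \<lhd> G" and "t \<in> rel_lcs G U i" "z \<in> rel_lcs G (carrier G) j"
  shows "commutator G t z \<in> rel_lcs G U (Suc (i + j))"
  using assms(2,3)
proof (induction j arbitrary: i t z)
  case 0
  then show ?case using rel_lcs_commutator by auto
next
  case (Suc j)
  let ?N = "rel_lcs G U (Suc (i + Suc j))"
  have N: "?N \<lhd> G" by (rule rel_lcs_normal[OF U])
  interpret N: normal ?N G by (rule N)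
  interpret q: group_hom G "G Mod ?N" "\<lambda>x. ?N #> x" by (rule N.group_hom_Mod)
  have ti: "rel_lcs G U i \<subseteq> carrier G" by (rule rel_lcs_carrier[OF U])
  interpret J: normal "rel_lcs G (carrier G) j" G by (rule rel_lcs_normal[OF normal_self])
  interpret I: normal "rel_lcs G U (Suc i)" G by (rule rel_lcs_normal[OF U])
  have "rel_lcs G (carrier G) (Suc j) \<subseteq> {z \<in> carrier G. \<forall>t\<in>rel_lcs G U i. commutator G t z \<in> ?N}"
  proof (rule rel_lcs_Suc_subsetI[OF centralizer_mod_subgroup[OF N ti]])
    fix a b assume a: "a \<in> rel_lcs G (carrier G) j" and b: "b \<in> carrier G"
    have ac: "a \<in> carrier G" using a by simp
    have "commutator G t (commutator G a b) \<in> ?N" if t: "t \<in> rel_lcs G U i" for t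
    proof -
      have tc: "t \<in> carrier G" using t ti by auto
      have "commutator G t (inv a) \<in> rel_lcs G U (Suc (i + j))"
        using Suc.IH[OF t] a by simp
      then have 1: "commutator G (commutator G t (inv a)) y \<in> ?N" if "y \<in> carrier G" for y
        using rel_lcs_commutator[OF _ that] by (metis add_Suc_right)
      have "commutator G t (inv b) \<in> rel_lcs G U (Suc i)"
        using rel_lcs_commutator[OF t] b by simp
      then have "commutator G (inv b) t \<in> rel_lcs G U (Suc i)"
        using inv_commutator[of t "inv b"] tc b I.m_inv_closed by (metis inv_closed)
      then have 2: "commutator G (commutator G (inv b) t) a \<in> ?N"
        using Suc.IH[OF _ a] by (metis add_Suc add_Suc_right)
      have "(?N #> t) \<otimes>\<^bsub>G Mod ?N\<^esub> commutator (G Mod ?N) (?N #> a) (?N #> b)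
          = commutator (G Mod ?N) (?N #> a) (?N #> b) \<otimes>\<^bsub>G Mod ?N\<^esub> (?N #> t)"
      proof (rule q.H.commutator_commutes)
        fix y assume "y \<in> carrier (G Mod ?N)"
        then obtain y' where y: "y' \<in> carrier G" "y = ?N #> y'" by (auto simp only: carrier_FactGroup)
        show "y \<otimes>\<^bsub>G Mod ?N\<^esub> commutator (G Mod ?N) (?N #> t) (inv\<^bsub>G Mod ?N\<^esub> (?N #> a)) =
          commutator (G Mod ?N) (?N #> t) (inv\<^bsub>G Mod ?N\<^esub> (?N #> a)) \<otimes>\<^bsub>G Mod ?N\<^esub> y"
          using iffD2[OF Mod_commutes_iff[OF N, of "commutator G t (inv a)" y'] 1] tc ac y
          by (simp only: q.hom_commutator q.hom_inv inv_closed commutator_closed)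
      next
        show "(?N #> a) \<otimes>\<^bsub>G Mod ?N\<^esub> commutator (G Mod ?N) (inv\<^bsub>G Mod ?N\<^esub> (?N #> b)) (?N #> t) =
          commutator (G Mod ?N) (inv\<^bsub>G Mod ?N\<^esub> (?N #> b)) (?N #> t) \<otimes>\<^bsub>G Mod ?N\<^esub> (?N #> a)"
          using iffD2[OF Mod_commutes_iff[OF N, of "commutator G (inv b) t" a] 2] tc ac b
          by (simp only: q.hom_commutator q.hom_inv inv_closed commutator_closed)
      qed (use tc ac b in \<open>simp_all only: q.hom_closed\<close>)
      then show ?thesis
        using Mod_commutes_iff[OF N, of t "commutator G a b"] tc ac b
        by (metis q.hom_commutator commutator_closed)
    qed
    then show "commutator G a b \<in> {z \<in> carrier G. \<forall>t\<in>rel_lcs G U i. commutator G t z \<in> ?N}"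
      using ac b by simp
  qed
  then show ?case using Suc.prems by auto
qed

end

context group
begin

text \<open>Inductive step of \<open>hom_congr_lcs\<close>: \<open>u\<close> and \<open>r\<close>
  are the discrepancies between two homomorphisms, at an element of the lower central series and at
  an arbitrary element.\<close>

lemma commutator_congr:
  assumes c: "u \<in> carrier G" "d \<in> carrier G" "r \<in> carrier G" "f \<in> carrier G"
    and u: "\<And>g. g \<in> carrier G \<Longrightarrow> u \<otimes> g = g \<otimes> u"
    and r: "r \<otimes> d = d \<otimes> r" "r \<otimes> commutator G d f = commutator G d f \<otimes> r"
  shows "commutator G (u \<otimes> d) (r \<otimes> f) = commutator G d f"
proof -
  have 1: "commutator G u (r \<otimes> f) = \<one>" "commutator G d r = \<one>"
    using c u[of "r \<otimes> f"] r by (simp_all add: commutator_eq_one_iff)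
  have "commutator G (u \<otimes> d) (r \<otimes> f) = commutator G d (r \<otimes> f) \<otimes> commutator G u (r \<otimes> f)"
    using c u[of "commutator G d (r \<otimes> f)"] by (intro commutator_mult_left) auto
  also have "\<dots> = commutator G d (r \<otimes> f)" unfolding 1 using c by simp
  also have "\<dots> = commutator G d r \<otimes> commutator G d f"
    using c r by (intro commutator_mult_right) auto
  also have "\<dots> = commutator G d f" unfolding 1 using c by simp
  finally show ?thesis .
qed

text \<open>The computation behind \<open>hom_power_lcs\<close>, in a quotient where commutators
  with x, t and u are central. Expanding [x, f]^(mk) bilinearly gives [u, r e] [t, r] [t, e], and
  expanding [u d, r e] gives [t, r] [d, e] [u, r e]; everything but [t, e] cancels.\<close>

lemma commutator_power_formula:
  assumes c: "x \<in> carrier G" "f \<in> carrier G" "z \<in> carrier G" "t \<in> carrier G" "u \<in> carrier G"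
      "d \<in> carrier G" "r \<in> carrier G" "e \<in> carrier G"
    and xc: "\<And>y g. \<lbrakk>y \<in> carrier G; g \<in> carrier G\<rbrakk> \<Longrightarrow> commutator G x y \<otimes> g = g \<otimes> commutator G x y"
    and tc: "\<And>y g. \<lbrakk>y \<in> carrier G; g \<in> carrier G\<rbrakk> \<Longrightarrow> commutator G t y \<otimes> g = g \<otimes> commutator G t y"
    and uc: "\<And>y g. \<lbrakk>y \<in> carrier G; g \<in> carrier G\<rbrakk> \<Longrightarrow> commutator G u y \<otimes> g = g \<otimes> commutator G u y"
    and zc: "\<And>g. g \<in> carrier G \<Longrightarrow> z \<otimes> g = g \<otimes> z"
    and xpow: "x [^] (m::nat) = z \<otimes> (t \<otimes> u)"
    and fpow: "commutator G x (f [^] (k::nat)) = commutator G x (r \<otimes> e)"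
    and dt: "commutator G d r = commutator G t r"
    and ud: "u \<otimes> commutator G d (r \<otimes> e) = commutator G d (r \<otimes> e) \<otimes> u"
    and rd: "r \<otimes> commutator G d e = commutator G d e \<otimes> r"
  shows "commutator G x f [^] (m * k) \<otimes> commutator G d e \<otimes> inv (commutator G (u \<otimes> d) (r \<otimes> e))
           = commutator G t e"
proof -
  have "commutator G x f [^] (m * k) = (commutator G x f [^] k) [^] m"
    using c by (simp add: nat_pow_pow mult.commute)
  also have "\<dots> = commutator G x (r \<otimes> e) [^] m"
    using c xc by (simp add: commutator_pow_right[symmetric] fpow)
  also have "\<dots> = commutator G (x [^] m) (r \<otimes> e)"
    using c xc[of "r \<otimes> e"] by (intro commutator_pow_left[symmetric]) auto
  also have "\<dots> = commutator G (t \<otimes> u) (r \<otimes> e) \<otimes> commutator G z (r \<otimes> e)"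
    unfolding xpow using c zc[of "commutator G (t \<otimes> u) (r \<otimes> e)"]
    by (intro commutator_mult_left) auto
  also have "commutator G z (r \<otimes> e) = \<one>"
    using c zc[of "r \<otimes> e"] by (simp add: commutator_eq_one_iff)
  also have "commutator G (t \<otimes> u) (r \<otimes> e) = commutator G u (r \<otimes> e) \<otimes> commutator G t (r \<otimes> e)"
    using c uc[of "r \<otimes> e" t] by (intro commutator_mult_left) auto
  also have "commutator G t (r \<otimes> e) = commutator G t r \<otimes> commutator G t e"
    using c tc[of e r] by (intro commutator_mult_right) auto
  finally have 1: "commutator G x f [^] (m * k) =
      commutator G u (r \<otimes> e) \<otimes> (commutator G t r \<otimes> commutator G t e)"
    using c by simp
  have "commutator G (u \<otimes> d) (r \<otimes> e) = commutator G d (r \<otimes> e) \<otimes> commutator G u (r \<otimes> e)"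
    using c ud by (intro commutator_mult_left) auto
  also have "commutator G d (r \<otimes> e) = commutator G d r \<otimes> commutator G d e"
    using c rd by (intro commutator_mult_right) auto
  finally have 2: "commutator G (u \<otimes> d) (r \<otimes> e) =
      commutator G t r \<otimes> commutator G d e \<otimes> commutator G u (r \<otimes> e)" unfolding dt .
  define A B C D where "A = commutator G u (r \<otimes> e)" and "B = commutator G t r"
    and "C = commutator G t e" and "D = commutator G d e"
  have cl: "A \<in> carrier G" "B \<in> carrier G" "C \<in> carrier G" "D \<in> carrier G"
    using c by (auto simp: A_def B_def C_def D_def)
  have "A \<otimes> (B \<otimes> C) \<otimes> D \<otimes> inv (B \<otimes> D \<otimes> A) = A \<otimes> (B \<otimes> C) \<otimes> (D \<otimes> inv A \<otimes> inv D) \<otimes> inv B"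
    using cl by (simp add: word_simps)
  also have "\<dots> = A \<otimes> (B \<otimes> C) \<otimes> (inv A \<otimes> D \<otimes> inv D) \<otimes> inv B"
    using cl uc[of "r \<otimes> e" D] c commutes_inv[of A D] by (simp add: A_def)
  also have "\<dots> = (A \<otimes> (B \<otimes> C)) \<otimes> inv A \<otimes> inv B"
    using cl by (simp add: word_simps)
  also have "\<dots> = ((C \<otimes> B) \<otimes> A) \<otimes> inv A \<otimes> inv B"
    using cl uc[of "r \<otimes> e" "B \<otimes> C"] tc[of e B] c by (simp add: A_def B_def C_def)
  also have "\<dots> = C" using cl by (simp add: word_simps)
  finally show ?thesis unfolding 1 2 A_def B_def C_def D_def .
qed

lemma Mod_rel_lcs_central:
  assumes "U \<lhd> G" "t \<in> rel_lcs G U n" "g \<in> carrier (G Mod rel_lcs G U (Suc n))"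
  shows "(rel_lcs G U (Suc n) #> t) \<otimes>\<^bsub>G Mod rel_lcs G U (Suc n)\<^esub> g = g \<otimes>\<^bsub>G Mod rel_lcs G U (Suc n)\<^esub> (rel_lcs G U (Suc n) #> t)"
proof -
  obtain g' where "g' \<in> carrier G" "g = rel_lcs G U (Suc n) #> g'"
    using assms(3) by (auto simp only: carrier_FactGroup)
  then show ?thesis
    using Mod_commutes_iff[OF rel_lcs_normal[OF assms(1), of "Suc n"], of t g'] assms(2)
      rel_lcs_carrier[OF assms(1)] rel_lcs_commutator by (metis subsetD)
qed

end

context group_hom
begin

lemma hom_rel_lcs:
  assumes "U \<subseteq> carrier G" "h ` U \<subseteq> V" "V \<lhd> H" "t \<in> rel_lcs G U n"
  shows "h t \<in> rel_lcs H V n"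
proof -
  have "rel_lcs G U n \<subseteq> carrier G \<and> h ` rel_lcs G U n \<subseteq> rel_lcs H V n"
  proof (induction n)
    case 0
    then show ?case using assms by simp
  next
    case (Suc n)
    have 1: "(\<Union>x\<in>rel_lcs G U n. \<Union>k\<in>carrier G. {commutator G x k}) \<subseteq> carrier G"
      using Suc by auto
    have "h ` (\<Union>x\<in>rel_lcs G U n. \<Union>k\<in>carrier G. {commutator G x k})
        \<subseteq> (\<Union>x\<in>rel_lcs H V n. \<Union>k\<in>carrier H. {commutator H x k})"
    proof -
      have "h (commutator G x k) = commutator H (h x) (h k) \<and> h x \<in> rel_lcs H V n \<and> h k \<in> carrier H"
        if "x \<in> rel_lcs G U n" "k \<in> carrier G" for x k
        using that Suc by auto
      then show ?thesis by fastforce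
    qed
    then show ?case
      unfolding rel_lcs.simps commutator_subgroup_alt generate_img[OF 1, symmetric]
      using G.generate_incl[OF 1] H.mono_generate by blast
  qed
  then show ?thesis using assms(4) by blast
qed

lemma image_rel_lcs:
  assumes "U \<lhd> G" "h ` carrier G = carrier H"
  shows "h ` rel_lcs G U n = rel_lcs H (h ` U) n"
proof (induction n)
  case (Suc n)
  have sub: "rel_lcs G U n \<subseteq> carrier G" by (rule G.rel_lcs_carrier[OF assms(1)])
  have 1: "(\<Union>x\<in>rel_lcs G U n. \<Union>k\<in>carrier G. {commutator G x k}) \<subseteq> carrier G"
    using sub by auto
  have "h ` (\<Union>x\<in>rel_lcs G U n. \<Union>k\<in>carrier G. {commutator G x k})
      = (\<Union>x\<in>rel_lcs G U n. \<Union>k\<in>carrier G. {commutator H (h x) (h k)})"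
    using sub by (auto simp: image_UN subset_iff)
  also have "\<dots> = (\<Union>x\<in>h ` rel_lcs G U n. \<Union>k\<in>h ` carrier G. {commutator H x k})"
    by auto
  finally show ?case
    unfolding rel_lcs.simps commutator_subgroup_alt generate_img[OF 1, symmetric] Suc assms(2) by simp
qed simp

end

text \<open>Induction along the lower central series. On a commutator [t, f] the discrepancies are u
  = a(t) d(t)^-1, central modulo the next term, and r = a(f) d(f)^-1 in R. By
  \<open>rel_lcs_commutator_lcs\<close> r commutes modulo that term with d(t) and with [d(t), d(f)],
  so both disappear from the commutator.\<close>

lemma hom_congr_lcs:
  assumes G: "group G" and P: "group P" and R: "R \<lhd> G" and a: "a \<in> hom P G" and d: "d \<in> hom P G"
    and cong: "\<And>f. f \<in> carrier P \<Longrightarrow> a f \<otimes>\<^bsub>G\<^esub> inv\<^bsub>G\<^esub> (d f) \<in> R"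
    and t: "t \<in> rel_lcs P (carrier P) n"
  shows "a t \<otimes>\<^bsub>G\<^esub> inv\<^bsub>G\<^esub> (d t) \<in> rel_lcs G R n"
  using t
proof (induction n arbitrary: t)
  case 0
  then show ?case using cong by simp
next
  case (Suc n)
  interpret G: group G by fact
  interpret P: group P by fact
  interpret a: group_hom P G a using a G P by (simp add: group_hom_def group_hom_axioms_def)
  interpret d: group_hom P G d using d G P by (simp add: group_hom_def group_hom_axioms_def)
  let ?N = "rel_lcs G R (Suc n)"
  interpret N: normal ?N G by (rule G.rel_lcs_normal[OF R])
  let ?q = "\<lambda>x. ?N #>\<^bsub>G\<^esub> x"
  interpret q: group_hom G "G Mod ?N" ?q by (rule N.group_hom_Mod)
  interpret qa: group_hom P "G Mod ?N" "\<lambda>x. ?q (a x)"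
    using hom_compose[OF a N.r_coset_hom_Mod] by (simp add: group_hom_def group_hom_axioms_def comp_def)
  interpret qd: group_hom P "G Mod ?N" "\<lambda>x. ?q (d x)"
    using hom_compose[OF d N.r_coset_hom_Mod] by (simp add: group_hom_def group_hom_axioms_def comp_def)
  have sub: "subgroup {t \<in> carrier P. ?q (a t) = ?q (d t)} P"
    by (rule P.subgroupI) (use P.one_closed qa.hom_one qd.hom_one qa.hom_inv qd.hom_inv qa.hom_mult qd.hom_mult in auto)
  have "rel_lcs P (carrier P) (Suc n) \<subseteq> {t \<in> carrier P. ?q (a t) = ?q (d t)}"
  proof (rule P.rel_lcs_Suc_subsetI[OF sub])
    fix t f assume t: "t \<in> rel_lcs P (carrier P) n" and f: "f \<in> carrier P"
    have tc: "t \<in> carrier P" using t P.rel_lcs_carrier[OF P.normal_self] by blast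
    define u where "u = a t \<otimes>\<^bsub>G\<^esub> inv\<^bsub>G\<^esub> (d t)"
    define r where "r = a f \<otimes>\<^bsub>G\<^esub> inv\<^bsub>G\<^esub> (d f)"
    have u: "u \<in> rel_lcs G R n" unfolding u_def by (rule Suc.IH[OF t])
    have r: "r \<in> rel_lcs G R 0" unfolding r_def using cong[OF f] by simp
    have dt: "d t \<in> rel_lcs G (carrier G) n"
      by (rule d.hom_rel_lcs[OF _ _ G.normal_self t]) auto
    have dtf: "commutator G (d t) (d f) \<in> rel_lcs G (carrier G) (Suc n)"
      using G.rel_lcs_commutator[OF dt] f d.hom_closed by blast
    have cl: "u \<in> carrier G" "r \<in> carrier G" "d t \<in> carrier G" "d f \<in> carrier G" "a t \<in> carrier G" "a f \<in> carrier G"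
      using tc f by (auto simp: u_def r_def)
    have n1: "commutator G r (d t) \<in> ?N"
      using G.rel_lcs_commutator_lcs[OF R r dt] by simp
    have n2: "commutator G r (commutator G (d t) (d f)) \<in> ?N"
      using G.rel_lcs_commutator_lcs[OF R r dtf] G.rel_lcs_Suc_subset[OF R, of "Suc n"]
      by (metis add_0 subsetD)
    have at: "a t = u \<otimes>\<^bsub>G\<^esub> d t" "a f = r \<otimes>\<^bsub>G\<^esub> d f"
      using cl unfolding u_def r_def by (simp_all add: G.word_simps)
    have "?q (a (commutator P t f)) = commutator (G Mod ?N) (?q u \<otimes>\<^bsub>G Mod ?N\<^esub> ?q (d t)) (?q r \<otimes>\<^bsub>G Mod ?N\<^esub> ?q (d f))"
      using cl tc f by (simp only: at a.hom_commutator q.hom_commutator q.hom_mult G.m_closed)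
    also have "\<dots> = commutator (G Mod ?N) (?q (d t)) (?q (d f))"
    proof (rule q.H.commutator_congr)
      show "?q r \<otimes>\<^bsub>G Mod ?N\<^esub> ?q (d t) = ?q (d t) \<otimes>\<^bsub>G Mod ?N\<^esub> ?q r"
        by (rule iffD2[OF G.Mod_commutes_iff[OF N.normal_axioms cl(2,3)] n1])
      show "?q r \<otimes>\<^bsub>G Mod ?N\<^esub> commutator (G Mod ?N) (?q (d t)) (?q (d f)) = commutator (G Mod ?N) (?q (d t)) (?q (d f)) \<otimes>\<^bsub>G Mod ?N\<^esub> ?q r"
        using iffD2[OF G.Mod_commutes_iff[OF N.normal_axioms cl(2) G.commutator_closed[OF cl(3,4)]] n2]
        by (simp only: q.hom_commutator[OF cl(3,4)])
      show "\<And>g. g \<in> carrier (G Mod ?N) \<Longrightarrow> ?q u \<otimes>\<^bsub>G Mod ?N\<^esub> g = g \<otimes>\<^bsub>G Mod ?N\<^esub> ?q u"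
        by (rule G.Mod_rel_lcs_central[OF R u])
    qed (use cl q.hom_closed in blast)+
    also have "\<dots> = ?q (d (commutator P t f))"
      using cl tc f by (simp only: d.hom_commutator q.hom_commutator)
    finally show "commutator P t f \<in> {t \<in> carrier P. ?q (a t) = ?q (d t)}"
      using tc f by simp
  qed
  then have tt: "t \<in> carrier P" "?q (a t) = ?q (d t)" using Suc.prems by auto
  show ?case using tt N.Mod_eq_iff[of "a t" "d t"] by simp
qed

section \<open>Homomorphisms congruent modulo a normal subgroup\<close>

context group
begin

lemma central_shuffle:
  assumes "k \<in> carrier G" "x \<in> carrier G" "d \<in> carrier G" "w \<in> carrier G" "j \<in> carrier G"
    and "x \<otimes> d = d \<otimes> x" "x \<otimes> j = j \<otimes> x" "w \<otimes> j = j \<otimes> w"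
  shows "k \<otimes> x \<otimes> d \<otimes> w \<otimes> j = (k \<otimes> d \<otimes> j) \<otimes> (x \<otimes> w)"
proof -
  have "k \<otimes> x \<otimes> d \<otimes> w \<otimes> j = k \<otimes> (x \<otimes> d) \<otimes> (w \<otimes> j)" using assms(1-5) by (simp add: m_assoc)
  also have "\<dots> = k \<otimes> d \<otimes> (x \<otimes> j) \<otimes> w" unfolding assms(6,8) using assms(1-5) by (simp add: m_assoc)
  also have "\<dots> = (k \<otimes> d \<otimes> j) \<otimes> (x \<otimes> w)" unfolding assms(7) using assms(1-5) by (simp add: m_assoc)
  finally show ?thesis .
qed

text \<open>The assumption \<open>dX\<close> follows from the others (see \<open>power_mem_filtration\<close>), but only by means of
  \<open>power_lcs\<close>, which is the case of this lemma where \<open>R\<close> is the whole group and \<open>d\<close> is trivial.\<close>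

lemma hom_power_lcs:
  fixes X :: "nat \<Rightarrow> 'a set" and e :: nat
  assumes R: "R \<lhd> G" and a: "a \<in> hom G G" and d: "d \<in> hom G G"
    and cong: "\<And>f. f \<in> carrier G \<Longrightarrow> a f \<otimes> inv (d f) \<in> R"
    and apow: "\<And>f. f \<in> carrier G \<Longrightarrow> inv (a f) \<otimes> f [^] e \<in> rel_lcs G (carrier G) (Suc 0)"
    and X: "\<And>n. subgroup (X n) G" "\<And>n. rel_lcs G R (Suc n) \<subseteq> X n" "\<And>n. X n \<subseteq> rel_lcs G R n"
    and X0: "\<And>r. r \<in> R \<Longrightarrow> r [^] e \<otimes> d r \<otimes> inv (a r) \<in> X 0"
    and XS: "\<And>n t f. \<lbrakk>t \<in> X n; f \<in> carrier G\<rbrakk> \<Longrightarrow> commutator G t (d f) \<in> X (Suc n)"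
    and dX: "\<And>n t. \<lbrakk>t \<in> rel_lcs G R n; t [^] (e ^ Suc n) \<otimes> d t \<otimes> inv (a t) \<in> X n\<rbrakk>
        \<Longrightarrow> inv (t [^] (e ^ Suc n) \<otimes> d t \<otimes> inv (a t)) \<otimes> d t \<in> rel_lcs G (carrier G) (Suc n)"
    and t: "t \<in> rel_lcs G R n"
  shows "t [^] (e ^ Suc n) \<otimes> d t \<otimes> inv (a t) \<in> X n"
  using t
proof (induction n arbitrary: t)
  case 0
  then show ?case using X0[of t] by simp
next
  case (Suc n)
  interpret a: group_hom G G a using a by (simp add: group_hom_def group_hom_axioms_def)
  interpret d: group_hom G G d using d by (simp add: group_hom_def group_hom_axioms_def)
  \<comment> \<open>On \<open>rel_lcs G R (Suc n)\<close> this map is multiplicative modulo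
    \<open>?N\<close>, because there the powers of t and the elements d(t) a(t)^-1 are central.
    Hence it can be tested on the generating commutators.\<close>
  define g where "g t = t [^] (e ^ Suc (Suc n)) \<otimes> d t \<otimes> inv (a t)" for t
  have Rc: "\<And>n. rel_lcs G R n \<subseteq> carrier G" by (rule rel_lcs_carrier[OF R])
  have Xc: "X n \<subseteq> carrier G" for n using X(3) Rc by blast
  interpret XS: subgroup "X (Suc n)" G by (rule X(1))
  have Rgam: "rel_lcs G R m \<subseteq> rel_lcs G (carrier G) m" for m
    using normal_imp_subgroup[OF R] by (intro rel_lcs_mono subgroup.subset)
  have Cc: "rel_lcs G (carrier G) m \<subseteq> carrier G" for m by (rule rel_lcs_carrier[OF normal_self])
  let ?N = "rel_lcs G R (Suc (Suc n))"
  interpret N: normal ?N G by (rule rel_lcs_normal[OF R])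
  interpret S: normal "rel_lcs G R (Suc n)" G by (rule rel_lcs_normal[OF R])
  define Q where "Q = G Mod ?N"
  define q where "q x = ?N #> x" for x
  have qh: "group_hom G Q q" using N.group_hom_Mod unfolding Q_def q_def .
  interpret q: group_hom G Q q by (rule qh)
  have qeq: "q x = q y \<longleftrightarrow> x \<otimes> inv y \<in> ?N" if "x \<in> carrier G" "y \<in> carrier G" for x y
    unfolding q_def by (rule N.Mod_eq_iff[OF that])
  have qcomm: "q x \<otimes>\<^bsub>Q\<^esub> q y = q y \<otimes>\<^bsub>Q\<^esub> q x" if "x \<in> carrier G" "y \<in> carrier G" "commutator G x y \<in> ?N" for x y
    unfolding q_def Q_def using Mod_commutes_iff[OF N.normal_axioms that(1,2)] that(3) by blast
  have qcen: "q s \<otimes>\<^bsub>Q\<^esub> y = y \<otimes>\<^bsub>Q\<^esub> q s" if "s \<in> rel_lcs G R (Suc n)" "y \<in> carrier Q" for s y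
    using Mod_rel_lcs_central[OF R that(1)] that(2) unfolding q_def Q_def by blast
  have congn: "a t \<otimes> inv (d t) \<in> rel_lcs G R m" if "t \<in> rel_lcs G (carrier G) m" for t m
    by (rule hom_congr_lcs[OF group_axioms group_axioms R a d cong that])
  have memX: "x \<in> X (Suc n)" if "q x = q y" "y \<in> X (Suc n)" "x \<in> carrier G" for x y
  proof -
    have y: "y \<in> carrier G" using that by simp
    have "x \<otimes> inv y \<in> X (Suc n)" using that qeq[OF that(3) y] X(2) by blast
    then have "x \<otimes> inv y \<otimes> y \<in> X (Suc n)" using that(2) by (rule XS.m_closed)
    then show ?thesis using that y by (simp add: m_assoc)
  qed
  have gc: "g t \<in> carrier G" if "t \<in> carrier G" for t using that by (simp add: g_def)
  have gmult: "q (g (s \<otimes> t)) = q (g s) \<otimes>\<^bsub>Q\<^esub> q (g t)" if s: "s \<in> rel_lcs G R (Suc n)" and t: "t \<in> rel_lcs G R (Suc n)" for s t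
  proof -
    have c: "s \<in> carrier G" "t \<in> carrier G" using s t by simp_all
    let ?k = "e ^ Suc (Suc n)"
    have st: "q s \<otimes>\<^bsub>Q\<^esub> q t = q t \<otimes>\<^bsub>Q\<^esub> q s" using qcen[OF s] c q.hom_closed by blast
    have u: "a t \<otimes> inv (d t) \<in> rel_lcs G R (Suc n)" using congn[of t "Suc n"] t Rgam by blast
    define w where "w = d t \<otimes> inv (a t)"
    have w: "w \<in> rel_lcs G R (Suc n)"
      using S.m_inv_closed[OF u] c by (simp add: w_def inv_mult_group)
    have wc: "w \<in> carrier G" using w by simp
    have tk: "t [^] ?k \<in> rel_lcs G R (Suc n)"
      using c t S.subgroup_axioms by (metis int_pow_int subgroup_int_pow_closed)
    have "q (g (s \<otimes> t)) = q ((s \<otimes> t) [^] ?k) \<otimes>\<^bsub>Q\<^esub> q (d s) \<otimes>\<^bsub>Q\<^esub> q w \<otimes>\<^bsub>Q\<^esub> q (inv (a s))"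
      using c by (simp add: g_def w_def word_simps q.H.m_assoc del: power_Suc nat_pow_Suc)
    also have "q ((s \<otimes> t) [^] ?k) = q (s [^] ?k) \<otimes>\<^bsub>Q\<^esub> q (t [^] ?k)"
      using c q.hom_closed st q.H.pow_mult_distrib[of "q s" "q t" ?k] by (simp add: q.hom_nat_pow del: power_Suc nat_pow_Suc)
    also have "q (s [^] ?k) \<otimes>\<^bsub>Q\<^esub> q (t [^] ?k) \<otimes>\<^bsub>Q\<^esub> q (d s) \<otimes>\<^bsub>Q\<^esub> q w \<otimes>\<^bsub>Q\<^esub> q (inv (a s))
      = (q (s [^] ?k) \<otimes>\<^bsub>Q\<^esub> q (d s) \<otimes>\<^bsub>Q\<^esub> q (inv (a s))) \<otimes>\<^bsub>Q\<^esub> (q (t [^] ?k) \<otimes>\<^bsub>Q\<^esub> q w)"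
    proof (rule q.H.central_shuffle)
      show "q (t [^] ?k) \<otimes>\<^bsub>Q\<^esub> q (d s) = q (d s) \<otimes>\<^bsub>Q\<^esub> q (t [^] ?k)"
        by (rule qcen[OF tk]) (use c in simp)
      show "q (t [^] ?k) \<otimes>\<^bsub>Q\<^esub> q (inv (a s)) = q (inv (a s)) \<otimes>\<^bsub>Q\<^esub> q (t [^] ?k)"
        by (rule qcen[OF tk]) (use c in simp)
      show "q w \<otimes>\<^bsub>Q\<^esub> q (inv (a s)) = q (inv (a s)) \<otimes>\<^bsub>Q\<^esub> q w"
        by (rule qcen[OF w]) (use c in simp)
    qed (use c wc in simp_all)
    also have "\<dots> = q (g s) \<otimes>\<^bsub>Q\<^esub> q (g t)"
      using c wc q.hom_closed by (simp add: g_def w_def q.H.m_assoc m_assoc del: power_Suc nat_pow_Suc)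
    finally show ?thesis .
  qed
  have sub: "subgroup {t \<in> rel_lcs G R (Suc n). g t \<in> X (Suc n)} G"
  proof (rule subgroupI)
    have g1: "g \<one> = \<one>" by (simp add: g_def del: power_Suc nat_pow_Suc)
    then show "{t \<in> rel_lcs G R (Suc n). g t \<in> X (Suc n)} \<noteq> {}"
      using S.one_closed XS.one_closed by (metis (mono_tags, lifting) empty_iff mem_Collect_eq)
    fix s assume s: "s \<in> {t \<in> rel_lcs G R (Suc n). g t \<in> X (Suc n)}"
    then have sc: "s \<in> carrier G" and s': "inv s \<in> rel_lcs G R (Suc n)" using S.m_inv_closed by simp_all
    have "q (g s) \<otimes>\<^bsub>Q\<^esub> q (g (inv s)) = \<one>\<^bsub>Q\<^esub>"
      using gmult[of s "inv s"] s s' sc by (simp add: g1)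
    then have "q (g (inv s)) = q (inv (g s))"
      using sc gc q.H.inv_unique'[of "q (g s)" "q (g (inv s))"] q.H.inv_equality[of "q (g s)" "q (g (inv s))"]
        q.H.inv_comm[of "q (g s)" "q (g (inv s))"] by simp
    then show "inv s \<in> {t \<in> rel_lcs G R (Suc n). g t \<in> X (Suc n)}"
      using memX[of "g (inv s)" "inv (g s)"] s s' sc gc XS.m_inv_closed by blast
    fix t assume t: "t \<in> {t \<in> rel_lcs G R (Suc n). g t \<in> X (Suc n)}"
    then have tc: "t \<in> carrier G" by simp
    have "q (g (s \<otimes> t)) = q (g s \<otimes> g t)"
      using gmult[of s t] s t sc tc gc by simp
    then show "s \<otimes> t \<in> {t \<in> rel_lcs G R (Suc n). g t \<in> X (Suc n)}"
      using memX[of "g (s \<otimes> t)" "g s \<otimes> g t"] s t sc tc gc XS.m_closed S.m_closed by blast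
  qed (use Rc in blast)
  have "rel_lcs G R (Suc n) \<subseteq> {t \<in> rel_lcs G R (Suc n). g t \<in> X (Suc n)}"
  proof (rule rel_lcs_Suc_subsetI[OF sub])
    fix t f assume t: "t \<in> rel_lcs G R n" and f: "f \<in> carrier G"
    let ?E = "e ^ Suc n"
    \<comment> \<open>By the induction hypothesis t^E = s u with s in \<open>X n\<close>; this
      factorization feeds the powers of one stage into the next.\<close>
    define s where "s = t [^] ?E \<otimes> d t \<otimes> inv (a t)"
    define u where "u = a t \<otimes> inv (d t)"
    define r where "r = a f \<otimes> inv (d f)"
    have tc: "t \<in> carrier G" using t Rc by blast
    have sX: "s \<in> X n" unfolding s_def by (rule Suc.IH[OF t])
    have sR: "s \<in> rel_lcs G R n" using sX X(3) by blast
    have tF: "t \<in> rel_lcs G (carrier G) n" using t Rgam by blast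
    have uR: "u \<in> rel_lcs G R n" unfolding u_def by (rule congn[OF tF])
    have rR: "r \<in> rel_lcs G R 0" unfolding r_def using cong[OF f] by simp
    have dF: "d t \<in> rel_lcs G (carrier G) n"
      by (rule d.hom_rel_lcs[OF _ _ normal_self tF]) auto
    have dsF: "inv s \<otimes> d t \<in> rel_lcs G (carrier G) (Suc n)"
      using dX[OF t] sX unfolding s_def by blast
    have c: "s \<in> carrier G" "u \<in> carrier G" "r \<in> carrier G" "d t \<in> carrier G" "d f \<in> carrier G" "a t \<in> carrier G" "a f \<in> carrier G"
      using tc f by (auto simp: s_def u_def r_def)
    have at: "a t = u \<otimes> d t" "a f = r \<otimes> d f"
      using c by (simp_all add: u_def r_def word_simps)
    have cen: "commutator Q (q x) y \<otimes>\<^bsub>Q\<^esub> g = g \<otimes>\<^bsub>Q\<^esub> commutator Q (q x) y"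
      if x: "x \<in> rel_lcs G R n" and y: "y \<in> carrier Q" and g: "g \<in> carrier Q" for x y g
    proof -
      obtain y' where y': "y' \<in> carrier G" "y = q y'"
        using y by (auto simp only: Q_def q_def carrier_FactGroup)
      have "x \<in> carrier G" using x Rc by blast
      then show ?thesis
        using qcen[OF rel_lcs_commutator[OF x y'(1)] g] y' by simp
    qed
    have q1: "q t [^]\<^bsub>Q\<^esub> ?E = \<one>\<^bsub>Q\<^esub> \<otimes>\<^bsub>Q\<^esub> (q s \<otimes>\<^bsub>Q\<^esub> q u)"
    proof -
      have "t [^] ?E = s \<otimes> u" using tc c by (simp add: s_def u_def word_simps del: nat_pow_Suc power_Suc)
      then have "q (t [^] ?E) = q s \<otimes>\<^bsub>Q\<^esub> q u" using c by (simp del: nat_pow_Suc power_Suc)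
      then show ?thesis using tc c by (simp add: q.hom_nat_pow del: nat_pow_Suc power_Suc)
    qed
    \<comment> \<open>a(f) and f^e differ by an element of [G, G], and its commutator with t lies
      two terms further down, in \<open>?N\<close>.\<close>
    have q2: "commutator Q (q t) (q f [^]\<^bsub>Q\<^esub> e) = commutator Q (q t) (q r \<otimes>\<^bsub>Q\<^esub> q (d f))"
    proof -
      define b where "b = inv (a f) \<otimes> f [^] e"
      have bF: "b \<in> rel_lcs G (carrier G) (Suc 0)" unfolding b_def by (rule apow[OF f])
      have bc: "b \<in> carrier G" using c f by (simp add: b_def)
      have "commutator G t b \<in> ?N"
        using rel_lcs_commutator_lcs[OF R t bF] by simp
      then have tb: "commutator Q (q t) (q b) = \<one>\<^bsub>Q\<^esub>"
        using qcomm[OF tc bc] tc bc by (simp add: q.H.commutator_eq_one_iff)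
      have "f [^] e = a f \<otimes> b" using c f by (simp add: b_def word_simps)
      then have "q f [^]\<^bsub>Q\<^esub> e = q (a f) \<otimes>\<^bsub>Q\<^esub> q b"
        using f bc c q.hom_mult q.hom_nat_pow by metis
      moreover have "commutator Q (q t) (q (a f) \<otimes>\<^bsub>Q\<^esub> q b) = commutator Q (q t) (q (a f)) \<otimes>\<^bsub>Q\<^esub> commutator Q (q t) (q b)"
        using tc bc c by (intro q.H.commutator_mult_right) (auto simp: tb)
      ultimately show ?thesis using tc bc c tb at(2) by simp
    qed
    \<comment> \<open>Here \<open>dX\<close> enters: s and d(t) agree modulo
      \<open>rel_lcs G (carrier G) (Suc n)\<close>, so their commutators with r in R agree modulo
      \<open>?N\<close>.\<close>
    have q3: "commutator Q (q (d t)) (q r) = commutator Q (q s) (q r)"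
    proof -
      define w where "w = inv s \<otimes> d t"
      have wF: "w \<in> rel_lcs G (carrier G) (Suc n)" unfolding w_def by (rule dsF)
      have wc: "w \<in> carrier G" using c by (simp add: w_def)
      have "commutator G r w \<in> ?N"
        using rel_lcs_commutator_lcs[OF R rR wF] by simp
      then have wr: "commutator Q (q w) (q r) = \<one>\<^bsub>Q\<^esub>"
        using qcomm[OF c(3) wc] c wc by (simp add: q.H.commutator_eq_one_iff)
      have "d t = s \<otimes> w" using c by (simp add: w_def word_simps)
      moreover have "commutator Q (q s \<otimes>\<^bsub>Q\<^esub> q w) (q r) = commutator Q (q w) (q r) \<otimes>\<^bsub>Q\<^esub> commutator Q (q s) (q r)"
        using wc c by (intro q.H.commutator_mult_left) (auto simp: wr)
      ultimately show ?thesis using wc c wr by simp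
    qed
    have q4: "q u \<otimes>\<^bsub>Q\<^esub> commutator Q (q (d t)) (q r \<otimes>\<^bsub>Q\<^esub> q (d f)) = commutator Q (q (d t)) (q r \<otimes>\<^bsub>Q\<^esub> q (d f)) \<otimes>\<^bsub>Q\<^esub> q u"
    proof -
      have "commutator G (d t) (r \<otimes> d f) \<in> rel_lcs G (carrier G) (Suc n)"
        using rel_lcs_commutator[OF dF] c by blast
      moreover have "rel_lcs G R (Suc (n + Suc n)) \<subseteq> ?N" by (rule rel_lcs_antimono[OF R]) simp
      ultimately have "commutator G u (commutator G (d t) (r \<otimes> d f)) \<in> ?N"
        using rel_lcs_commutator_lcs[OF R uR] by blast
      then show ?thesis using qcomm[of u "commutator G (d t) (r \<otimes> d f)"] c by simp
    qed
    have q5: "q r \<otimes>\<^bsub>Q\<^esub> commutator Q (q (d t)) (q (d f)) = commutator Q (q (d t)) (q (d f)) \<otimes>\<^bsub>Q\<^esub> q r"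
    proof -
      have "commutator G (d t) (d f) \<in> rel_lcs G (carrier G) (Suc n)"
        using rel_lcs_commutator[OF dF] c by blast
      then have "commutator G r (commutator G (d t) (d f)) \<in> ?N"
        using rel_lcs_commutator_lcs[OF R rR] by (metis add_0)
      then show ?thesis using qcomm[of r "commutator G (d t) (d f)"] c by simp
    qed
    have "commutator Q (q t) (q f) [^]\<^bsub>Q\<^esub> (?E * e) \<otimes>\<^bsub>Q\<^esub> commutator Q (q (d t)) (q (d f)) \<otimes>\<^bsub>Q\<^esub>
        inv\<^bsub>Q\<^esub> (commutator Q (q u \<otimes>\<^bsub>Q\<^esub> q (d t)) (q r \<otimes>\<^bsub>Q\<^esub> q (d f))) = commutator Q (q s) (q (d f))"
      by (rule q.H.commutator_power_formula[OF _ _ _ _ _ _ _ _ _ _ _ _ q1 q2 q3 q4 q5])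
        (use tc c f cen[OF t] cen[OF sR] cen[OF uR] in simp_all)
    \<comment> \<open>Modulo \<open>?N\<close> the value of g at [t, f] is [s, d(f)], and
      \<open>XS\<close> carries s from \<open>X n\<close> to \<open>X (Suc n)\<close> under
      commutators with the image of d.\<close>
    then have "q (g (commutator G t f)) = q (commutator G s (d f))"
      unfolding g_def using tc c f at by (simp add: q.hom_nat_pow mult.commute del: nat_pow_Suc)
    moreover have "commutator G s (d f) \<in> X (Suc n)" by (rule XS[OF sX f])
    ultimately have "g (commutator G t f) \<in> X (Suc n)"
      by (rule memX) (use tc f gc in blast)
    then show "commutator G t f \<in> {t \<in> rel_lcs G R (Suc n). g t \<in> X (Suc n)}"
      using rel_lcs_commutator[OF t f] by blast
  qed
  then show ?case using Suc.prems unfolding g_def by blast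
qed

end

section \<open>Finitely generated abelian groups\<close>

context comm_group
begin

lemma generate_insert_decomp:
  assumes "S \<subseteq> carrier G" "y \<in> carrier G" "x \<in> generate G (insert y S)"
  obtains z and j :: int where "z \<in> generate G S" "x = z \<otimes> y [^] j"
proof -
  have c: "z \<in> carrier G" if "z \<in> generate G S" for z using generate_in_carrier[OF assms(1) that] .
  have "\<exists>z\<in>generate G S. \<exists>j::int. x = z \<otimes> y [^] j"
    using assms(3)
  proof induction
    case one
    then show ?case by (intro bexI[of _ \<one>] exI[of _ 0]) (auto intro: generate.one)
  next
    case (incl h)
    show ?case
    proof (cases "h = y")
      case True
      then show ?thesis using assms by (intro bexI[of _ \<one>] exI[of _ 1]) (auto intro: generate.one)
    next
      case False
      then show ?thesis using assms incl by (intro bexI[of _ h] exI[of _ 0]) (auto intro: generate.incl)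
    qed
  next
    case (inv h)
    show ?case
    proof (cases "h = y")
      case True
      then show ?thesis using assms by (intro bexI[of _ \<one>] exI[of _ "-1"]) (auto intro: generate.one simp: int_pow_neg)
    next
      case False
      then show ?thesis using assms inv by (intro bexI[of _ "inv h"] exI[of _ 0]) (auto intro: generate.inv)
    qed
  next
    case (eng h1 h2)
    then obtain z1 j1 z2 j2 where z: "z1 \<in> generate G S" "z2 \<in> generate G S"
      "h1 = z1 \<otimes> y [^] (j1::int)" "h2 = z2 \<otimes> y [^] (j2::int)" by auto
    then show ?case
      using c[OF z(1)] c[OF z(2)] assms(2)
      by (intro bexI[of _ "z1 \<otimes> z2"] exI[of _ "j1 + j2"]) (auto simp: int_pow_mult m_ac intro: generate.eng)
  qed
  then show ?thesis using that by blast
qed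

lemma int_pow_mem_subgroup: "\<lbrakk>subgroup K G; x \<in> K\<rbrakk> \<Longrightarrow> x [^] (j::int) \<in> K"
  by (rule subgroup_int_pow_closed)

text \<open>Induction on the generators, writing x = z y^j with z in the span of S. Finitely many j
  suffice for the torsion elements: residues modulo d if y^d lies in the span, and otherwise only j
  = 0. Two torsion elements with the same j differ by torsion in the span.\<close>

lemma finite_torsion:
  assumes "finite S" "S \<subseteq> carrier G" "k > 0"
  shows "finite {x \<in> generate G S. x [^] (k::nat) = \<one>}"
  using assms(1,2)
proof (induction S)
  case empty
  then show ?case by (simp add: generate_empty)
next
  case (insert y S)
  let ?T = "{x \<in> generate G S. x [^] k = \<one>}"
  let ?B = "{x \<in> generate G (insert y S). x [^] k = \<one>}"
  have S: "S \<subseteq> carrier G" and y: "y \<in> carrier G" using insert.prems by auto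
  have fin: "finite ?T" using insert by auto
  have gS: "subgroup (generate G S) G" by (rule generate_is_subgroup[OF S])
  have gc: "z \<in> carrier G" if "z \<in> generate G S" for z using generate_in_carrier[OF S that] .
  have ex: "\<exists>J. finite J \<and> (\<forall>x\<in>?B. \<exists>z\<in>generate G S. \<exists>j\<in>J. x = z \<otimes> y [^] (j::int))"
  proof (cases "\<exists>d>0. y [^] (d::int) \<in> generate G S")
    case True
    then obtain d where d: "d > 0" "y [^] (d::int) \<in> generate G S" by blast
    have "\<exists>z\<in>generate G S. \<exists>j\<in>{0..<d}. x = z \<otimes> y [^] (j::int)" if x: "x \<in> ?B" for x
    proof -
      obtain z j where z: "z \<in> generate G S" "x = z \<otimes> y [^] (j::int)"
        using x generate_insert_decomp[OF S y, of x] by auto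
      have "y [^] (d * q + r) = (y [^] d) [^] q \<otimes> y [^] r" for q r :: int
        using y by (simp add: int_pow_mult int_pow_pow)
      from this[of "j div d" "j mod d"] have "y [^] j = (y [^] d) [^] (j div d) \<otimes> y [^] (j mod d)"
        by simp
      then have "x = (z \<otimes> (y [^] d) [^] (j div d)) \<otimes> y [^] (j mod d)"
        using z y gc by (simp add: m_assoc)
      moreover have "z \<otimes> (y [^] d) [^] (j div d) \<in> generate G S"
        using z d int_pow_mem_subgroup[OF gS] by (auto intro: generate.eng)
      ultimately show ?thesis using d(1) by force
    qed
    then show ?thesis by (intro exI[of _ "{0..<d}"]) auto
  next
    case False
    have "\<exists>z\<in>generate G S. \<exists>j\<in>{0}. x = z \<otimes> y [^] (j::int)" if x: "x \<in> ?B" for x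
    proof -
      obtain z j where z: "z \<in> generate G S" "x = z \<otimes> y [^] (j::int)"
        using x generate_insert_decomp[OF S y, of x] by auto
      have "z [^] k \<otimes> y [^] (j * int k) = \<one>"
        using x z y gc[OF z(1)] by (simp add: nat_pow_distrib int_pow_pow[symmetric] int_pow_int)
      then have "y [^] (j * int k) = inv (z [^] k)"
        using y gc[OF z(1)] inv_equality[of "y [^] (j * int k)" "z [^] k"] m_comm[of "z [^] k" "y [^] (j * int k)"] by simp
      moreover have "inv (z [^] k) \<in> generate G S"
        using int_pow_mem_subgroup[OF gS z(1), of "int k"] subgroup.m_inv_closed[OF gS] by (simp add: int_pow_int)
      ultimately have *: "y [^] (j * int k) \<in> generate G S" by simp
      then have **: "y [^] (- (j * int k)) \<in> generate G S"
        using y subgroup.m_inv_closed[OF gS] by (simp add: int_pow_neg)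
      have "j = 0"
      proof (rule ccontr)
        assume "j \<noteq> 0"
        then consider "j * int k > 0" | "- (j * int k) > 0"
          using \<open>k > 0\<close> by (cases "j > 0") (auto simp: mult_less_0_iff zero_less_mult_iff)
        then show False using False * ** by cases blast+
      qed
      then show ?thesis using z by auto
    qed
    then show ?thesis by (intro exI[of _ "{0}"]) auto
  qed
  then obtain J where J: "finite J" "\<And>x. x \<in> ?B \<Longrightarrow> \<exists>z\<in>generate G S. \<exists>j\<in>J. x = z \<otimes> y [^] (j::int)" by blast
  define C where "C j = {x \<in> ?B. \<exists>z\<in>generate G S. x = z \<otimes> y [^] j}" for j :: int
  have "finite (C j)" for j
  proof (cases "C j = {}")
    case False
    then obtain x0 z0 where x0: "x0 [^] k = \<one>" "z0 \<in> generate G S" "x0 = z0 \<otimes> y [^] j" by (auto simp: C_def)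
    have x0c: "x0 \<in> carrier G" using x0 gc y by simp
    have "C j \<subseteq> (\<lambda>t. t \<otimes> x0) ` ?T"
    proof
      fix x assume "x \<in> C j"
      then obtain z where z: "x [^] k = \<one>" "z \<in> generate G S" "x = z \<otimes> y [^] j" by (auto simp: C_def)
      have xc: "x \<in> carrier G" using z gc y by simp
      have "x \<otimes> inv x0 = z \<otimes> inv z0"
        using z x0 gc y by (simp add: inv_mult_group m_assoc inv_cancel_left)
      moreover have "z \<otimes> inv z0 \<in> generate G S" using z x0 subgroup.m_inv_closed[OF gS] by (auto intro: generate.eng)
      moreover have "(x \<otimes> inv x0) [^] k = \<one>"
        using xc x0c z(1) x0(1) by (simp add: nat_pow_distrib nat_pow_inv)
      ultimately have "x \<otimes> inv x0 \<in> ?T" by simp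
      moreover have "x = x \<otimes> inv x0 \<otimes> x0" using xc x0c by (simp add: m_assoc)
      ultimately show "x \<in> (\<lambda>t. t \<otimes> x0) ` ?T" by blast
    qed
    then show ?thesis using fin finite_subset by blast
  qed simp
  moreover have "?B \<subseteq> (\<Union>j\<in>J. C j)" using J(2) by (fastforce simp: C_def)
  ultimately show ?case using J(1) finite_subset by blast
qed

text \<open>Induction on the generators of the ambient group. To generators of the part of B inside
  the span of S one adds an element of B in which y has the least positive exponent, and then
  divides with remainder.\<close>

lemma subgroup_finitely_generated:
  assumes "finite S" "S \<subseteq> carrier G" "subgroup B G" "B \<subseteq> generate G S"
  shows "\<exists>T. finite T \<and> T \<subseteq> B \<and> B \<subseteq> generate G T"
  using assms
proof (induction S arbitrary: B)
  case empty
  then show ?case by (intro exI[of _ "{}"]) auto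
next
  case (insert y S)
  interpret B: subgroup B G by fact
  have S: "S \<subseteq> carrier G" and y: "y \<in> carrier G" using insert.prems by auto
  have gS: "subgroup (generate G S) G" by (rule generate_is_subgroup[OF S])
  have gc: "z \<in> carrier G" if "z \<in> generate G S" for z using generate_in_carrier[OF S that] .
  have sub: "subgroup (B \<inter> generate G S) G"
    using subgroups_Inter_pair[OF insert.prems(2) gS] .
  then obtain T0 where T0: "finite T0" "T0 \<subseteq> B \<inter> generate G S" "B \<inter> generate G S \<subseteq> generate G T0"
    using insert.IH[OF S sub] by auto
  \<comment> \<open>Only positive exponents are recorded, so that a least one exists;
    \<open>Jneg\<close> turns negative ones into positive ones by inversion.\<close>
  define J where "J = {j::nat. j > 0 \<and> (\<exists>z\<in>generate G S. z \<otimes> y [^] int j \<in> B)}"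
  have Jneg: "nat (- j) \<in> J" if "z \<in> generate G S" "z \<otimes> y [^] j \<in> B" "j < 0" for z and j :: int
  proof -
    have "inv (z \<otimes> y [^] j) \<in> B" using that by simp
    moreover have "inv (z \<otimes> y [^] j) = inv z \<otimes> y [^] (- j)"
      using gc[OF that(1)] y by (simp add: inv_mult int_pow_neg)
    ultimately show ?thesis
      using that subgroup.m_inv_closed[OF gS that(1)] by (auto simp: J_def)
  qed
  show ?case
  proof (cases "J = {}")
    case True
    have "B \<subseteq> generate G S"
    proof
      fix x assume x: "x \<in> B"
      then obtain z j where z: "z \<in> generate G S" "x = z \<otimes> y [^] (j::int)"
        using insert.prems(3) generate_insert_decomp[OF S y, of x] by blast
      have "j = 0"
      proof (rule ccontr)
        assume "j \<noteq> 0"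
        then consider "j > 0" | "j < 0" by linarith
        then show False
        proof cases
          case 1
          then have "nat j \<in> J" using z x by (auto simp: J_def)
          then show False using True by simp
        next
          case 2
          then show False using Jneg[of z j] z x True by simp
        qed
      qed
      then show "x \<in> generate G S" using z gc by simp
    qed
    then show ?thesis using T0 by (intro exI[of _ T0]) auto
  next
    case False
    define d where "d = (LEAST j. j \<in> J)"
    have dJ: "d \<in> J" unfolding d_def using False by (auto intro: LeastI)
    have dmin: "d \<le> j" if "j \<in> J" for j unfolding d_def using that by (rule Least_le)
    from dJ obtain w where w: "w \<in> generate G S" "w \<otimes> y [^] int d \<in> B" and d0: "d > 0" by (auto simp: J_def)
    let ?b = "w \<otimes> y [^] int d"
    have "B \<subseteq> generate G (insert ?b T0)"
    proof
      fix x assume x: "x \<in> B"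
      then obtain z j where z: "z \<in> generate G S" "x = z \<otimes> y [^] (j::int)"
        using insert.prems(3) generate_insert_decomp[OF S y, of x] by blast
      define q r where "q = j div int d" and "r = j mod int d"
      have j: "j = int d * q + r" and r: "0 \<le> r" "r < int d" using d0 by (auto simp: q_def r_def)
      have bB: "?b [^] q \<in> B" by (rule int_pow_mem_subgroup[OF insert.prems(2) w(2)])
      have bq: "?b [^] q = w [^] q \<otimes> y [^] (int d * q)"
        using gc[OF w(1)] y by (simp add: int_pow_distrib int_pow_pow)
      have "x \<otimes> inv (?b [^] q) = (z \<otimes> inv (w [^] q)) \<otimes> y [^] r"
      proof -
        have "x = z \<otimes> (y [^] (int d * q) \<otimes> y [^] r)" using z(2) y unfolding j by (simp add: int_pow_mult)
        then show ?thesis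
          unfolding bq using gc[OF z(1)] gc[OF w(1)] y
          by (simp add: inv_mult m_ac)
      qed
      moreover have v: "z \<otimes> inv (w [^] q) \<in> generate G S"
        using z(1) int_pow_mem_subgroup[OF gS w(1)] subgroup.m_inv_closed[OF gS] by (auto intro: generate.eng)
      moreover have xB: "x \<otimes> inv (?b [^] q) \<in> B" using x bB by auto
      ultimately have r0: "r = 0"
        using dmin[of "nat r"] r by (fastforce simp: J_def)
      have "x \<otimes> inv (?b [^] q) \<in> generate G T0"
        using \<open>x \<otimes> inv (?b [^] q) = _\<close> v gc[OF v] xB T0(3) r0 by auto
      then have 1: "x \<otimes> inv (?b [^] q) \<in> generate G (insert ?b T0)"
        using mono_generate[of T0 "insert ?b T0"] by blast
      have "insert ?b T0 \<subseteq> carrier G" using T0(2) w(2) B.subset by auto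
      then have "?b [^] q \<in> generate G (insert ?b T0)"
        by (intro int_pow_mem_subgroup[OF generate_is_subgroup] generate.incl) auto
      then have "(x \<otimes> inv (?b [^] q)) \<otimes> ?b [^] q \<in> generate G (insert ?b T0)"
        using 1 by (rule generate.eng[rotated])
      moreover have "(x \<otimes> inv (?b [^] q)) \<otimes> ?b [^] q = x"
        using x bB B.subset by (simp add: m_assoc subset_iff)
      ultimately show "x \<in> generate G (insert ?b T0)" by simp
    qed
    then show ?thesis using T0(1,2) w(2) by (intro exI[of _ "insert ?b T0"]) auto
  qed
qed

text \<open>A finitely generated abelian group is free up to torsion, so a surjection onto it splits
  up to a power. If some y^m lies in the span already treated, precompose with x -> x^m, which
  multiplies e by m. Otherwise the new generator is independent and can be sent to v^e for any
  preimage v of y.\<close>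

lemma quasi_section:
  assumes V: "comm_group V" and p: "p \<in> hom V G" and surj: "carrier G \<subseteq> p ` carrier V"
    and S: "finite S" "S \<subseteq> carrier G"
  shows "\<exists>a (e::nat). e > 0 \<and> a \<in> hom (G\<lparr>carrier := generate G S\<rparr>) V \<and> (\<forall>x\<in>generate G S. p (a x) = x [^] e)"
  using S
proof (induction S)
  case empty
  interpret V: comm_group V by fact
  interpret p: group_hom V G p using p by (simp add: group_hom_def group_hom_axioms_def)
  show ?case
    by (intro exI[of _ "\<lambda>x. \<one>\<^bsub>V\<^esub>"] exI[of _ 1]) (auto simp: generate_empty hom_def)
next
  case (insert y S)
  interpret V: comm_group V by fact
  interpret p: group_hom V G p using p by (simp add: group_hom_def group_hom_axioms_def)
  have S: "S \<subseteq> carrier G" and y: "y \<in> carrier G" using insert.prems by auto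
  have gS: "subgroup (generate G S) G" by (rule generate_is_subgroup[OF S])
  have gc: "z \<in> carrier G" if "z \<in> generate G S" for z using generate_in_carrier[OF S that] .
  have gyc: "z \<in> carrier G" if "z \<in> generate G (insert y S)" for z using generate_in_carrier[OF insert.prems that] .
  obtain a e where e: "(e::nat) > 0" and ah: "a \<in> hom (G\<lparr>carrier := generate G S\<rparr>) V"
    and pa: "\<And>x. x \<in> generate G S \<Longrightarrow> p (a x) = x [^] e" using insert.IH[OF S] by blast
  have amult: "a (x \<otimes> z) = a x \<otimes>\<^bsub>V\<^esub> a z" if "x \<in> generate G S" "z \<in> generate G S" for x z
    using ah that by (auto simp: hom_def)
  have acl: "a x \<in> carrier V" if "x \<in> generate G S" for x
    using ah that by (auto simp: hom_def)
  show ?case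
  proof (cases "\<exists>m>0. y [^] (m::nat) \<in> generate G S")
    case True
    then obtain m where m: "m > 0" "y [^] (m::nat) \<in> generate G S" by blast
    have xm: "x [^] m \<in> generate G S" if x: "x \<in> generate G (insert y S)" for x
    proof -
      obtain z j where z: "z \<in> generate G S" "x = z \<otimes> y [^] (j::int)"
        using x generate_insert_decomp[OF S y, of x] by blast
      have "x [^] m = z [^] int m \<otimes> (y [^] m) [^] j"
        using z gc y by (simp add: int_pow_distrib int_pow_int[symmetric] int_pow_pow mult.commute)
      then show ?thesis
        using m(2) z int_pow_mem_subgroup[OF gS] by (auto intro: generate.eng)
    qed
    show ?thesis
      using e m(1) xm acl pa amult gyc generate.eng
      by (intro exI[of _ "\<lambda>x. a (x [^] m)"] exI[of _ "m * e"])
        (auto simp: hom_def nat_pow_distrib nat_pow_pow)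
  next
    case False
    obtain v where v: "v \<in> carrier V" "p v = y" using surj y by blast
    have uniq: "j = j' \<and> z = z'" if "z \<in> generate G S" "z' \<in> generate G S" "z \<otimes> y [^] (j::int) = z' \<otimes> y [^] j'" for z z' j j'
    proof -
      have zc: "z \<in> carrier G" "z' \<in> carrier G" using that gc by auto
      have "y [^] (j - j') = inv z \<otimes> (z \<otimes> y [^] j) \<otimes> inv (y [^] j')"
        using zc y by (simp add: int_pow_diff inv_cancel_left)
      also have "\<dots> = inv z \<otimes> z'" unfolding that(3) using zc y by (simp add: m_assoc)
      finally have 1: "y [^] (j - j') \<in> generate G S"
        using that subgroup.m_inv_closed[OF gS] by (auto intro: generate.eng)
      then have 2: "y [^] (j' - j) \<in> generate G S"
        using y subgroup.m_inv_closed[OF gS 1] by (simp flip: int_pow_neg)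
      have "j = j'"
      proof (rule ccontr)
        assume "j \<noteq> j'"
        then consider "nat (j - j') > 0" "j - j' = int (nat (j - j'))" | "nat (j' - j) > 0" "j' - j = int (nat (j' - j))" by linarith
        then show False using False 1 2 by cases (metis int_pow_int)+
      qed
      then show ?thesis using that(3) zc y by simp
    qed
    \<comment> \<open>Well defined by \<open>uniq\<close>: y has infinite order modulo the span of
      S, so z and j are determined by z y^j.\<close>
    define b where "b x = (THE w. \<exists>z\<in>generate G S. \<exists>j::int. x = z \<otimes> y [^] j \<and> w = a z \<otimes>\<^bsub>V\<^esub> v [^]\<^bsub>V\<^esub> (int e * j))" for x
    have b: "b (z \<otimes> y [^] j) = a z \<otimes>\<^bsub>V\<^esub> v [^]\<^bsub>V\<^esub> (int e * j)" if "z \<in> generate G S" for z and j :: int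
      unfolding b_def using uniq that by (intro the_equality) (blast, metis)
    have bh: "b \<in> hom (G\<lparr>carrier := generate G (insert y S)\<rparr>) V"
    proof (rule homI)
      fix x assume "x \<in> carrier (G\<lparr>carrier := generate G (insert y S)\<rparr>)"
      then obtain z j where z: "z \<in> generate G S" "x = z \<otimes> y [^] (j::int)"
        using generate_insert_decomp[OF S y, of x] by auto
      then show "b x \<in> carrier V" using b acl v by simp
      fix x' assume "x' \<in> carrier (G\<lparr>carrier := generate G (insert y S)\<rparr>)"
      then obtain z' j' where z': "z' \<in> generate G S" "x' = z' \<otimes> y [^] (j'::int)"
        using generate_insert_decomp[OF S y, of x'] by auto
      have "x \<otimes> x' = (z \<otimes> z') \<otimes> y [^] (j + j')"
        using z z' gc y by (simp add: int_pow_mult m_ac)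
      then have "b (x \<otimes> x') = a (z \<otimes> z') \<otimes>\<^bsub>V\<^esub> v [^]\<^bsub>V\<^esub> (int e * (j + j'))"
        using b z z' generate.eng by metis
      also have "\<dots> = b x \<otimes>\<^bsub>V\<^esub> b x'"
        using z z' b acl v by (simp add: amult V.int_pow_mult distrib_left V.m_ac)
      finally show "b (x \<otimes>\<^bsub>G\<lparr>carrier := generate G (insert y S)\<rparr>\<^esub> x') = b x \<otimes>\<^bsub>V\<^esub> b x'" by simp
    qed
    have "p (b x) = x [^] e" if x: "x \<in> generate G (insert y S)" for x
    proof -
      obtain z j where z: "z \<in> generate G S" "x = z \<otimes> y [^] (j::int)"
        using generate_insert_decomp[OF S y x] by auto
      have "p (b x) = z [^] e \<otimes> y [^] (int e * j)"
        using z b acl v pa by (simp add: p.hom_int_pow)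
      also have "\<dots> = x [^] e"
        using z gc y by (simp add: int_pow_distrib int_pow_int[symmetric] int_pow_pow mult.commute)
      finally show ?thesis .
    qed
    then show ?thesis using e bh by blast
  qed
qed

end

section \<open>Finiteness of the multipliers\<close>

lemma (in normal) Mod_eq_iff_left:
  assumes "x \<in> carrier G" "y \<in> carrier G"
  shows "H #> x = H #> y \<longleftrightarrow> inv x \<otimes> y \<in> H"
proof -
  have "x \<otimes> inv y = x \<otimes> inv (inv x \<otimes> y) \<otimes> inv x" "inv x \<otimes> y = inv x \<otimes> inv (x \<otimes> inv y) \<otimes> x"
    using assms by (simp_all add: word_simps)
  then show ?thesis
    unfolding Mod_eq_iff[OF assms]
    using assms inv_op_closed2[of x "inv (inv x \<otimes> y)"] inv_op_closed1[of x "inv (x \<otimes> inv y)"] by auto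
qed

context group
begin

lemma Mod_lcs_comm_group: "comm_group (G Mod rel_lcs G (carrier G) (Suc 0))"
proof -
  interpret N: normal "rel_lcs G (carrier G) (Suc 0)" G by (rule rel_lcs_normal[OF normal_self])
  have "x \<otimes>\<^bsub>G Mod rel_lcs G (carrier G) (Suc 0)\<^esub> y = y \<otimes>\<^bsub>G Mod rel_lcs G (carrier G) (Suc 0)\<^esub> x"
    if x: "x \<in> carrier (G Mod rel_lcs G (carrier G) (Suc 0))" and y: "y \<in> carrier (G Mod rel_lcs G (carrier G) (Suc 0))" for x y
  proof -
    obtain x' where x': "x' \<in> carrier G" "x = rel_lcs G (carrier G) (Suc 0) #> x'"
      using x by (auto simp only: carrier_FactGroup)
    then show ?thesis
      using Mod_rel_lcs_central[OF normal_self, of x' 0 y] y by (simp only: rel_lcs.simps(1))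
  qed
  then show ?thesis by (rule group.group_comm_groupI[OF N.factorgroup_is_group])
qed

text \<open>Conjugation changes an element of \<open>rel_lcs G U n\<close> only by a commutator in
  \<open>rel_lcs G U (Suc n)\<close>, which lies in X.\<close>

lemma sandwiched_normal:
  assumes U: "U \<lhd> G" and X: "subgroup X G" "rel_lcs G U (Suc n) \<subseteq> X" "X \<subseteq> rel_lcs G U n"
  shows "X \<lhd> G"
proof -
  interpret X: subgroup X G by fact
  have "g \<otimes> x \<otimes> inv g \<in> X" if "x \<in> X" "g \<in> carrier G" for x g
  proof -
    have "commutator G x g \<in> X" using X that rel_lcs_commutator by blast
    then have "inv (commutator G x g) \<otimes> x \<in> X" using that by simp
    moreover have "inv (commutator G x g) \<otimes> x = g \<otimes> x \<otimes> inv g"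
      using that by (simp add: inv_commutator) (simp add: commutator_def word_simps)
    ultimately show ?thesis by simp
  qed
  then show ?thesis using X(1) by (simp add: normal_inv_iff)
qed

lemma hom_eq_on_generate:
  assumes "group H" "a \<in> hom G H" "d \<in> hom G H" "B \<subseteq> carrier G" "\<And>b. b \<in> B \<Longrightarrow> a b = d b" "x \<in> generate G B"
  shows "a x = d x"
proof -
  interpret a: group_hom G H a using assms by (simp add: group_hom_def group_hom_axioms_def)
  interpret d: group_hom G H d using assms by (simp add: group_hom_def group_hom_axioms_def)
  show ?thesis
    using assms(6)
  proof induction
    case (eng h1 h2)
    then show ?case using generate_in_carrier[OF assms(4)] by simp
  qed (use assms(4,5) in auto)
qed

text \<open>The case of \<open>hom_power_lcs\<close> where R is the whole group, d is trivial and
  \<open>X n\<close> is the lower central term following the n-th. Multiplication by e on the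
  abelianization becomes multiplication by e^(n+1) on the layer with index n, as commutators of
  weight n + 1 are multilinear there. For trivial d the condition \<open>dX\<close> is
  immediate.\<close>

lemma power_lcs:
  assumes a: "a \<in> hom G G"
    and apow: "\<And>f. f \<in> carrier G \<Longrightarrow> inv (a f) \<otimes> f [^] (e::nat) \<in> rel_lcs G (carrier G) (Suc 0)"
    and t: "t \<in> rel_lcs G (carrier G) n"
  shows "t [^] (e ^ Suc n) \<otimes> inv (a t) \<in> rel_lcs G (carrier G) (Suc n)"
proof -
  interpret a: group_hom G G a using a by (simp add: group_hom_def group_hom_axioms_def)
  interpret N1: normal "rel_lcs G (carrier G) (Suc 0)" G by (rule rel_lcs_normal[OF normal_self])
  have tc: "t \<in> carrier G" using t rel_lcs_carrier[OF normal_self] by blast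
  let ?d = "\<lambda>x. \<one>"
  have "t [^] (e ^ Suc n) \<otimes> ?d t \<otimes> inv (a t) \<in> rel_lcs G (carrier G) (Suc n)"
  proof (rule hom_power_lcs[where R="carrier G" and d="?d"])
    show "?d \<in> hom G G" by (auto simp: hom_def)
    fix n
    show "subgroup (rel_lcs G (carrier G) (Suc n)) G"
      by (rule normal_imp_subgroup[OF rel_lcs_normal[OF normal_self]])
    show "rel_lcs G (carrier G) (Suc n) \<subseteq> rel_lcs G (carrier G) n"
      by (rule rel_lcs_Suc_subset[OF normal_self])
  next
    fix r assume r: "r \<in> carrier G"
    have "r [^] e \<otimes> \<one> \<otimes> inv (a r) = a r \<otimes> (inv (a r) \<otimes> r [^] e) \<otimes> inv (a r)"
      using r by (simp add: word_simps)
    then show "r [^] e \<otimes> \<one> \<otimes> inv (a r) \<in> rel_lcs G (carrier G) (Suc 0)"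
      using N1.inv_op_closed2[OF _ apow[OF r], of "a r"] r by simp
  next
    fix n t f assume "t \<in> rel_lcs G (carrier G) (Suc n)" "f \<in> carrier G"
    then have "t \<in> carrier G" using rel_lcs_carrier[OF normal_self] by blast
    then have "commutator G t \<one> = \<one>" by (simp add: commutator_def)
    then show "commutator G t \<one> \<in> rel_lcs G (carrier G) (Suc (Suc n))"
      using normal_imp_subgroup[OF rel_lcs_normal[OF normal_self]] subgroup.one_closed by metis
  next
    fix n t assume s: "t [^] e ^ Suc n \<otimes> \<one> \<otimes> inv a t \<in> rel_lcs G (carrier G) (Suc n)"
    have sub: "subgroup (rel_lcs G (carrier G) (Suc n)) G"
      by (rule normal_imp_subgroup[OF rel_lcs_normal[OF normal_self]])
    then show "inv (t [^] e ^ Suc n \<otimes> \<one> \<otimes> inv a t) \<otimes> \<one> \<in> rel_lcs G (carrier G) (Suc n)"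
      using s by (meson subgroup.m_closed subgroup.m_inv_closed subgroup.one_closed)
  qed (use a t apow normal_self in simp_all)
  then show ?thesis using tc by (simp del: nat_pow_Suc power_Suc)
qed

text \<open>Two estimates are combined: \<open>hom_power_lcs\<close> puts t^(e^(n+1)) d(t) a(t)^-1
  into \<open>X n\<close>, and since t lies in the next lower central term, a(t) and d(t) agree
  modulo \<open>rel_lcs G R (Suc n)\<close>, so that only the power remains. The filtration X stays
  arbitrary because it serves once for exponents and once for generators.\<close>

lemma power_mem_filtration:
  fixes X :: "nat \<Rightarrow> 'a set" and e :: nat
  assumes R: "R \<lhd> G" and a: "a \<in> hom G G" and d: "d \<in> hom G G"
    and cong: "\<And>f. f \<in> carrier G \<Longrightarrow> a f \<otimes> inv (d f) \<in> R"
    and apow: "\<And>f. f \<in> carrier G \<Longrightarrow> inv (a f) \<otimes> f [^] e \<in> rel_lcs G (carrier G) (Suc 0)"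
    and X: "\<And>n. subgroup (X n) G" "\<And>n. rel_lcs G R (Suc n) \<subseteq> X n" "\<And>n. X n \<subseteq> rel_lcs G R n"
    and X0: "\<And>r. r \<in> R \<Longrightarrow> r [^] e \<otimes> d r \<otimes> inv (a r) \<in> X 0"
    and XS: "\<And>n t f. \<lbrakk>t \<in> X n; f \<in> carrier G\<rbrakk> \<Longrightarrow> commutator G t (d f) \<in> X (Suc n)"
    and t: "t \<in> rel_lcs G R n" "t \<in> rel_lcs G (carrier G) (Suc n)"
  shows "t [^] (e ^ Suc n) \<in> X n"
proof -
  interpret a: group_hom G G a using a by (simp add: group_hom_def group_hom_axioms_def)
  interpret d: group_hom G G d using d by (simp add: group_hom_def group_hom_axioms_def)
  interpret X: subgroup "X n" G by (rule X)
  have tc: "t \<in> carrier G" using t rel_lcs_carrier[OF R] by blast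
  have 1: "t [^] (e ^ Suc n) \<otimes> d t \<otimes> inv (a t) \<in> X n"
  proof (rule hom_power_lcs[OF R a d cong apow X X0 XS _ t(1)])
    \<comment> \<open>The condition \<open>dX\<close>: by \<open>power_lcs\<close> the power cancels
      a(t) modulo the next lower central term, and moving d(t) past the power costs a commutator in
      that term.\<close>
    fix n t assume "t \<in> rel_lcs G R n"
    moreover have "rel_lcs G R n \<subseteq> rel_lcs G (carrier G) n"
      using normal_imp_subgroup[OF R] by (intro rel_lcs_mono subgroup.subset)
    ultimately have tF: "t \<in> rel_lcs G (carrier G) n" by blast
    interpret N: normal "rel_lcs G (carrier G) n" G by (rule rel_lcs_normal[OF normal_self])
    interpret N1: normal "rel_lcs G (carrier G) (Suc n)" G by (rule rel_lcs_normal[OF normal_self])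
    have tc: "t \<in> carrier G" using tF by simp
    let ?T = "t [^] (e ^ Suc n)"
    have "?T \<in> rel_lcs G (carrier G) n"
      using tF N.subgroup_axioms by (metis int_pow_int subgroup_int_pow_closed)
    then have "commutator G ?T (inv (d t)) \<in> rel_lcs G (carrier G) (Suc n)"
      by (rule rel_lcs_commutator) (use tc in simp)
    moreover have "inv (?T \<otimes> inv (a t)) \<in> rel_lcs G (carrier G) (Suc n)"
      by (rule N1.m_inv_closed[OF power_lcs[OF a apow tF]])
    ultimately have "inv (?T \<otimes> inv (a t)) \<otimes> commutator G ?T (inv (d t)) \<in> rel_lcs G (carrier G) (Suc n)"
      by (rule N1.m_closed[rotated])
    moreover have "inv (?T \<otimes> inv (a t)) \<otimes> commutator G ?T (inv (d t)) = inv (?T \<otimes> d t \<otimes> inv (a t)) \<otimes> d t"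
      using tc by (simp add: commutator_def word_simps del: nat_pow_Suc power_Suc)
    ultimately show "inv (?T \<otimes> d t \<otimes> inv (a t)) \<otimes> d t \<in> rel_lcs G (carrier G) (Suc n)" by (simp only:)
  qed
  have "a t \<otimes> inv (d t) \<in> rel_lcs G R (Suc n)"
    by (rule hom_congr_lcs[OF group_axioms group_axioms R a d cong t(2)])
  then have "(t [^] (e ^ Suc n) \<otimes> d t \<otimes> inv (a t)) \<otimes> (a t \<otimes> inv (d t)) \<in> X n"
    using 1 X(2) by blast
  then show ?thesis using tc by (simp add: word_simps del: nat_pow_Suc power_Suc)
qed

end

text \<open>Freeness in the form used below: maps on the basis extend to endomorphisms. Restricting
  the target to the group itself avoids a quantifier over types, which a locale cannot express;
  uniqueness of the extension comes from generation.\<close>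

locale self_free = group +
  fixes B :: "'a set"
  assumes gens: "B \<subseteq> carrier G" "generate G B = carrier G"
    and extend: "\<And>\<phi>. (\<And>b. b \<in> B \<Longrightarrow> \<phi> b \<in> carrier G) \<Longrightarrow> \<exists>h\<in>hom G G. \<forall>b\<in>B. h b = \<phi> b"
begin

text \<open>On the basis put a(b) = r(b) d(b) with r(b) in R supplied by \<open>dB\<close>. Both
  properties spread from the basis to the whole group, the second because x -> x^e is a homomorphism
  on the abelianization.\<close>

lemma congruent_hom:
  fixes e :: nat
  assumes R: "R \<lhd> G" and d: "d \<in> hom G G"
    and dB: "\<And>b. b \<in> B \<Longrightarrow> \<exists>r\<in>R. inv (r \<otimes> d b) \<otimes> b [^] e \<in> rel_lcs G (carrier G) (Suc 0)"
  obtains a where "a \<in> hom G G" "\<And>f. f \<in> carrier G \<Longrightarrow> a f \<otimes> inv (d f) \<in> R"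
    "\<And>f. f \<in> carrier G \<Longrightarrow> inv (a f) \<otimes> f [^] e \<in> rel_lcs G (carrier G) (Suc 0)"
proof -
  interpret d: group_hom G G d using d by (simp add: group_hom_def group_hom_axioms_def)
  interpret R: normal R G by fact
  obtain r where r: "\<And>b. b \<in> B \<Longrightarrow> r b \<in> R \<and> inv (r b \<otimes> d b) \<otimes> b [^] e \<in> rel_lcs G (carrier G) (Suc 0)"
    using dB by metis
  obtain a where a: "a \<in> hom G G" "\<And>b. b \<in> B \<Longrightarrow> a b = r b \<otimes> d b"
    using extend[of "\<lambda>b. r b \<otimes> d b"] r gens(1) by (metis R.mem_carrier d.hom_closed m_closed subsetD)
  interpret a: group_hom G G a using a by (simp add: group_hom_def group_hom_axioms_def)
  interpret N1: normal "rel_lcs G (carrier G) (Suc 0)" G by (rule rel_lcs_normal[OF normal_self])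
  let ?V = "G Mod rel_lcs G (carrier G) (Suc 0)"
  interpret V: comm_group ?V by (rule Mod_lcs_comm_group)
  have "a f \<otimes> inv (d f) \<in> R" if f: "f \<in> carrier G" for f
  proof -
    have "R #> a f = R #> d f"
    proof (rule hom_eq_on_generate[OF R.factorgroup_is_group, where a="\<lambda>f. R #> a f" and d="\<lambda>f. R #> d f"])
      show "(\<lambda>f. R #> a f) \<in> hom G (G Mod R)" "(\<lambda>f. R #> d f) \<in> hom G (G Mod R)"
        using Group.hom_compose[OF a(1) R.r_coset_hom_Mod] Group.hom_compose[OF d R.r_coset_hom_Mod] by (simp_all add: comp_def)
      fix b assume b: "b \<in> B"
      then have "b \<in> carrier G" using gens by auto
      then show "R #> a b = R #> d b"
        using r[OF b] a(2)[OF b] by (subst R.Mod_eq_iff) (auto simp: m_assoc)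
    qed (use gens f in auto)
    then show ?thesis using R.Mod_eq_iff f by auto
  qed
  moreover have "inv (a f) \<otimes> f [^] e \<in> rel_lcs G (carrier G) (Suc 0)" if f: "f \<in> carrier G" for f
  proof -
    let ?q = "\<lambda>f. rel_lcs G (carrier G) (Suc 0) #> f"
    interpret q: group_hom G ?V ?q by (rule N1.group_hom_Mod)
    have eq: "?q (inv x \<otimes> y) = \<one>\<^bsub>?V\<^esub> \<longleftrightarrow> ?q x = ?q y" if "x \<in> carrier G" "y \<in> carrier G" for x y
      using that N1.Mod_eq_iff_left[OF that] N1.Mod_eq_one_iff[of "inv x \<otimes> y"] by simp
    have "?q (a f) = ?q f [^]\<^bsub>?V\<^esub> e"
    proof (rule hom_eq_on_generate[OF V.group_axioms, where a="\<lambda>f. ?q (a f)" and d="\<lambda>f. ?q f [^]\<^bsub>?V\<^esub> e"])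
      show "(\<lambda>f. ?q (a f)) \<in> hom G ?V"
        using Group.hom_compose[OF a(1) N1.r_coset_hom_Mod] by (simp add: comp_def)
      show "(\<lambda>f. ?q f [^]\<^bsub>?V\<^esub> e) \<in> hom G ?V"
        by (rule homI) (simp_all add: V.nat_pow_distrib del: mult_FactGroup)
      fix b assume b: "b \<in> B"
      then have bc: "b \<in> carrier G" using gens by auto
      have "?q (inv (a b) \<otimes> b [^] e) = \<one>\<^bsub>?V\<^esub>"
        using r[OF b] a(2)[OF b] bc by (subst N1.Mod_eq_one_iff) auto
      then show "?q (a b) = ?q b [^]\<^bsub>?V\<^esub> e"
        using eq[of "a b" "b [^] e"] bc q.hom_nat_pow by simp
    qed (use gens f in auto)
    then have "?q (inv (a f) \<otimes> f [^] e) = \<one>\<^bsub>?V\<^esub>"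
      using eq[of "a f" "f [^] e"] f q.hom_nat_pow by simp
    then show ?thesis using f N1.Mod_eq_one_iff[of "inv (a f) \<otimes> f [^] e"] by simp
  qed
  ultimately show ?thesis using that a(1) by blast
qed

text \<open>\<open>power_mem_filtration\<close> is applied to the elements whose c-th power lies in
  the next relative term. Commutators keep this condition, since [t^c, f] = [t, f]^c where [t, f] is
  central. It holds at the start because r^e d(r) a(r)^-1 lies in R and in [G, G], where c is an
  exponent by hypothesis.\<close>

lemma multiplier_exponent:
  fixes e c :: nat
  assumes R: "R \<lhd> G" and d: "d \<in> hom G G" and dR: "\<And>r. r \<in> R \<Longrightarrow> d r \<in> rel_lcs G (carrier G) (Suc 0)"
    and dB: "\<And>b. b \<in> B \<Longrightarrow> \<exists>r\<in>R. inv (r \<otimes> d b) \<otimes> b [^] e \<in> rel_lcs G (carrier G) (Suc 0)"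
    and c: "\<And>x. \<lbrakk>x \<in> R; x \<in> rel_lcs G (carrier G) (Suc 0)\<rbrakk> \<Longrightarrow> x [^] c \<in> rel_lcs G R (Suc 0)"
    and t: "t \<in> rel_lcs G R n" "t \<in> rel_lcs G (carrier G) (Suc n)"
  shows "t [^] (e ^ Suc n * c) \<in> rel_lcs G R (Suc n)"
proof -
  obtain a where a: "a \<in> hom G G" "\<And>f. f \<in> carrier G \<Longrightarrow> a f \<otimes> inv (d f) \<in> R"
    "\<And>f. f \<in> carrier G \<Longrightarrow> inv (a f) \<otimes> f [^] e \<in> rel_lcs G (carrier G) (Suc 0)"
    using congruent_hom[OF R d dB] by blast
  interpret a: group_hom G G a using a by (simp add: group_hom_def group_hom_axioms_def)
  interpret d: group_hom G G d using d by (simp add: group_hom_def group_hom_axioms_def)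
  interpret R: normal R G by fact
  interpret N1: normal "rel_lcs G (carrier G) (Suc 0)" G by (rule rel_lcs_normal[OF normal_self])
  define X where "X n = {t \<in> rel_lcs G R n. t [^] c \<in> rel_lcs G R (Suc n)}" for n
  have Rc: "rel_lcs G R n \<subseteq> carrier G" for n by (rule rel_lcs_carrier[OF R])
  have powm: "x [^] (k::nat) \<in> K" if "subgroup K G" "x \<in> K" for K x k
    using that by (metis int_pow_int subgroup_int_pow_closed)
  have "t [^] (e ^ Suc n) \<in> X n"
  proof (rule power_mem_filtration[OF R a(1) d a(2,3) _ _ _ _ _ t])
    fix n
    interpret S: normal "rel_lcs G R n" G by (rule rel_lcs_normal[OF R])
    interpret N: normal "rel_lcs G R (Suc n)" G by (rule rel_lcs_normal[OF R])
    let ?Q = "G Mod rel_lcs G R (Suc n)" and ?q = "\<lambda>x. rel_lcs G R (Suc n) #> x"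
    interpret q: group_hom G ?Q ?q by (rule N.group_hom_Mod)
    show "rel_lcs G R (Suc n) \<subseteq> X n"
      using rel_lcs_Suc_subset[OF R, of n] powm[OF N.subgroup_axioms] unfolding X_def by blast
    show "X n \<subseteq> rel_lcs G R n" by (auto simp: X_def)
    have iff: "x \<in> X n \<longleftrightarrow> ?q x [^]\<^bsub>?Q\<^esub> c = \<one>\<^bsub>?Q\<^esub>" if x: "x \<in> rel_lcs G R n" for x
    proof -
      have "x [^] c \<in> carrier G" using x by simp
      then show ?thesis using x N.Mod_eq_one_iff[of "x [^] c"] by (simp add: X_def q.hom_nat_pow[symmetric] del: one_FactGroup)
    qed
    show "subgroup (X n) G"
    proof (rule subgroupI)
      show "X n \<noteq> {}" using N.one_closed S.one_closed by (auto simp: X_def intro!: exI[of _ \<one>])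
      fix x assume x: "x \<in> X n"
      then have xS: "x \<in> rel_lcs G R n" by (simp add: X_def)
      have "?q x [^]\<^bsub>?Q\<^esub> c = \<one>\<^bsub>?Q\<^esub>" using x iff[OF xS] by blast
      then have "?q (inv x) [^]\<^bsub>?Q\<^esub> c = \<one>\<^bsub>?Q\<^esub>"
        using xS by (simp add: q.H.nat_pow_inv del: one_FactGroup)
      then show "inv x \<in> X n" using iff[of "inv x"] xS by blast
      fix y assume y: "y \<in> X n"
      then have yS: "y \<in> rel_lcs G R n" by (simp add: X_def)
      have "?q y [^]\<^bsub>?Q\<^esub> c = \<one>\<^bsub>?Q\<^esub>" using y iff[OF yS] by blast
      moreover have "?q x \<otimes>\<^bsub>?Q\<^esub> ?q y = ?q y \<otimes>\<^bsub>?Q\<^esub> ?q x"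
        by (rule Mod_rel_lcs_central[OF R xS]) (use yS in simp)
      ultimately have "?q (x \<otimes> y) [^]\<^bsub>?Q\<^esub> c = \<one>\<^bsub>?Q\<^esub>"
        using \<open>?q x [^]\<^bsub>?Q\<^esub> c = _\<close> xS yS
        by (simp add: q.H.pow_mult_distrib del: one_FactGroup mult_FactGroup)
      then show "x \<otimes> y \<in> X n" using iff[of "x \<otimes> y"] xS yS by blast
    qed (use Rc in \<open>auto simp: X_def\<close>)
  next
    fix r assume r: "r \<in> R"
    have rc: "r \<in> carrier G" using r by simp
    have dra: "d r \<otimes> inv (a r) \<in> R"
      using R.m_inv_closed[OF a(2)[OF rc]] rc by (simp add: inv_mult_group)
    have "r [^] e \<otimes> (d r \<otimes> inv (a r)) \<in> R"
      using powm[OF R.subgroup_axioms r] dra by (rule R.m_closed)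
    then have 1: "r [^] e \<otimes> d r \<otimes> inv (a r) \<in> R" using rc by (simp add: m_assoc)
    \<comment> \<open>Conjugation by a(r) brings out the factors a(r)^-1 r^e and d(r), both in
      [G, G].\<close>
    have "a r \<otimes> (inv (a r) \<otimes> r [^] e \<otimes> d r) \<otimes> inv (a r) \<in> rel_lcs G (carrier G) (Suc 0)"
      using rc by (intro N1.inv_op_closed2 N1.m_closed a(3) dR r) auto
    then have 2: "r [^] e \<otimes> d r \<otimes> inv (a r) \<in> rel_lcs G (carrier G) (Suc 0)"
      using rc by (simp add: word_simps)
    show "r [^] e \<otimes> d r \<otimes> inv (a r) \<in> X 0"
      using 1 c[OF 1 2] by (simp add: X_def)
  next
    fix n t f assume t: "t \<in> X n" and f: "f \<in> carrier G"
    then have tR: "t \<in> rel_lcs G R n" "t [^] c \<in> rel_lcs G R (Suc n)" by (simp_all add: X_def)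
    have tc: "t \<in> carrier G" using tR(1) Rc by blast
    interpret N: normal "rel_lcs G R (Suc (Suc n))" G by (rule rel_lcs_normal[OF R])
    let ?Q = "G Mod rel_lcs G R (Suc (Suc n))" and ?q = "\<lambda>x. rel_lcs G R (Suc (Suc n)) #> x"
    interpret q: group_hom G ?Q ?q by (rule N.group_hom_Mod)
    have tf: "commutator G t (d f) \<in> rel_lcs G R (Suc n)" by (rule rel_lcs_commutator[OF tR(1) d.hom_closed[OF f]])
    have "?q (commutator G (t [^] c) (d f)) = commutator ?Q (?q t [^]\<^bsub>?Q\<^esub> c) (?q (d f))"
      using tc f by (simp add: q.hom_nat_pow)
    also have "\<dots> = commutator ?Q (?q t) (?q (d f)) [^]\<^bsub>?Q\<^esub> c"
      using Mod_rel_lcs_central[OF R tf] tc f by (intro q.H.commutator_pow_left) (simp_all del: mult_FactGroup)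
    also have "\<dots> = ?q (commutator G t (d f) [^] c)"
      using tc f by (simp add: q.hom_nat_pow)
    finally have "?q (commutator G t (d f) [^] c) = ?q (commutator G (t [^] c) (d f))" ..
    moreover have "commutator G (t [^] c) (d f) \<in> rel_lcs G R (Suc (Suc n))"
      by (rule rel_lcs_commutator[OF tR(2) d.hom_closed[OF f]])
    ultimately have "commutator G t (d f) [^] c \<in> rel_lcs G R (Suc (Suc n))"
      using N.Mod_eq_one_iff[of "commutator G t (d f) [^] c"] N.Mod_eq_one_iff[of "commutator G (t [^] c) (d f)"] tc f
      by (metis commutator_closed d.hom_closed nat_pow_closed)
    then show "commutator G t (d f) \<in> X (Suc n)" using tf by (simp add: X_def)
  qed
  then have "(t [^] (e ^ Suc n)) [^] c \<in> rel_lcs G R (Suc n)" by (simp add: X_def del: nat_pow_Suc power_Suc)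
  then show ?thesis using t(1) Rc by (metis nat_pow_pow subsetD)
qed

text \<open>Here e = 1, so the power disappears and the intersection itself lies in
  \<open>X n\<close>. The endomorphism d takes values in the span of Y, and commutators of
  \<open>X n\<close> with that span lie in the group generated, modulo the next relative term, by
  commutators of finitely many generators with elements of Y.\<close>

lemma multiplier_finitely_generated:
  assumes R: "R \<lhd> G" and Y: "finite Y" "Y \<subseteq> carrier G" and S0: "finite S0" "S0 \<subseteq> R"
    and B: "\<And>b. b \<in> B \<Longrightarrow> \<exists>r\<in>R. \<exists>y\<in>generate G Y. inv (r \<otimes> y) \<otimes> b \<in> rel_lcs G (carrier G) (Suc 0)"
    and RS: "\<And>r y. \<lbrakk>r \<in> R; y \<in> generate G Y; inv y \<otimes> r \<in> rel_lcs G (carrier G) (Suc 0)\<rbrakk> \<Longrightarrow> r \<in> generate G (S0 \<union> rel_lcs G R (Suc 0))"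
  shows "\<exists>S. finite S \<and> S \<subseteq> rel_lcs G R n \<and>
    rel_lcs G R n \<inter> rel_lcs G (carrier G) (Suc n) \<subseteq> generate G (S \<union> rel_lcs G R (Suc n))"
proof -
  interpret R: normal R G by fact
  interpret N1: normal "rel_lcs G (carrier G) (Suc 0)" G by (rule rel_lcs_normal[OF normal_self])
  have gY: "subgroup (generate G Y) G" by (rule generate_is_subgroup[OF Y(2)])
  interpret gY: subgroup "generate G Y" G by (rule gY)
  have Bc: "b \<in> carrier G" if "b \<in> B" for b using that gens by auto
  obtain y where y: "\<And>b. b \<in> B \<Longrightarrow> y b \<in> generate G Y \<and> (\<exists>r\<in>R. inv (r \<otimes> y b) \<otimes> b \<in> rel_lcs G (carrier G) (Suc 0))"
    using B by metis
  obtain d where d: "d \<in> hom G G" "\<And>b. b \<in> B \<Longrightarrow> d b = y b"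
    using extend[of y] y gY.mem_carrier by metis
  interpret d: group_hom G G d using d by (simp add: group_hom_def group_hom_axioms_def)
  have dY: "d f \<in> generate G Y" if "f \<in> carrier G" for f
  proof -
    have "subgroup {f \<in> carrier G. d f \<in> generate G Y} G"
      by (rule subgroupI) (auto intro!: exI[of _ \<one>] simp: gY.one_closed)
    then have "generate G B \<subseteq> {f \<in> carrier G. d f \<in> generate G Y}"
      using Bc y d(2) by (intro generate_subgroup_incl) auto
    then show ?thesis using gens that by auto
  qed
  have dB: "\<exists>r\<in>R. inv (r \<otimes> d b) \<otimes> b [^] (1::nat) \<in> rel_lcs G (carrier G) (Suc 0)" if "b \<in> B" for b
    using y[OF that] d(2)[OF that] Bc[OF that] by simp
  obtain a where a: "a \<in> hom G G" "\<And>f. f \<in> carrier G \<Longrightarrow> a f \<otimes> inv (d f) \<in> R"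
    "\<And>f. f \<in> carrier G \<Longrightarrow> inv (a f) \<otimes> f [^] (1::nat) \<in> rel_lcs G (carrier G) (Suc 0)"
    using congruent_hom[OF R d(1) dB] by blast
  interpret a: group_hom G G a using a by (simp add: group_hom_def group_hom_axioms_def)
  \<comment> \<open>\<open>S n\<close> consists of the iterated commutators [...[s, y_1], ..., y_n]
    with s in \<open>S0\<close> and all y_i in Y.\<close>
  define S where "S = rec_nat S0 (\<lambda>n T. (\<Union>s\<in>T. commutator G s ` Y))"
  have S_simps: "S 0 = S0" "S (Suc n) = (\<Union>s\<in>S n. commutator G s ` Y)" for n by (simp_all add: S_def)
  have Sfin: "finite (S n)" for n by (induction n) (use S0 Y in \<open>auto simp: S_simps\<close>)
  have SR: "S n \<subseteq> rel_lcs G R n" for n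
    by (induction n) (use S0 Y in \<open>auto simp: S_simps intro!: rel_lcs_commutator\<close>)
  define X where "X n = generate G (S n \<union> rel_lcs G R (Suc n))" for n
  have Rc: "rel_lcs G R n \<subseteq> carrier G" for n by (rule rel_lcs_carrier[OF R])
  have sub: "S n \<union> rel_lcs G R (Suc n) \<subseteq> rel_lcs G R n" for n
    using SR rel_lcs_Suc_subset[OF R] by blast
  have subc: "S n \<union> rel_lcs G R (Suc n) \<subseteq> carrier G" for n using sub Rc by blast
  have X: "subgroup (X n) G" "rel_lcs G R (Suc n) \<subseteq> X n" "X n \<subseteq> rel_lcs G R n" for n
  proof -
    show "subgroup (X n) G" unfolding X_def by (rule generate_is_subgroup[OF subc])
    show "rel_lcs G R (Suc n) \<subseteq> X n" unfolding X_def by (auto intro: generate.incl)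
    show "X n \<subseteq> rel_lcs G R n" unfolding X_def
      by (rule generate_subgroup_incl[OF sub normal_imp_subgroup[OF rel_lcs_normal[OF R]]])
  qed
  have "rel_lcs G R n \<inter> rel_lcs G (carrier G) (Suc n) \<subseteq> X n" for n
  proof
    fix t assume t: "t \<in> rel_lcs G R n \<inter> rel_lcs G (carrier G) (Suc n)"
    have tc: "t \<in> carrier G" using t Rc by blast
    have "t [^] ((1::nat) ^ Suc n) \<in> X n"
    proof (rule power_mem_filtration[OF R a(1) d(1) a(2,3) X])
      fix r assume r: "r \<in> R"
      have rc: "r \<in> carrier G" using r by simp
      have "d r \<otimes> inv (a r) \<in> R"
        using R.m_inv_closed[OF a(2)[OF rc]] rc by (simp add: inv_mult_group)
      then have 1: "r \<otimes> d r \<otimes> inv (a r) \<in> R" using r rc by (simp add: m_assoc)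
      have "inv (a r) \<otimes> r \<in> rel_lcs G (carrier G) (Suc 0)" using a(3)[OF rc] rc by simp
      then have "a r \<otimes> (inv (a r) \<otimes> r) \<otimes> inv (a r) \<in> rel_lcs G (carrier G) (Suc 0)"
        using rc by (intro N1.inv_op_closed2) auto
      moreover have "commutator G (inv (d r)) r \<in> rel_lcs G (carrier G) (Suc 0)"
        using rel_lcs_commutator[of "inv (d r)" "carrier G" 0 r] rc by simp
      ultimately have "commutator G (inv (d r)) r \<otimes> (a r \<otimes> (inv (a r) \<otimes> r) \<otimes> inv (a r)) \<in> rel_lcs G (carrier G) (Suc 0)"
        by (rule N1.m_closed[rotated])
      moreover have "commutator G (inv (d r)) r \<otimes> (a r \<otimes> (inv (a r) \<otimes> r) \<otimes> inv (a r)) = inv (d r) \<otimes> (r \<otimes> d r \<otimes> inv (a r))"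
        using rc by (simp add: commutator_def word_simps)
      ultimately have "inv (d r) \<otimes> (r \<otimes> d r \<otimes> inv (a r)) \<in> rel_lcs G (carrier G) (Suc 0)" by (simp only:)
      then show "r [^] (1::nat) \<otimes> d r \<otimes> inv (a r) \<in> X 0"
        using RS[OF 1 dY[OF rc]] rc by (simp add: X_def S_simps)
    next
      fix n t f assume t: "t \<in> X n" and f: "f \<in> carrier G"
      have N: "X (Suc n) \<lhd> G" using sandwiched_normal[OF R X] .
      interpret N: normal "X (Suc n)" G by (rule N)
      have SYX: "commutator G s z \<in> X (Suc n)" if s: "s \<in> S n \<union> rel_lcs G R (Suc n)" and z: "z \<in> Y" for s z
      proof -
        consider "s \<in> S n" | "s \<in> rel_lcs G R (Suc n)" using s by blast
        then show ?thesis
        proof cases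
          case 1
          then have "commutator G s z \<in> S (Suc n)" using z by (auto simp: S_simps)
          then show ?thesis unfolding X_def by (auto intro: generate.incl)
        next
          case 2
          then show ?thesis using rel_lcs_commutator[OF 2, of z] Y(2) z X(2) by blast
        qed
      qed
      \<comment> \<open>Centralizers modulo \<open>X (Suc n)\<close> are subgroups. This extends the
        claim from Y and the generators of \<open>X n\<close> to the groups that they generate, one
        argument at a time.\<close>
      have 1: "generate G Y \<subseteq> {z \<in> carrier G. \<forall>s\<in>S n \<union> rel_lcs G R (Suc n). commutator G s z \<in> X (Suc n)}"
        using centralizer_mod_subgroup[OF N subc] SYX Y(2) by (intro generate_subgroup_incl) blast+
      have inv_c: "commutator G y x \<in> X (Suc n)" if "commutator G x y \<in> X (Suc n)" "x \<in> carrier G" "y \<in> carrier G" for x y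
        using N.m_inv_closed[OF that(1)] inv_commutator[OF that(2,3)] by simp
      have "S n \<union> rel_lcs G R (Suc n) \<subseteq> {s \<in> carrier G. \<forall>z\<in>generate G Y. commutator G z s \<in> X (Suc n)}"
        using 1 subc[of n] inv_c by blast
      then have "X n \<subseteq> {s \<in> carrier G. \<forall>z\<in>generate G Y. commutator G z s \<in> X (Suc n)}"
        unfolding X_def[of n] by (rule generate_subgroup_incl[OF _ centralizer_mod_subgroup[OF N gY.subset]])
      then show "commutator G t (d f) \<in> X (Suc n)"
        using t dY[OF f] inv_c gY.mem_carrier by blast
    qed (use t in auto)
    then show "t \<in> X n" using tc by simp
  qed
  then show ?thesis
    using Sfin[of n] SR[of n] unfolding X_def by (intro exI[of _ "S n"] conjI)
qed

end

section \<open>From generators and exponents to finite quotients\<close>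

context group
begin

text \<open>The image of \<open>rel_lcs G R n\<close> in the quotient is central, hence abelian. The
  image of K lies in a finitely generated part of it and is killed by k, so
  \<open>finite_torsion\<close> applies.\<close>

lemma layer_finite:
  assumes R: "R \<lhd> G" and S: "finite S" "S \<subseteq> rel_lcs G R n"
    and K: "K \<subseteq> rel_lcs G R n" "K \<subseteq> generate G (S \<union> rel_lcs G R (Suc n))"
    and k: "k > 0" "\<And>t. t \<in> K \<Longrightarrow> t [^] (k::nat) \<in> rel_lcs G R (Suc n)"
  shows "finite ((\<lambda>t. rel_lcs G R (Suc n) #> t) ` K)"
proof -
  let ?N = "rel_lcs G R (Suc n)"
  interpret N: normal ?N G by (rule rel_lcs_normal[OF R])
  interpret S: normal "rel_lcs G R n" G by (rule rel_lcs_normal[OF R])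
  let ?Q = "G Mod ?N" and ?q = "\<lambda>x. ?N #> x"
  interpret q: group_hom G ?Q ?q by (rule N.group_hom_Mod)
  define Z where "Z = ?q ` rel_lcs G R n"
  have Z: "subgroup Z ?Q" unfolding Z_def by (rule q.subgroup_img_is_subgroup[OF S.subgroup_axioms])
  have Zg: "comm_group (?Q\<lparr>carrier := Z\<rparr>)"
  proof (rule group.group_comm_groupI)
    show "group (?Q\<lparr>carrier := Z\<rparr>)" by (rule q.H.subgroup_imp_group[OF Z])
    fix x y assume "x \<in> carrier (?Q\<lparr>carrier := Z\<rparr>)" "y \<in> carrier (?Q\<lparr>carrier := Z\<rparr>)"
    then obtain x' where "x' \<in> rel_lcs G R n" "x = ?q x'" and y: "y \<in> carrier ?Q"
      using subgroup.subset[OF Z] by (auto simp: Z_def)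
    then show "x \<otimes>\<^bsub>?Q\<lparr>carrier := Z\<rparr>\<^esub> y = y \<otimes>\<^bsub>?Q\<lparr>carrier := Z\<rparr>\<^esub> x"
      using Mod_rel_lcs_central[OF R] by (simp del: mult_FactGroup)
  qed
  have SZ: "?q ` S \<subseteq> Z" using S by (auto simp: Z_def)
  have Sc: "?q ` S \<subseteq> carrier ?Q" using SZ subgroup.subset[OF Z] by blast
  have gS: "subgroup (generate ?Q (?q ` S)) ?Q" by (rule q.H.generate_is_subgroup[OF Sc])
  have fin: "finite {x \<in> generate (?Q\<lparr>carrier := Z\<rparr>) (?q ` S). x [^]\<^bsub>?Q\<lparr>carrier := Z\<rparr>\<^esub> k = \<one>\<^bsub>?Q\<lparr>carrier := Z\<rparr>\<^esub>}"
    using comm_group.finite_torsion[OF Zg _ _ k(1), of "?q ` S"] S SZ by simp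
  have "?q ` K \<subseteq> {x \<in> generate (?Q\<lparr>carrier := Z\<rparr>) (?q ` S). x [^]\<^bsub>?Q\<lparr>carrier := Z\<rparr>\<^esub> k = \<one>\<^bsub>?Q\<lparr>carrier := Z\<rparr>\<^esub>}"
  proof (rule image_subsetI, rule CollectI, rule conjI)
    fix t assume t: "t \<in> K"
    have tc: "t \<in> carrier G" using t K(1) by auto
    have sub: "subgroup {x \<in> carrier G. ?q x \<in> generate ?Q (?q ` S)} G"
    proof (rule subgroupI)
      show "{x \<in> carrier G. ?q x \<in> generate ?Q (?q ` S)} \<noteq> {}"
        using generate.one[of ?Q] q.hom_one by (auto intro!: exI[of _ \<one>])
    next
      fix a assume "a \<in> {x \<in> carrier G. ?q x \<in> generate ?Q (?q ` S)}"
      then show "inv a \<in> {x \<in> carrier G. ?q x \<in> generate ?Q (?q ` S)}"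
        using subgroup.m_inv_closed[OF gS] q.hom_inv by (metis (no_types, lifting) inv_closed mem_Collect_eq)
    next
      fix a b assume "a \<in> {x \<in> carrier G. ?q x \<in> generate ?Q (?q ` S)}" "b \<in> {x \<in> carrier G. ?q x \<in> generate ?Q (?q ` S)}"
      then show "a \<otimes> b \<in> {x \<in> carrier G. ?q x \<in> generate ?Q (?q ` S)}"
        using q.hom_mult[of a b] by (auto intro: generate.eng simp del: mult_FactGroup)
    qed auto
    have "S \<union> ?N \<subseteq> {x \<in> carrier G. ?q x \<in> generate ?Q (?q ` S)}"
    proof
      fix x assume "x \<in> S \<union> ?N"
      then show "x \<in> {x \<in> carrier G. ?q x \<in> generate ?Q (?q ` S)}"
      proof
        assume "x \<in> S"
        then show ?thesis using S by (auto intro: generate.incl)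
      next
        assume x: "x \<in> ?N"
        then have "x \<in> carrier G" by simp
        then have "?q x = \<one>\<^bsub>?Q\<^esub>" using x N.Mod_eq_one_iff by blast
        then show ?thesis using generate.one[of ?Q "?q ` S"] x by simp
      qed
    qed
    then have "generate G (S \<union> ?N) \<subseteq> {x \<in> carrier G. ?q x \<in> generate ?Q (?q ` S)}"
      by (rule generate_subgroup_incl[OF _ sub])
    then have "?q t \<in> generate ?Q (?q ` S)" using t K(2) by blast
    then show "?q t \<in> generate (?Q\<lparr>carrier := Z\<rparr>) (?q ` S)"
      using q.H.generate_consistent[OF SZ Z] by simp
    have "?q (t [^] k) = \<one>\<^bsub>?Q\<^esub>" using k(2)[OF t] tc N.Mod_eq_one_iff by blast
    then show "?q t [^]\<^bsub>?Q\<lparr>carrier := Z\<rparr>\<^esub> k = \<one>\<^bsub>?Q\<lparr>carrier := Z\<rparr>\<^esub>"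
      using tc by (simp add: q.hom_nat_pow q.H.nat_pow_consistent[symmetric] del: one_FactGroup) 
  qed
  then show ?thesis using fin finite_subset by blast
qed

text \<open>Fix a representative in K for each coset of N met by K. Then t is determined modulo M by
  its coset of N and by its quotient with the representative, which lies in both K and N.\<close>

lemma finite_cosets_refine:
  assumes K: "subgroup K G" and N: "N \<lhd> G" and M: "M \<lhd> G"
    and fin: "finite ((\<lambda>t. N #> t) ` K)" "finite ((\<lambda>t. M #> t) ` (K \<inter> N))"
  shows "finite ((\<lambda>t. M #> t) ` K)"
proof -
  interpret N: normal N G by fact
  interpret M: normal M G by fact
  interpret K: subgroup K G by fact
  define rep where "rep C = (SOME t. t \<in> K \<and> N #> t = C)" for C
  have rep: "rep C \<in> K \<and> N #> rep C = C" if "C \<in> (\<lambda>t. N #> t) ` K" for C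
    unfolding rep_def by (rule someI_ex) (use that in blast)
  have "(\<lambda>t. M #> t) ` K \<subseteq> (\<lambda>(A, C). A <#> (M #> rep C)) ` (((\<lambda>t. M #> t) ` (K \<inter> N)) \<times> ((\<lambda>t. N #> t) ` K))"
  proof
    fix A assume "A \<in> (\<lambda>t. M #> t) ` K"
    then obtain t where t: "t \<in> K" "A = M #> t" by blast
    let ?s = "rep (N #> t)"
    have s: "?s \<in> K" "N #> ?s = N #> t" using rep[of "N #> t"] t by auto
    have c: "t \<in> carrier G" "?s \<in> carrier G" using t s by auto
    have "t \<otimes> inv ?s \<in> K \<inter> N" using t s N.Mod_eq_iff[OF c] by auto
    moreover have "A = (M #> (t \<otimes> inv ?s)) <#> (M #> ?s)"
      using c t(2) by (simp add: M.rcos_sum m_assoc)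
    ultimately show "A \<in> (\<lambda>(A, C). A <#> (M #> rep C)) ` (((\<lambda>t. M #> t) ` (K \<inter> N)) \<times> ((\<lambda>t. N #> t) ` K))"
      using t(1) by (intro image_eqI[of _ _ "(M #> (t \<otimes> inv ?s), N #> t)"]) auto
  qed
  then show ?thesis using fin by (meson finite_SigmaI finite_imageI finite_subset)
qed

text \<open>The order of the image of K in the quotient serves as c.\<close>

lemma finite_quotient_exponent:
  assumes K: "subgroup K G" and N: "N \<lhd> G" and fin: "finite ((\<lambda>t. N #> t) ` K)"
  shows "\<exists>c>0. \<forall>x\<in>K. x [^] (c::nat) \<in> N"
proof -
  interpret N: normal N G by fact
  let ?Q = "G Mod N" and ?q = "\<lambda>x. N #> x"
  interpret q: group_hom G ?Q ?q by (rule N.group_hom_Mod)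
  have Z: "subgroup (?q ` K) ?Q" by (rule q.subgroup_img_is_subgroup[OF K])
  interpret Z: group "?Q\<lparr>carrier := ?q ` K\<rparr>" by (rule q.H.subgroup_imp_group[OF Z])
  have "0 < order (?Q\<lparr>carrier := ?q ` K\<rparr>)" using fin Z.order_gt_0_iff_finite by simp
  moreover have "x [^] order (?Q\<lparr>carrier := ?q ` K\<rparr>) \<in> N" if x: "x \<in> K" for x
  proof -
    have xc: "x \<in> carrier G" using x K subgroup.mem_carrier by metis
    have "?q x [^]\<^bsub>?Q\<lparr>carrier := ?q ` K\<rparr>\<^esub> order (?Q\<lparr>carrier := ?q ` K\<rparr>) = \<one>\<^bsub>?Q\<lparr>carrier := ?q ` K\<rparr>\<^esub>"
      by (rule Z.pow_order_eq_1) (use x in simp)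
    then have "?q (x [^] order (?Q\<lparr>carrier := ?q ` K\<rparr>)) = \<one>\<^bsub>?Q\<^esub>"
      using xc by (simp add: q.hom_nat_pow q.H.nat_pow_consistent[symmetric] del: one_FactGroup)
    then show ?thesis using xc N.Mod_eq_one_iff[of "x [^] order (?Q\<lparr>carrier := ?q ` K\<rparr>)"] by simp
  qed
  ultimately show ?thesis by blast
qed

end

context self_free
begin

text \<open>Constructs the two pairs of endomorphisms from generators of E_ab:
  \<open>quasi_section\<close> yields the d that is trivial on R modulo [G, G] and hence the
  exponent, while lifts of the generators to G yield finite generation. The case n = 1, given as
  \<open>fin\<close>, supplies both c and the initial generators; the rest is an induction over
  layers.\<close>

lemma multiplier_finite:
  fixes h :: "'a \<Rightarrow> 'c" and E :: "'c monoid"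
  assumes hE: "group_hom G E h" and surj: "h ` carrier G = carrier E" and RK: "R = kernel G E h"
    and YE: "finite YE" "YE \<subseteq> carrier E"
    and EY: "\<And>x. x \<in> carrier E \<Longrightarrow> \<exists>y\<in>generate E YE. inv\<^bsub>E\<^esub> y \<otimes>\<^bsub>E\<^esub> x \<in> rel_lcs E (carrier E) (Suc 0)"
    and fin: "finite ((\<lambda>t. rel_lcs G R (Suc 0) #> t) ` (R \<inter> rel_lcs G (carrier G) (Suc 0)))"
  shows "finite ((\<lambda>t. rel_lcs G R n #> t) ` (R \<inter> rel_lcs G (carrier G) n))"
proof -
  interpret h: group_hom G E h by fact
  have R: "R \<lhd> G" unfolding RK by (rule h.normal_kernel)
  interpret R: normal R G by (rule R)
  have Rmem: "x \<in> R \<longleftrightarrow> x \<in> carrier G \<and> h x = \<one>\<^bsub>E\<^esub>" for x unfolding RK kernel_def by simp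
  let ?N1 = "rel_lcs G (carrier G) (Suc 0)"
  interpret N1: normal ?N1 G by (rule rel_lcs_normal[OF normal_self])
  interpret V: comm_group "G Mod ?N1" using Mod_lcs_comm_group by simp
  let ?V = "G Mod ?N1" and ?q = "\<lambda>x. ?N1 #> x"
  interpret q: group_hom G ?V ?q by (rule N1.group_hom_Mod)
  let ?E1 = "rel_lcs E (carrier E) (Suc 0)"
  interpret E1: normal ?E1 E by (rule h.H.rel_lcs_normal[OF h.H.normal_self])
  interpret A: comm_group "E Mod ?E1" using h.H.Mod_lcs_comm_group by simp
  let ?A = "E Mod ?E1" and ?qE = "\<lambda>x. ?E1 #>\<^bsub>E\<^esub> x"
  interpret qE: group_hom E ?A ?qE by (rule E1.group_hom_Mod)
  have hN1: "h ` ?N1 = ?E1" using h.image_rel_lcs[OF normal_self surj, of "Suc 0"] surj by simp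
  have Bc: "b \<in> carrier G" if "b \<in> B" for b using that gens by auto
  \<comment> \<open>Since [G, G] maps onto [E, E], a congruence between images modulo [E, E] lifts
    to one modulo [G, G], at the price of a factor in R.\<close>
  have lift_mod: "\<exists>r\<in>R. inv (r \<otimes> y) \<otimes> x \<in> ?N1"
    if xy: "x \<in> carrier G" "y \<in> carrier G" "inv\<^bsub>E\<^esub> (h y) \<otimes>\<^bsub>E\<^esub> h x \<in> ?E1" for x y
  proof -
    obtain z where z: "z \<in> ?N1" "h z = inv\<^bsub>E\<^esub> (h y) \<otimes>\<^bsub>E\<^esub> h x" using xy(3) hN1 by (metis imageE)
    have zc: "z \<in> carrier G" using z by simp
    have "h (x \<otimes> inv z \<otimes> inv y) = h x \<otimes>\<^bsub>E\<^esub> inv\<^bsub>E\<^esub> (h z) \<otimes>\<^bsub>E\<^esub> inv\<^bsub>E\<^esub> (h y)"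
      using xy(1,2) zc by simp
    also have "\<dots> = \<one>\<^bsub>E\<^esub>"
      unfolding z(2) using h.hom_closed[OF xy(1)] h.hom_closed[OF xy(2)] by (simp add: h.H.word_simps)
    finally have "x \<otimes> inv z \<otimes> inv y \<in> R"
      using xy(1,2) zc unfolding Rmem by simp
    moreover have "inv (x \<otimes> inv z \<otimes> inv y \<otimes> y) \<otimes> x = z" using xy zc by (simp add: word_simps)
    ultimately show ?thesis using z(1) by metis
  qed
  obtain c :: nat where c: "c > 0" "\<And>x. \<lbrakk>x \<in> R; x \<in> ?N1\<rbrakk> \<Longrightarrow> x [^] c \<in> rel_lcs G R (Suc 0)"
    using finite_quotient_exponent[OF subgroups_Inter_pair[OF R.subgroup_axioms N1.subgroup_axioms] rel_lcs_normal[OF R] fin]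
    by blast
  have Agen: "carrier ?A = generate ?A (?qE ` YE)"
  proof
    show "generate ?A (?qE ` YE) \<subseteq> carrier ?A" by (rule A.generate_incl) (use YE in auto)
    show "carrier ?A \<subseteq> generate ?A (?qE ` YE)"
    proof
      fix u assume "u \<in> carrier ?A"
      then obtain x where x: "x \<in> carrier E" "u = ?qE x" by (auto simp only: carrier_FactGroup)
      obtain y where y: "y \<in> generate E YE" "inv\<^bsub>E\<^esub> y \<otimes>\<^bsub>E\<^esub> x \<in> ?E1" using EY[OF x(1)] by blast
      have "u = ?qE y" using E1.Mod_eq_iff_left[of y x] y x h.H.generate_in_carrier[OF YE(2)] by metis
      then show "u \<in> generate ?A (?qE ` YE)" using qE.generate_img[OF YE(2)] y(1) by blast
    qed
  qed
  have qh: "(\<lambda>x. ?qE (h x)) \<in> hom G ?A"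
    using Group.hom_compose[OF h.homh qE.homh] by (simp add: comp_def)
  obtain p where p: "p \<in> hom ?V ?A" "\<And>x. x \<in> carrier G \<Longrightarrow> p (?q x) = ?qE (h x)"
  proof (rule FactGroup_universal[OF qh N1.normal_axioms])
    fix x y assume xy: "x \<in> carrier G" "y \<in> carrier G" "?q x = ?q y"
    then have "inv x \<otimes> y \<in> ?N1" using N1.Mod_eq_iff_left by blast
    then have "h (inv x \<otimes> y) \<in> ?E1" using hN1 by blast
    then show "?qE (h x) = ?qE (h y)" using xy by (subst E1.Mod_eq_iff_left) auto
  qed blast
  have psurj: "carrier ?A \<subseteq> p ` carrier ?V"
  proof
    fix u assume "u \<in> carrier ?A"
    then obtain x where x: "x \<in> carrier E" "u = ?qE x" by (auto simp only: carrier_FactGroup)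
    then obtain x' where "x' \<in> carrier G" "h x' = x" using surj by (metis imageE)
    then show "u \<in> p ` carrier ?V" using p(2) x by (metis imageI q.hom_closed)
  qed
  have qEY: "?qE ` YE \<subseteq> carrier ?A" using YE(2) qE.hom_closed by blast
  obtain a and e :: nat where e: "e > 0" and a: "a \<in> hom (?A\<lparr>carrier := generate ?A (?qE ` YE)\<rparr>) ?V"
    and pa: "\<And>x. x \<in> generate ?A (?qE ` YE) \<Longrightarrow> p (a x) = x [^]\<^bsub>?A\<^esub> e"
    using A.quasi_section[OF V.comm_group_axioms p(1) psurj finite_imageI[OF YE(1)] qEY] by blast
  have aA: "a \<in> hom ?A ?V" using a unfolding Agen[symmetric] by (simp add: hom_def)
  interpret a: group_hom ?A ?V a using aA by (simp add: group_hom_def group_hom_axioms_def)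
  have pa': "p (a x) = x [^]\<^bsub>?A\<^esub> e" if "x \<in> carrier ?A" for x using pa that unfolding Agen[symmetric] by blast
  \<comment> \<open>Values for d on the basis: it is to lift the composite of G_ab -> E_ab with the
    quasi-section a. It is then trivial on R modulo [G, G], because h is trivial on R.\<close>
  have "\<exists>y\<in>carrier G. ?q y = a (?qE (h b))" if "b \<in> B" for b
  proof -
    have "a (?qE (h b)) \<in> carrier ?V" using Bc[OF that] by (intro a.hom_closed qE.hom_closed h.hom_closed)
    then show ?thesis by (auto simp: carrier_FactGroup)
  qed
  then obtain y where y: "\<And>b. b \<in> B \<Longrightarrow> y b \<in> carrier G \<and> ?q (y b) = a (?qE (h b))" by metis
  obtain d where d: "d \<in> hom G G" "\<And>b. b \<in> B \<Longrightarrow> d b = y b" using extend[of y] y by metis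
  interpret d: group_hom G G d using d by (simp add: group_hom_def group_hom_axioms_def)
  have qd: "?q (d f) = a (?qE (h f))" if f: "f \<in> carrier G" for f
  proof (rule hom_eq_on_generate[OF V.group_axioms, where a="\<lambda>f. ?q (d f)" and d="\<lambda>f. a (?qE (h f))"])
    show "(\<lambda>f. ?q (d f)) \<in> hom G ?V" using Group.hom_compose[OF d(1) q.homh] by (simp add: comp_def)
    show "(\<lambda>f. a (?qE (h f))) \<in> hom G ?V" using Group.hom_compose[OF qh aA] by (simp add: comp_def)
  qed (use gens f y d(2) in auto)
  have dR: "d r \<in> ?N1" if r: "r \<in> R" for r
  proof -
    have rc: "r \<in> carrier G" "h r = \<one>\<^bsub>E\<^esub>" using r Rmem by blast+
    have "?q (d r) = \<one>\<^bsub>?V\<^esub>" unfolding qd[OF rc(1)] rc(2) by (metis a.hom_one qE.hom_one)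
    then show ?thesis using N1.Mod_eq_one_iff[of "d r"] rc by simp
  qed
  have dB: "\<exists>r\<in>R. inv (r \<otimes> d b) \<otimes> b [^] e \<in> ?N1" if b: "b \<in> B" for b
  proof (rule lift_mod)
    have bc: "b \<in> carrier G" by (rule Bc[OF b])
    then show "b [^] e \<in> carrier G" "d b \<in> carrier G" by auto
    have "?qE (h (d b)) = p (?q (d b))" using p(2) bc by simp
    also have "\<dots> = ?qE (h b) [^]\<^bsub>?A\<^esub> e" unfolding qd[OF bc] using bc by (intro pa' qE.hom_closed h.hom_closed)
    also have "\<dots> = ?qE (h (b [^] e))" using bc by (simp add: qE.hom_nat_pow h.hom_nat_pow)
    finally show "inv\<^bsub>E\<^esub> h (d b) \<otimes>\<^bsub>E\<^esub> h (b [^] e) \<in> ?E1"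
      using E1.Mod_eq_iff_left[of "h (d b)" "h (b [^] e)"] bc by simp
  qed
  have "\<exists>y. y \<in> carrier G \<and> h y = x" if "x \<in> YE" for x using that YE(2) surj by (metis imageE subsetD)
  then obtain l where l: "\<And>x. x \<in> YE \<Longrightarrow> l x \<in> carrier G \<and> h (l x) = x" by metis
  define Y where "Y = l ` YE"
  have Y: "finite Y" "Y \<subseteq> carrier G" "h ` Y = YE" using l YE by (auto simp: Y_def image_image)
  have BY: "\<exists>r\<in>R. \<exists>y\<in>generate G Y. inv (r \<otimes> y) \<otimes> b \<in> ?N1" if b: "b \<in> B" for b
  proof -
    obtain x where x: "x \<in> generate E YE" "inv\<^bsub>E\<^esub> x \<otimes>\<^bsub>E\<^esub> h b \<in> ?E1" using EY[of "h b"] Bc[OF b] by auto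
    then obtain y where "y \<in> generate G Y" "h y = x" using h.generate_img[OF Y(2)] Y(3) by (metis imageE)
    then show ?thesis using lift_mod[OF Bc[OF b], of y] x(2) generate_in_carrier[OF Y(2)] by blast
  qed
  \<comment> \<open>The image of R in the abelianization need not be finitely generated, but its
    intersection with the span of the finite set Y is.\<close>
  have qR: "subgroup (?q ` R \<inter> generate ?V (?q ` Y)) ?V"
    by (intro V.subgroups_Inter_pair q.subgroup_img_is_subgroup R.subgroup_axioms V.generate_is_subgroup) (use Y in auto)
  have qYc: "?q ` Y \<subseteq> carrier ?V" using Y(2) q.hom_closed by blast
  obtain T where T: "finite T" "T \<subseteq> ?q ` R \<inter> generate ?V (?q ` Y)" "?q ` R \<inter> generate ?V (?q ` Y) \<subseteq> generate ?V T"
    using V.subgroup_finitely_generated[OF _ qYc qR] Y(1) by blast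
  then obtain T' where T': "T' \<subseteq> R" "finite T'" "T = ?q ` T'"
    by (meson finite_subset_image le_inf_iff)
  \<comment> \<open>M represents the finitely many classes of R meet [G, G] modulo [R, G]. Modulo
    [R, G], the sets T' and M together generate every r in R that agrees with an element of the span
    of Y modulo [G, G].\<close>
  obtain M where M: "finite M" "M \<subseteq> R \<inter> ?N1" "(\<lambda>t. rel_lcs G R (Suc 0) #> t) ` (R \<inter> ?N1) = (\<lambda>t. rel_lcs G R (Suc 0) #> t) ` M"
    using finite_subset_image[OF fin order_refl] by blast
  interpret R1: normal "rel_lcs G R (Suc 0)" G by (rule rel_lcs_normal[OF R])
  have T'c: "T' \<subseteq> carrier G" using T'(1) R.subset by blast
  define W where "W = generate G ((T' \<union> M) \<union> rel_lcs G R (Suc 0))"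
  have Wsub: "subgroup W G" unfolding W_def
    using T'c M(2) R1.subset R.subset by (intro generate_is_subgroup) blast
  interpret W: subgroup W G by (rule Wsub)
  have RS: "r \<in> W" if r: "r \<in> R" and y: "y \<in> generate G Y" and ry: "inv y \<otimes> r \<in> ?N1" for r y
  proof -
    have rc: "r \<in> carrier G" and yc: "y \<in> carrier G" using r y generate_in_carrier[OF Y(2)] by auto
    have "?q r = ?q y" using N1.Mod_eq_iff_left[OF yc rc] ry by simp
    then have "?q r \<in> ?q ` R \<inter> generate ?V (?q ` Y)"
      using r y q.generate_img[OF Y(2)] by blast
    then have "?q r \<in> ?q ` generate G T'" using T(3) T'(3) q.generate_img[OF T'c] by blast
    then obtain s where s: "s \<in> generate G T'" "?q r = ?q s" by blast
    have sR: "s \<in> R" using s(1) generate_subgroup_incl[OF T'(1) R.subgroup_axioms] by blast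
    have sW: "s \<in> W" using s(1) mono_generate[of T' "(T' \<union> M) \<union> rel_lcs G R (Suc 0)"] by (auto simp: W_def)
    have sc: "s \<in> carrier G" using sR by simp
    have rs: "r \<otimes> inv s \<in> R \<inter> ?N1" using N1.Mod_eq_iff[OF rc sc] s(2) r sR by simp
    then obtain m where m: "m \<in> M" "rel_lcs G R (Suc 0) #> (r \<otimes> inv s) = rel_lcs G R (Suc 0) #> m"
      using M(3) by (metis (no_types, lifting) imageE imageI)
    have mc: "m \<in> carrier G" using m M(2) by auto
    have "(r \<otimes> inv s) \<otimes> inv m \<in> rel_lcs G R (Suc 0)"
      using R1.Mod_eq_iff[of "r \<otimes> inv s" m] m rc sc mc by simp
    then have "(r \<otimes> inv s) \<otimes> inv m \<in> W" "m \<in> W" using m(1) by (auto simp: W_def intro: generate.incl)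
    then have "((r \<otimes> inv s) \<otimes> inv m) \<otimes> m \<otimes> s \<in> W" using sW by blast
    then show ?thesis using rc sc mc by (simp add: word_simps)
  qed
  have S0: "finite (T' \<union> M)" "T' \<union> M \<subseteq> R" using T' M by auto
  have layer: "finite ((\<lambda>t. rel_lcs G R (Suc n) #> t) ` (rel_lcs G R n \<inter> rel_lcs G (carrier G) (Suc n)))" for n
  proof -
    have "\<exists>S. finite S \<and> S \<subseteq> rel_lcs G R n \<and>
        rel_lcs G R n \<inter> rel_lcs G (carrier G) (Suc n) \<subseteq> generate G (S \<union> rel_lcs G R (Suc n))"
      by (rule multiplier_finitely_generated[OF R Y(1,2) S0 BY RS[unfolded W_def]])
    then obtain S where S: "finite S" "S \<subseteq> rel_lcs G R n"
      "rel_lcs G R n \<inter> rel_lcs G (carrier G) (Suc n) \<subseteq> generate G (S \<union> rel_lcs G R (Suc n))"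
      by (elim exE conjE)
    show ?thesis
    proof (rule layer_finite[OF R S(1,2) _ S(3)])
      show "0 < e ^ Suc n * c" using e c(1) by simp
      show "t [^] (e ^ Suc n * c) \<in> rel_lcs G R (Suc n)"
        if "t \<in> rel_lcs G R n \<inter> rel_lcs G (carrier G) (Suc n)" for t
        by (rule multiplier_exponent[OF R d(1) dR dB c(2)]) (use that in blast)+
    qed simp
  qed
  show ?thesis
  proof (induction n)
    case 0
    have "(\<lambda>t. R #> t) ` (R \<inter> carrier G) \<subseteq> {R}" using R.rcos_const by auto
    then show ?case by (simp add: finite_subset)
  next
    case (Suc n)
    interpret F: normal "rel_lcs G (carrier G) (Suc n)" G by (rule rel_lcs_normal[OF normal_self])
    show ?case
    proof (rule finite_cosets_refine[OF subgroups_Inter_pair[OF R.subgroup_axioms F.subgroup_axioms] rel_lcs_normal[OF R] rel_lcs_normal[OF R]])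
      show "finite ((\<lambda>t. rel_lcs G R n #> t) ` (R \<inter> rel_lcs G (carrier G) (Suc n)))"
        by (rule finite_subset[OF _ Suc]) (use rel_lcs_Suc_subset[OF normal_self] in blast)
      \<comment> \<open>What the passage from n to n + 1 adds is exactly one
        \<open>layer\<close>.\<close>
      have "R \<inter> rel_lcs G (carrier G) (Suc n) \<inter> rel_lcs G R n = rel_lcs G R n \<inter> rel_lcs G (carrier G) (Suc n)"
        using rel_lcs_subset[OF R] by blast
      then show "finite ((\<lambda>t. rel_lcs G R (Suc n) #> t) ` (R \<inter> rel_lcs G (carrier G) (Suc n) \<inter> rel_lcs G R n))"
        using layer by simp
    qed
  qed
qed

end

section \<open>Completions as coherent sequences\<close>

text \<open>Call x good if chains starting at x reach every later stage. Finiteness forces a good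
  element wherever chains of all lengths exist, and a good element has a good successor, so
  dependent choice yields an infinite chain.\<close>

lemma konig_chain:
  fixes P :: "nat \<Rightarrow> 'a set" and f :: "nat \<Rightarrow> 'a \<Rightarrow> 'a"
  assumes fin: "\<And>n. finite (P n)" and ne: "\<And>n. P n \<noteq> {}"
    and f: "\<And>n x. x \<in> P (Suc n) \<Longrightarrow> f n x \<in> P n"
  shows "\<exists>x. \<forall>n. x n \<in> P n \<and> f n (x (Suc n)) = x n"
proof -
  define ch where "ch n m y \<longleftrightarrow> (\<forall>k. n \<le> k \<and> k \<le> m \<longrightarrow> y k \<in> P k) \<and> (\<forall>k. n \<le> k \<and> k < m \<longrightarrow> f k (y (Suc k)) = y k)" for n m y
  define good where "good n x \<longleftrightarrow> (\<forall>m\<ge>n. \<exists>y. ch n m y \<and> y n = x)" for n x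
  have chE: "\<exists>y. ch n m y \<and> y m = x" if "n \<le> m" "x \<in> P m" for n m x
    using that
  proof (induction m arbitrary: x rule: dec_induct)
    case base
    then show ?case by (intro exI[of _ "\<lambda>_. x"]) (auto simp: ch_def)
  next
    case (step m)
    then obtain y where y: "ch n m y" "y m = f m x" using f by blast
    then show ?case using step.prems step.hyps
      by (intro exI[of _ "y(Suc m := x)"]) (auto simp: ch_def le_Suc_eq less_Suc_eq)
  qed
  have ch_mono: "ch n m y" if "ch n m' y" "m \<le> m'" for n m m' y
    using that by (auto simp: ch_def)
  have good_ex: "\<exists>x\<in>A. good n x" if A: "A \<subseteq> P n" and AE: "\<And>m. n \<le> m \<Longrightarrow> \<exists>y. ch n m y \<and> y n \<in> A" for A n
  proof (rule ccontr)
    assume "\<not> ?thesis"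
    then have "\<forall>x\<in>A. \<exists>m\<ge>n. \<not> (\<exists>y. ch n m y \<and> y n = x)" by (auto simp: good_def)
    then obtain m where m: "\<And>x. x \<in> A \<Longrightarrow> n \<le> m x \<and> \<not> (\<exists>y. ch n (m x) y \<and> y n = x)" by metis
    have finA: "finite A" using A fin finite_subset by blast
    \<comment> \<open>If each x in the finite set A failed at some stage, a chain up to the largest
      of these stages would contradict the failure of its own starting point.\<close>
    define M where "M = Max (insert n (m ` A))"
    have M: "n \<le> M" "\<And>x. x \<in> A \<Longrightarrow> m x \<le> M" using finA by (auto simp: M_def)
    then obtain y where "ch n M y" "y n \<in> A" using AE by blast
    then show False using m M(2) ch_mono by blast
  qed
  have "\<exists>x. x \<in> P 0 \<and> good 0 x"
  proof -
    have "\<exists>y. ch 0 m y \<and> y 0 \<in> P 0" for m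
      using chE[of 0 m] ne[of m] by (fastforce simp: ch_def)
    then show ?thesis using good_ex[of "P 0" 0] by auto
  qed
  moreover have "\<exists>x'. (x' \<in> P (Suc n) \<and> good (Suc n) x') \<and> f n x' = x" if g: "x \<in> P n \<and> good n x" for n x
  proof -
    have "\<exists>x'\<in>{x' \<in> P (Suc n). f n x' = x}. good (Suc n) x'"
    proof (rule good_ex)
      fix m assume "Suc n \<le> m"
      then obtain y where "ch n m y" "y n = x" using g by (meson Suc_leD good_def)
      then show "\<exists>y. ch (Suc n) m y \<and> y (Suc n) \<in> {x' \<in> P (Suc n). f n x' = x}"
        using \<open>Suc n \<le> m\<close> by (intro exI[of _ y]) (auto simp: ch_def)
    qed auto
    then show ?thesis by auto
  qed
  ultimately obtain x where "\<forall>n. (x n \<in> P n \<and> good n (x n)) \<and> f n (x (Suc n)) = x n"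
    using dependent_nat_choice[of "\<lambda>n x. x \<in> P n \<and> good n x" "\<lambda>n x x'. f n x' = x"] by blast
  then show ?thesis by blast
qed

text \<open>A choice of representatives for an element of the completion; \<open>coset_seq\<close>
  returns to the cosets. Sequences of group elements replace coset arithmetic by computations with
  words. Entries n and n + 1 are compared modulo the n-th term, which is what the inclusion of
  successive cosets amounts to.\<close>

definition coherent :: "('a, 'm) monoid_scheme \<Rightarrow> 'a set \<Rightarrow> (nat \<Rightarrow> 'a) \<Rightarrow> bool" where
  "coherent E U u \<longleftrightarrow> (\<forall>n. u n \<in> U) \<and> (\<forall>n. u (Suc n) \<otimes>\<^bsub>E\<^esub> inv\<^bsub>E\<^esub> (u n) \<in> rel_lcs E U n)"

definition coset_seq :: "('a, 'm) monoid_scheme \<Rightarrow> 'a set \<Rightarrow> (nat \<Rightarrow> 'a) \<Rightarrow> nat \<Rightarrow> 'a set" where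
  "coset_seq E U u = (\<lambda>n. rel_lcs E U n #>\<^bsub>E\<^esub> u n)"

context group
begin

lemma coset_seq_eq_iff:
  assumes "U \<lhd> G" "\<And>n. u n \<in> carrier G" "\<And>n. v n \<in> carrier G"
  shows "coset_seq G U u = coset_seq G U v \<longleftrightarrow> (\<forall>n. u n \<otimes> inv (v n) \<in> rel_lcs G U n)"
proof -
  interpret normal "rel_lcs G U n" G for n by (rule rel_lcs_normal[OF assms(1)])
  show ?thesis using assms by (auto simp: coset_seq_def fun_eq_iff Mod_eq_iff)
qed

lemma coherent_carrier: "\<lbrakk>U \<lhd> G; coherent G U u\<rbrakk> \<Longrightarrow> u n \<in> carrier G"
  by (meson coherent_def normal_imp_subgroup subgroup.mem_carrier)

lemma completion_carrier:
  assumes U: "U \<lhd> G"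
  shows "carrier (completion G U) = coset_seq G U ` {u. coherent G U u}"
proof -
  interpret U: normal U G by fact
  have Q: "carrier (completion_quot G U n) = (\<lambda>a. rel_lcs G U n #> a) ` U" for n
    by (simp add: completion_quot_def carrier_FactGroup)
  have iff: "rel_lcs G U (Suc n) #> a \<subseteq> rel_lcs G U n #> b \<longleftrightarrow> a \<otimes> inv b \<in> rel_lcs G U n"
    if "a \<in> carrier G" "b \<in> carrier G" for a b n
  proof -
    interpret N: normal "rel_lcs G U n" G by (rule rel_lcs_normal[OF U])
    interpret N': normal "rel_lcs G U (Suc n)" G by (rule rel_lcs_normal[OF U])
    have sub: "rel_lcs G U (Suc n) \<subseteq> rel_lcs G U n" by (rule rel_lcs_Suc_subset[OF U])
    have "a \<in> rel_lcs G U (Suc n) #> a" using that rcos_self[OF that(1) N'.subgroup_axioms] by simp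
    moreover have "rel_lcs G U (Suc n) #> a \<subseteq> rel_lcs G U n #> a" using sub by (auto simp: r_coset_def)
    ultimately show ?thesis
      using N.Mod_eq_iff[OF that] repr_independence[OF _ that(2) N.subgroup_axioms, of a] by blast
  qed
  show ?thesis
  proof (intro equalityI subsetI)
    fix x assume "x \<in> carrier (completion G U)"
    then have x: "\<And>n. x n \<in> (\<lambda>a. rel_lcs G U n #> a) ` U" "\<And>n. x (Suc n) \<subseteq> x n"
      by (simp_all add: completion_def Q)
    have "\<forall>n. \<exists>a. a \<in> U \<and> x n = rel_lcs G U n #> a" using x(1) by blast
    then obtain u where u: "\<And>n. u n \<in> U \<and> x n = rel_lcs G U n #> u n" by metis
    have "u (Suc n) \<otimes> inv (u n) \<in> rel_lcs G U n" for n
      using x(2)[of n] u[of n] u[of "Suc n"] iff[of "u (Suc n)" "u n" n] by simp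
    then have "coherent G U u" using u by (simp add: coherent_def)
    moreover have "x = coset_seq G U u" using u by (auto simp: coset_seq_def)
    ultimately show "x \<in> coset_seq G U ` {u. coherent G U u}" by blast
  next
    fix x assume "x \<in> coset_seq G U ` {u. coherent G U u}"
    then obtain u where u: "\<And>n. u n \<in> U" "\<And>n. u (Suc n) \<otimes> inv (u n) \<in> rel_lcs G U n" "x = coset_seq G U u"
      by (auto simp: coherent_def)
    have "x (Suc n) \<subseteq> x n" for n
      using u(1)[of n] u(1)[of "Suc n"] u(2)[of n] iff[of "u (Suc n)" "u n" n] by (simp add: u(3) coset_seq_def)
    then show "x \<in> carrier (completion G U)"
      using u(1) by (simp add: completion_def Q u(3) coset_seq_def)
  qed
qed

lemma completion_mult:
  assumes U: "U \<lhd> G" and "\<And>n. u n \<in> carrier G" "\<And>n. v n \<in> carrier G"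
  shows "coset_seq G U u \<otimes>\<^bsub>completion G U\<^esub> coset_seq G U v = coset_seq G U (\<lambda>n. u n \<otimes> v n)"
proof -
  interpret normal "rel_lcs G U n" G for n by (rule rel_lcs_normal[OF assms(1)])
  show ?thesis using assms(2,3)
    by (simp add: completion_def completion_quot_def coset_seq_def rcos_sum)
qed

lemma completion_one:
  assumes U: "U \<lhd> G"
  shows "\<one>\<^bsub>completion G U\<^esub> = coset_seq G U (\<lambda>n. \<one>)"
  using rel_lcs_carrier[OF U] by (simp add: completion_def completion_quot_def coset_seq_def)

lemma coherent_one: "U \<lhd> G \<Longrightarrow> coherent G U (\<lambda>n. \<one>)"
  using normal_imp_subgroup[OF rel_lcs_normal, of U] normal_imp_subgroup[of U G]
  by (simp add: coherent_def subgroup.one_closed)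

lemma coherent_mult:
  assumes U: "U \<lhd> G" and u: "coherent G U u" and v: "coherent G U v"
  shows "coherent G U (\<lambda>n. u n \<otimes> v n)"
proof -
  interpret U: normal U G by fact
  have "u (Suc n) \<otimes> v (Suc n) \<otimes> inv (u n \<otimes> v n) \<in> rel_lcs G U n" for n
  proof -
    interpret N: normal "rel_lcs G U n" G by (rule rel_lcs_normal[OF U])
    have c: "u n \<in> carrier G" "u (Suc n) \<in> carrier G" "v n \<in> carrier G" "v (Suc n) \<in> carrier G"
      using u v coherent_carrier[OF U] by auto
    have "(u (Suc n) \<otimes> (v (Suc n) \<otimes> inv (v n)) \<otimes> inv (u (Suc n))) \<otimes> (u (Suc n) \<otimes> inv (u n)) \<in> rel_lcs G U n"
      using u v c(2) by (auto simp: coherent_def intro: N.m_closed[OF N.inv_op_closed2])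
    then show ?thesis using c by (simp add: word_simps)
  qed
  then show ?thesis using u v by (auto simp: coherent_def)
qed

lemma coherent_inv:
  assumes U: "U \<lhd> G" and u: "coherent G U u"
  shows "coherent G U (\<lambda>n. inv (u n))"
proof -
  interpret U: normal U G by fact
  have "inv (u (Suc n)) \<otimes> inv (inv (u n)) \<in> rel_lcs G U n" for n
  proof -
    interpret N: normal "rel_lcs G U n" G by (rule rel_lcs_normal[OF U])
    have c: "u n \<in> carrier G" "u (Suc n) \<in> carrier G" using u coherent_carrier[OF U] by auto
    have "inv (u (Suc n)) \<otimes> inv (u (Suc n) \<otimes> inv (u n)) \<otimes> u (Suc n) \<in> rel_lcs G U n"
      using u c by (intro N.inv_op_closed1 N.m_inv_closed) (auto simp: coherent_def)
    then show ?thesis using c by (simp add: word_simps)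
  qed
  then show ?thesis using u by (auto simp: coherent_def)
qed

lemma completion_group:
  assumes U: "U \<lhd> G"
  shows "group (completion G U)"
proof (rule groupI)
  note C = completion_carrier[OF U] coherent_carrier[OF U]
  fix x assume "x \<in> carrier (completion G U)"
  then obtain u where u: "coherent G U u" "x = coset_seq G U u" by (auto simp: C)
  have uc: "\<And>n. u n \<in> carrier G" by (rule C(2)[OF u(1)])
  show "\<one>\<^bsub>completion G U\<^esub> \<otimes>\<^bsub>completion G U\<^esub> x = x"
    using uc by (simp add: completion_one[OF U] completion_mult[OF U] u(2))
  have "coset_seq G U (\<lambda>n. inv (u n)) \<otimes>\<^bsub>completion G U\<^esub> x = \<one>\<^bsub>completion G U\<^esub>"
    using uc by (simp add: completion_one[OF U] completion_mult[OF U] u(2))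
  then show "\<exists>y\<in>carrier (completion G U). y \<otimes>\<^bsub>completion G U\<^esub> x = \<one>\<^bsub>completion G U\<^esub>"
    using coherent_inv[OF U u(1)] by (auto simp: C(1))
  fix y assume "y \<in> carrier (completion G U)"
  then obtain v where v: "coherent G U v" "y = coset_seq G U v" by (auto simp: C)
  have vc: "\<And>n. v n \<in> carrier G" by (rule C(2)[OF v(1)])
  show "x \<otimes>\<^bsub>completion G U\<^esub> y \<in> carrier (completion G U)"
    using uc vc coherent_mult[OF U u(1) v(1)] by (auto simp: completion_mult[OF U] u(2) v(2) C(1))
  fix z assume "z \<in> carrier (completion G U)"
  then obtain w where w: "coherent G U w" "z = coset_seq G U w" by (auto simp: C)
  have wc: "\<And>n. w n \<in> carrier G" by (rule C(2)[OF w(1)])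
  show "x \<otimes>\<^bsub>completion G U\<^esub> y \<otimes>\<^bsub>completion G U\<^esub> z = x \<otimes>\<^bsub>completion G U\<^esub> (y \<otimes>\<^bsub>completion G U\<^esub> z)"
    using uc vc wc by (simp add: completion_mult[OF U] u(2) v(2) w(2) m_assoc)
next
  show "\<one>\<^bsub>completion G U\<^esub> \<in> carrier (completion G U)"
    using coherent_one[OF U] by (auto simp: completion_carrier[OF U] completion_one[OF U])
qed

text \<open>The cosets of \<open>rel_lcs G R n\<close> in R that agree with r(n) modulo the n-th
  lower central term form a translate of the set that is finite by hypothesis, and the transition
  maps respect them. A compatible choice by \<open>konig_chain\<close> is the required
  sequence.\<close>

lemma ex_coherent_approximation:
  assumes R: "R \<lhd> G" and fin: "\<And>n. finite ((\<lambda>t. rel_lcs G R n #> t) ` (R \<inter> rel_lcs G (carrier G) n))"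
    and r: "\<And>n. r n \<in> R" "\<And>n. r (Suc n) \<otimes> inv (r n) \<in> rel_lcs G (carrier G) n"
  shows "\<exists>u. coherent G R u \<and> (\<forall>n. u n \<otimes> inv (r n) \<in> rel_lcs G (carrier G) n)"
proof -
  interpret R: normal R G by fact
  define P where "P n = {rel_lcs G R n #> t |t. t \<in> R \<and> t \<otimes> inv (r n) \<in> rel_lcs G (carrier G) n}" for n
  \<comment> \<open>Multiplying a coset by the larger subgroup is the transition map between
    consecutive quotients.\<close>
  define f where "f n C = rel_lcs G R n <#> C" for n C
  have rc: "r n \<in> carrier G" for n using r(1) by simp
  have norm: "rel_lcs G R n \<lhd> G" "rel_lcs G (carrier G) n \<lhd> G" for n
    using rel_lcs_normal R normal_self by auto
  have fC: "f n (rel_lcs G R (Suc n) #> t) = rel_lcs G R n #> t" if t: "t \<in> carrier G" for n t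
  proof -
    interpret N: normal "rel_lcs G R n" G by (rule norm)
    interpret N': normal "rel_lcs G R (Suc n)" G by (rule norm)
    have "rel_lcs G R n <#> rel_lcs G R (Suc n) = rel_lcs G R n"
    proof
      show "rel_lcs G R n <#> rel_lcs G R (Suc n) \<subseteq> rel_lcs G R n"
        using rel_lcs_Suc_subset[OF R, of n] by (auto simp: set_mult_def)
      show "rel_lcs G R n \<subseteq> rel_lcs G R n <#> rel_lcs G R (Suc n)"
      proof
        fix x assume x: "x \<in> rel_lcs G R n"
        have "x = x \<otimes> \<one>" using x by simp
        then show "x \<in> rel_lcs G R n <#> rel_lcs G R (Suc n)"
          using x N'.one_closed unfolding set_mult_def by blast
      qed
    qed
    then show ?thesis unfolding f_def using setmult_rcos_assoc[OF N.subset N'.subset t] by simp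
  qed
  have "\<exists>x. \<forall>n. x n \<in> P n \<and> f n (x (Suc n)) = x n"
  proof (rule konig_chain)
    fix n
    interpret N: normal "rel_lcs G R n" G by (rule norm)
    interpret F: normal "rel_lcs G (carrier G) n" G by (rule norm)
    have "P n \<subseteq> (\<lambda>A. A <#> (rel_lcs G R n #> r n)) ` ((\<lambda>t. rel_lcs G R n #> t) ` (R \<inter> rel_lcs G (carrier G) n))"
    proof
      fix C assume "C \<in> P n"
      then obtain t where t: "C = rel_lcs G R n #> t" "t \<in> R" "t \<otimes> inv (r n) \<in> rel_lcs G (carrier G) n"
        by (auto simp: P_def)
      have "C = (rel_lcs G R n #> (t \<otimes> inv (r n))) <#> (rel_lcs G R n #> r n)"
        using t rc by (simp add: N.rcos_sum m_assoc)
      then show "C \<in> (\<lambda>A. A <#> (rel_lcs G R n #> r n)) ` ((\<lambda>t. rel_lcs G R n #> t) ` (R \<inter> rel_lcs G (carrier G) n))"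
        using t r(1) by blast
    qed
    then show "finite (P n)" using fin[of n] finite_subset by blast
    have "r n \<otimes> inv (r n) \<in> rel_lcs G (carrier G) n" using rc F.one_closed by simp
    then show "P n \<noteq> {}" using r(1) unfolding P_def by blast
    fix x assume "x \<in> P (Suc n)"
    then obtain t where t: "x = rel_lcs G R (Suc n) #> t" "t \<in> R" "t \<otimes> inv (r (Suc n)) \<in> rel_lcs G (carrier G) (Suc n)"
      by (auto simp: P_def)
    have "(t \<otimes> inv (r (Suc n))) \<otimes> (r (Suc n) \<otimes> inv (r n)) \<in> rel_lcs G (carrier G) n"
      using t(3) rel_lcs_Suc_subset[OF normal_self, of n] r(2) by blast
    then have "t \<otimes> inv (r n) \<in> rel_lcs G (carrier G) n"
      using t(2) rc by (simp add: word_simps)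
    then show "f n x \<in> P n" using t fC by (auto simp: P_def)
  qed
  then obtain x where x: "\<And>n. x n \<in> P n" "\<And>n. f n (x (Suc n)) = x n" by blast
  then obtain u where u: "\<And>n. x n = rel_lcs G R n #> u n \<and> u n \<in> R \<and> u n \<otimes> inv (r n) \<in> rel_lcs G (carrier G) n"
    unfolding P_def mem_Collect_eq by metis
  have "u (Suc n) \<otimes> inv (u n) \<in> rel_lcs G R n" for n
  proof -
    interpret N: normal "rel_lcs G R n" G by (rule norm)
    have c: "u n \<in> carrier G" "u (Suc n) \<in> carrier G" using u by auto
    have "rel_lcs G R n #> u (Suc n) = rel_lcs G R n #> u n"
      using x(2)[of n] u fC[OF c(2), of n] by metis
    then show ?thesis using N.Mod_eq_iff[OF c(2,1)] by simp
  qed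
  then show ?thesis using u by (auto simp: coherent_def)
qed

end

section \<open>Maps of completions: surjectivity and kernels\<close>

context group_hom
begin

lemma hom_coherent:
  assumes U: "U \<lhd> G" and V: "V \<lhd> H" and UV: "h ` U \<subseteq> V" and u: "coherent G U u"
  shows "coherent H V (\<lambda>n. h (u n))"
proof -
  interpret U: normal U G by fact
  have c: "u n \<in> carrier G" for n by (rule G.coherent_carrier[OF U u])
  have "h (u (Suc n)) \<otimes>\<^bsub>H\<^esub> inv\<^bsub>H\<^esub> h (u n) \<in> rel_lcs H V n" for n
    using hom_rel_lcs[OF U.subset UV V, of "u (Suc n) \<otimes> inv (u n)" n] u c by (simp add: coherent_def)
  then show ?thesis using u UV by (auto simp: coherent_def)
qed

lemma completion_map_coset_seq:
  assumes U: "U \<lhd> G" and V: "V \<lhd> H" and UV: "h ` U \<subseteq> V" and u: "coherent G U u"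
  shows "completion_map H V h (coset_seq G U u) = coset_seq H V (\<lambda>n. h (u n))"
proof
  fix n
  interpret U: normal U G by fact
  interpret N: normal "rel_lcs G U n" G by (rule G.rel_lcs_normal[OF U])
  interpret M: normal "rel_lcs H V n" H by (rule H.rel_lcs_normal[OF V])
  have c: "u n \<in> carrier G" for n by (rule G.coherent_carrier[OF U u])
  have sub: "h ` rel_lcs G U n \<subseteq> rel_lcs H V n"
    using hom_rel_lcs[OF U.subset UV V] by blast
  have img: "h ` (rel_lcs G U n #> u n) = h ` rel_lcs G U n #>\<^bsub>H\<^esub> h (u n)"
    using c N.subset by (auto simp: r_coset_def image_iff subset_iff)
  have "rel_lcs H V n <#>\<^bsub>H\<^esub> h ` rel_lcs G U n = rel_lcs H V n"
  proof
    show "rel_lcs H V n <#>\<^bsub>H\<^esub> h ` rel_lcs G U n \<subseteq> rel_lcs H V n"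
      using sub by (auto simp: set_mult_def)
    show "rel_lcs H V n \<subseteq> rel_lcs H V n <#>\<^bsub>H\<^esub> h ` rel_lcs G U n"
    proof
      fix x assume x: "x \<in> rel_lcs H V n"
      have "x = x \<otimes>\<^bsub>H\<^esub> h \<one>" using x by simp
      then show "x \<in> rel_lcs H V n <#>\<^bsub>H\<^esub> h ` rel_lcs G U n"
        using x N.one_closed unfolding set_mult_def by blast
    qed
  qed
  then show "completion_map H V h (coset_seq G U u) n = coset_seq H V (\<lambda>n. h (u n)) n"
    using H.setmult_rcos_assoc[OF M.subset, of "h ` rel_lcs G U n" "h (u n)"] sub M.subset c
    by (simp add: completion_map_def coset_seq_def img)
qed

lemma completion_map_hom:
  assumes U: "U \<lhd> G" and V: "V \<lhd> H" and UV: "h ` U \<subseteq> V"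
  shows "group_hom (completion G U) (completion H V) (completion_map H V h)"
proof -
  note CM = completion_map_coset_seq[OF U V UV]
  note hc = hom_coherent[OF U V UV]
  have "completion_map H V h \<in> hom (completion G U) (completion H V)"
  proof (rule homI)
    fix x assume "x \<in> carrier (completion G U)"
    then obtain u where u: "coherent G U u" "x = coset_seq G U u" by (auto simp: G.completion_carrier[OF U])
    have uc: "\<And>n. u n \<in> carrier G" by (rule G.coherent_carrier[OF U u(1)])
    show "completion_map H V h x \<in> carrier (completion H V)"
      using hc[OF u(1)] by (auto simp: u(2) CM[OF u(1)] H.completion_carrier[OF V])
    fix y assume "y \<in> carrier (completion G U)"
    then obtain v where v: "coherent G U v" "y = coset_seq G U v" by (auto simp: G.completion_carrier[OF U])
    have vc: "\<And>n. v n \<in> carrier G" by (rule G.coherent_carrier[OF U v(1)])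
    show "completion_map H V h (x \<otimes>\<^bsub>completion G U\<^esub> y) = completion_map H V h x \<otimes>\<^bsub>completion H V\<^esub> completion_map H V h y"
      using uc vc by (simp add: u(2) v(2) CM[OF u(1)] CM[OF v(1)] G.completion_mult[OF U] H.completion_mult[OF V]
          CM[OF G.coherent_mult[OF U u(1) v(1)]])
  qed
  then show ?thesis
    using G.completion_group[OF U] H.completion_group[OF V] by (simp add: group_hom_def group_hom_axioms_def)
qed

text \<open>Lift stage by stage. The discrepancy with the next entry of v lies in the n-th term for
  h(U), which by \<open>image_rel_lcs\<close> is the image of the n-th term for U, so a correction
  compatible with coherence exists.\<close>

lemma ex_coherent_lift:
  assumes U: "U \<lhd> G" and surj: "h ` carrier G = carrier H" and v: "coherent H (h ` U) v"
  shows "\<exists>u. coherent G U u \<and> coset_seq H (h ` U) (\<lambda>n. h (u n)) = coset_seq H (h ` U) v"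
proof -
  interpret U: normal U G by fact
  have hU: "h ` U \<lhd> H" by (rule U.surj_hom_normal_subgroup[OF group_hom_axioms surj])
  have vc: "v n \<in> carrier H" for n by (rule H.coherent_carrier[OF hU v])
  define P where "P n x \<longleftrightarrow> x \<in> U \<and> h x \<otimes>\<^bsub>H\<^esub> inv\<^bsub>H\<^esub> v n \<in> rel_lcs H (h ` U) n" for n x
  \<comment> \<open>At stage 0 the term is h(U) itself, so any element of U is a valid
    start.\<close>
  have "\<exists>x. P 0 x"
  proof -
    obtain x where "x \<in> U" using U.one_closed by blast
    moreover have "h x \<otimes>\<^bsub>H\<^esub> inv\<^bsub>H\<^esub> v 0 \<in> h ` U" if "x \<in> U" for x
    proof -
      interpret hU: normal "h ` U" H by (rule hU)
      show ?thesis using that v by (intro hU.m_closed hU.m_inv_closed) (auto simp: coherent_def)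
    qed
    ultimately show ?thesis by (auto simp: P_def)
  qed
  moreover have "\<exists>x'. P (Suc n) x' \<and> x' \<otimes> inv x \<in> rel_lcs G U n" if x: "P n x" for n x
  proof -
    interpret N: normal "rel_lcs H (h ` U) n" H by (rule H.rel_lcs_normal[OF hU])
    interpret N': normal "rel_lcs H (h ` U) (Suc n)" H by (rule H.rel_lcs_normal[OF hU])
    have xU: "x \<in> U" and xv: "h x \<otimes>\<^bsub>H\<^esub> inv\<^bsub>H\<^esub> v n \<in> rel_lcs H (h ` U) n" using x by (auto simp: P_def)
    have xc: "x \<in> carrier G" using xU by simp
    have "(v (Suc n) \<otimes>\<^bsub>H\<^esub> inv\<^bsub>H\<^esub> v n) \<otimes>\<^bsub>H\<^esub> inv\<^bsub>H\<^esub> (h x \<otimes>\<^bsub>H\<^esub> inv\<^bsub>H\<^esub> v n) \<in> rel_lcs H (h ` U) n"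
      using v by (intro N.m_closed[OF _ N.m_inv_closed[OF xv]]) (simp add: coherent_def)
    then have "v (Suc n) \<otimes>\<^bsub>H\<^esub> inv\<^bsub>H\<^esub> h x \<in> h ` rel_lcs G U n"
      using vc xc hom_closed[OF xc] by (simp add: H.word_simps image_rel_lcs[OF U surj] del: hom_closed)
    then obtain z where z: "z \<in> rel_lcs G U n" "h z = v (Suc n) \<otimes>\<^bsub>H\<^esub> inv\<^bsub>H\<^esub> h x" by auto
    have zU: "z \<in> U" using z(1) G.rel_lcs_subset[OF U] by blast
    have "h (z \<otimes> x) = v (Suc n)" using z(2) zU xc vc by (simp add: H.m_assoc)
    then have "P (Suc n) (z \<otimes> x)" using zU xU vc N'.one_closed by (simp add: P_def)
    moreover have "(z \<otimes> x) \<otimes> inv x \<in> rel_lcs G U n" using z(1) zU xc by (simp add: G.m_assoc)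
    ultimately show ?thesis by blast
  qed
  ultimately obtain u where u: "\<And>n. P n (u n)" "\<And>n. u (Suc n) \<otimes> inv (u n) \<in> rel_lcs G U n"
    using dependent_nat_choice[of P "\<lambda>n x x'. x' \<otimes> inv x \<in> rel_lcs G U n"] by blast
  have "coherent G U u" using u by (auto simp: coherent_def P_def)
  moreover have "coset_seq H (h ` U) (\<lambda>n. h (u n)) = coset_seq H (h ` U) v"
    using u vc G.coherent_carrier[OF U \<open>coherent G U u\<close>] by (subst H.coset_seq_eq_iff[OF hU]) (auto simp: P_def)
  ultimately show ?thesis by blast
qed

lemma completion_map_image:
  assumes U: "U \<lhd> G" and surj: "h ` carrier G = carrier H"
  shows "completion_map H (h ` U) h ` carrier (completion G U) = carrier (completion H (h ` U))"
proof -
  interpret U: normal U G by fact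
  have hU: "h ` U \<lhd> H" by (rule U.surj_hom_normal_subgroup[OF group_hom_axioms surj])
  interpret c: group_hom "completion G U" "completion H (h ` U)" "completion_map H (h ` U) h"
    by (rule completion_map_hom[OF U hU order_refl])
  show ?thesis
  proof
    show "carrier (completion H (h ` U)) \<subseteq> completion_map H (h ` U) h ` carrier (completion G U)"
    proof
      fix y assume "y \<in> carrier (completion H (h ` U))"
      then obtain v where "coherent H (h ` U) v" "y = coset_seq H (h ` U) v" by (auto simp: H.completion_carrier[OF hU])
      then obtain u where u: "coherent G U u" "coset_seq H (h ` U) (\<lambda>n. h (u n)) = y" using ex_coherent_lift[OF U surj] by blast
      then have "y = completion_map H (h ` U) h (coset_seq G U u)"
        using completion_map_coset_seq[OF U hU order_refl u(1)] by simp
      then show "y \<in> completion_map H (h ` U) h ` carrier (completion G U)"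
        using u(1) by (auto simp: G.completion_carrier[OF U])
    qed
  qed auto
qed

text \<open>For the kernel N of a split surjection, N meet gamma_n G equals gamma_n(N, G): the
  identity and s h agree modulo N, hence by \<open>hom_congr_lcs\<close> modulo gamma_n(N, G) on
  gamma_n G, and s h is trivial on N. So once the representatives are moved into N, absolute
  coherence becomes relative coherence.\<close>

lemma kernel_coherent_split:
  assumes s: "s \<in> hom H G" and hs: "\<And>x. x \<in> carrier H \<Longrightarrow> h (s x) = x"
    and u: "coherent G (carrier G) u" "\<And>n. h (u n) \<in> rel_lcs H (carrier H) n"
  shows "\<exists>v. coherent G (kernel G H h) v \<and> coset_seq G (carrier G) v = coset_seq G (carrier G) u"
proof -
  interpret s: group_hom H G s using s by (simp add: group_hom_def group_hom_axioms_def)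
  let ?N = "kernel G H h"
  have N: "?N \<lhd> G" by (rule normal_kernel)
  have uc: "u n \<in> carrier G" for n by (rule G.coherent_carrier[OF G.normal_self u(1)])
  \<comment> \<open>s(h(u n)) lies in the n-th lower central term, so dividing by it moves u n into
    the kernel without changing its class modulo that term.\<close>
  define v where "v n = u n \<otimes> inv (s (h (u n)))" for n
  have vN: "v n \<in> ?N" for n using uc[of n] hs by (simp add: v_def kernel_def)
  have shu: "s (h (u n)) \<in> rel_lcs G (carrier G) n" for n
    by (rule s.hom_rel_lcs[OF _ _ G.normal_self u(2)]) auto
  have split: "t \<in> rel_lcs G ?N n" if t: "t \<in> ?N" "t \<in> rel_lcs G (carrier G) n" for t n
  proof -
    have "t \<otimes> inv (s (h t)) \<in> rel_lcs G ?N n"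
    proof (rule hom_congr_lcs[OF G.group_axioms G.group_axioms N, where a="\<lambda>x. x" and d="\<lambda>x. s (h x)", OF _ _ _ t(2)])
      show "(\<lambda>x. s (h x)) \<in> hom G G" using Group.hom_compose[OF homh s] by (simp add: comp_def)
    qed (auto simp: hom_def kernel_def hs)
    then show ?thesis using t(1) by (simp add: kernel_def)
  qed
  have vu: "v n \<otimes> inv (u n) \<in> rel_lcs G (carrier G) n" for n
  proof -
    interpret F: normal "rel_lcs G (carrier G) n" G by (rule G.rel_lcs_normal[OF G.normal_self])
    have "u n \<otimes> inv (s (h (u n))) \<otimes> inv (u n) \<in> rel_lcs G (carrier G) n"
      using shu uc by (intro F.inv_op_closed2 F.m_inv_closed) auto
    then show ?thesis by (simp add: v_def)
  qed
  have vc: "v n \<in> carrier G" for n using vN by (simp add: kernel_def)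
  have "v (Suc n) \<otimes> inv (v n) \<in> rel_lcs G ?N n" for n
  proof (rule split)
    interpret Nn: normal ?N G by (rule N)
    show "v (Suc n) \<otimes> inv (v n) \<in> ?N" using vN by blast
    interpret F: normal "rel_lcs G (carrier G) n" G by (rule G.rel_lcs_normal[OF G.normal_self])
    have "v (Suc n) \<otimes> inv (u (Suc n)) \<in> rel_lcs G (carrier G) n"
      using vu[of "Suc n"] G.rel_lcs_Suc_subset[OF G.normal_self, of n] by blast
    then have "(v (Suc n) \<otimes> inv (u (Suc n))) \<otimes> (u (Suc n) \<otimes> inv (u n)) \<otimes> inv (v n \<otimes> inv (u n)) \<in> rel_lcs G (carrier G) n"
      using u(1) by (intro F.m_closed[OF F.m_closed F.m_inv_closed[OF vu]]) (simp_all add: coherent_def)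
    then show "v (Suc n) \<otimes> inv (v n) \<in> rel_lcs G (carrier G) n" using uc vc by (simp add: G.word_simps)
  qed
  then have "coherent G ?N v" using vN by (simp add: coherent_def)
  moreover have "coset_seq G (carrier G) v = coset_seq G (carrier G) u"
    using vu uc vc by (subst G.coset_seq_eq_iff[OF G.normal_self]) auto
  ultimately show ?thesis by blast
qed

text \<open>In place of a section, an element z(n) of the n-th lower central term with the same
  image as u(n) is used to move u(n) into the kernel. The result is coherent only for the absolute
  series; finiteness and \<open>ex_coherent_approximation\<close> make it coherent for the relative
  one.\<close>

lemma kernel_coherent_finite:
  assumes surj: "h ` carrier G = carrier H"
    and fin: "\<And>n. finite ((\<lambda>t. rel_lcs G (kernel G H h) n #> t) ` (kernel G H h \<inter> rel_lcs G (carrier G) n))"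
    and u: "coherent G (carrier G) u" "\<And>n. h (u n) \<in> rel_lcs H (carrier H) n"
  shows "\<exists>v. coherent G (kernel G H h) v \<and> coset_seq G (carrier G) v = coset_seq G (carrier G) u"
proof -
  let ?R = "kernel G H h"
  have uc: "u n \<in> carrier G" for n by (rule G.coherent_carrier[OF G.normal_self u(1)])
  have norm: "rel_lcs G (carrier G) n \<lhd> G" for n by (rule G.rel_lcs_normal[OF G.normal_self])
  have "\<exists>z. z \<in> rel_lcs G (carrier G) n \<and> h z = h (u n)" for n
    using image_rel_lcs[OF G.normal_self surj, of n] u(2)[of n] unfolding surj by (metis imageE)
  then obtain z where z: "\<And>n. z n \<in> rel_lcs G (carrier G) n \<and> h (z n) = h (u n)" by metis
  have zc: "z n \<in> carrier G" for n using z[of n] G.rel_lcs_carrier[OF G.normal_self] by blast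
  define r where "r n = u n \<otimes> inv (z n)" for n
  have rc: "r n \<in> carrier G" for n using uc zc by (simp add: r_def)
  have rR: "r n \<in> ?R" for n using uc zc z by (simp add: r_def kernel_def)
  have ru: "r n \<otimes> inv (u n) \<in> rel_lcs G (carrier G) n" for n
  proof -
    interpret F: normal "rel_lcs G (carrier G) n" G by (rule norm)
    show ?thesis unfolding r_def using z uc by (intro F.inv_op_closed2 F.m_inv_closed) auto
  qed
  have rd: "r (Suc n) \<otimes> inv (r n) \<in> rel_lcs G (carrier G) n" for n
  proof -
    interpret F: normal "rel_lcs G (carrier G) n" G by (rule norm)
    have "r (Suc n) \<otimes> inv (u (Suc n)) \<in> rel_lcs G (carrier G) n"
      using ru[of "Suc n"] G.rel_lcs_Suc_subset[OF G.normal_self, of n] by blast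
    then have "(r (Suc n) \<otimes> inv (u (Suc n))) \<otimes> (u (Suc n) \<otimes> inv (u n)) \<otimes> inv (r n \<otimes> inv (u n)) \<in> rel_lcs G (carrier G) n"
      using u(1) by (intro F.m_closed[OF F.m_closed F.m_inv_closed[OF ru]]) (simp_all add: coherent_def)
    then show ?thesis using uc rc by (simp add: G.word_simps)
  qed
  obtain v where v: "coherent G ?R v" "\<And>n. v n \<otimes> inv (r n) \<in> rel_lcs G (carrier G) n"
    using G.ex_coherent_approximation[where r=r, OF normal_kernel fin rR rd] by blast
  have vc: "v n \<in> carrier G" for n by (rule G.coherent_carrier[OF normal_kernel v(1)])
  have "v n \<otimes> inv (u n) \<in> rel_lcs G (carrier G) n" for n
  proof -
    interpret F: normal "rel_lcs G (carrier G) n" G by (rule norm)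
    have "(v n \<otimes> inv (r n)) \<otimes> (r n \<otimes> inv (u n)) \<in> rel_lcs G (carrier G) n" using v(2) ru by blast
    then show ?thesis using uc rc vc by (simp add: G.word_simps)
  qed
  then have "coset_seq G (carrier G) v = coset_seq G (carrier G) u"
    using uc vc by (subst G.coset_seq_eq_iff[OF G.normal_self]) auto
  then show ?thesis using v(1) by blast
qed

end

section \<open>Free groups\<close>

abbreviation reduced :: "'x fword \<Rightarrow> bool" where
  "reduced \<equiv> successively (\<lambda>a b. \<not> inverse_letters a b)"

lemma reduced_Cons: "reduced (a # w) \<longleftrightarrow> reduced w \<and> (case w of [] \<Rightarrow> True | b # v \<Rightarrow> \<not> inverse_letters a b)"
  by (cases w) auto

lemma reduced_letter_mult: "reduced w \<Longrightarrow> reduced (letter_mult a w)"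
  by (cases w) (auto simp: letter_mult_def reduced_Cons)

lemma reduced_foldr: "reduced w \<Longrightarrow> reduced (foldr letter_mult u w)"
  by (induction u) (auto intro: reduced_letter_mult)

lemma letter_mult_cancel: "\<lbrakk>reduced w; inverse_letters a b\<rbrakk> \<Longrightarrow> letter_mult a (letter_mult b w) = w"
  by (cases a; cases b; cases w) (auto simp: letter_mult_def reduced_Cons inverse_letters_def split: list.splits if_splits)

text \<open>The heart of associativity, by van der Waerden's argument: letters act on reduced words,
  and inverse letters undo each other, so cancelling before acting or acting letter by letter gives
  the same word.\<close>

lemma foldr_letter_mult:
  "\<lbrakk>reduced v; reduced w\<rbrakk> \<Longrightarrow> foldr letter_mult (letter_mult a v) w = letter_mult a (foldr letter_mult v w)"
proof (cases v)
  case (Cons b v')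
  assume "reduced v" "reduced w"
  then have "letter_mult a (letter_mult b (foldr letter_mult v' w)) = foldr letter_mult v' w" if "inverse_letters a b"
    using that Cons by (auto simp: reduced_Cons reduced_foldr letter_mult_cancel)
  then show ?thesis by (auto simp: Cons letter_mult_def[of a "b # v'"])
qed (simp add: letter_mult_def[of a "[]"])

lemma foldr_letter_mult_assoc:
  "\<lbrakk>reduced u; reduced v; reduced w\<rbrakk> \<Longrightarrow>
    foldr letter_mult (foldr letter_mult u v) w = foldr letter_mult u (foldr letter_mult v w)"
  by (induction u) (auto simp: reduced_Cons foldr_letter_mult reduced_foldr)

lemma set_letter_mult: "set (letter_mult a w) \<subseteq> insert a (set w)"
  by (cases w) (auto simp: letter_mult_def)

lemma set_foldr_letter_mult: "set (foldr letter_mult u w) \<subseteq> set u \<union> set w"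
  by (induction u) (use set_letter_mult in fastforce)+

lemma snd_set_foldr_letter_mult:
  "\<lbrakk>snd ` set u \<subseteq> S; snd ` set w \<subseteq> S\<rbrakk> \<Longrightarrow> snd ` set (foldr letter_mult u w) \<subseteq> S"
  using set_foldr_letter_mult[of u w] by blast

lemma free_group_group: "group (free_group S)"
proof (rule groupI)
  fix x y z assume "x \<in> carrier (free_group S)" "y \<in> carrier (free_group S)" "z \<in> carrier (free_group S)"
  then show "x \<otimes>\<^bsub>free_group S\<^esub> y \<otimes>\<^bsub>free_group S\<^esub> z = x \<otimes>\<^bsub>free_group S\<^esub> (y \<otimes>\<^bsub>free_group S\<^esub> z)"
    by (simp add: free_group_def foldr_letter_mult_assoc)
next
  fix x y assume "x \<in> carrier (free_group S)" "y \<in> carrier (free_group S)"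
  then show "x \<otimes>\<^bsub>free_group S\<^esub> y \<in> carrier (free_group S)"
    using snd_set_foldr_letter_mult[of x S y] by (simp add: free_group_def reduced_foldr)
next
  \<comment> \<open>A left inverse is built letter by letter: a left inverse of the tail is
    multiplied on the right by the inverse of the first letter.\<close>
  have "\<exists>y. snd ` set y \<subseteq> S \<and> reduced y \<and> foldr letter_mult y x = []" if "snd ` set x \<subseteq> S" "reduced x" for x
    using that
  proof (induction x)
    case (Cons a x)
    let ?b = "(\<not> fst a, snd a)"
    have rx: "reduced x" using Cons.prems by (simp add: reduced_Cons)
    obtain y where y: "snd ` set y \<subseteq> S" "reduced y" "foldr letter_mult y x = []"
      using Cons.IH Cons.prems rx by auto
    have "foldr letter_mult (foldr letter_mult y [?b]) (a # x) = foldr letter_mult y (letter_mult ?b (a # x))"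
      using foldr_letter_mult_assoc[OF y(2) _ Cons.prems(2), of "[?b]"] by simp
    also have "letter_mult ?b (a # x) = x" by (simp add: letter_mult_def inverse_letters_def)
    finally show ?case
      using y Cons.prems snd_set_foldr_letter_mult[of y S "[?b]"] reduced_foldr[of "[?b]" y]
      by (intro exI[of _ "foldr letter_mult y [?b]"]) simp
  qed (auto intro!: exI[of _ "[]"])
  then show "\<exists>y\<in>carrier (free_group S). y \<otimes>\<^bsub>free_group S\<^esub> x = \<one>\<^bsub>free_group S\<^esub>" if "x \<in> carrier (free_group S)" for x
    using that by (auto simp: free_group_def)
qed (auto simp: free_group_def)

lemma free_lift_Nil [simp]: "free_lift H f [] = \<one>\<^bsub>H\<^esub>"
  by (simp add: free_lift_def)

lemma free_lift_Cons:
  "free_lift H f (a # w) = (if fst a then f (snd a) else inv\<^bsub>H\<^esub> (f (snd a))) \<otimes>\<^bsub>H\<^esub> free_lift H f w"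
  by (simp add: free_lift_def case_prod_beta)

lemma free_lift_closed:
  assumes "group H" "\<And>x. x \<in> S \<Longrightarrow> f x \<in> carrier H" "snd ` set w \<subseteq> S"
  shows "free_lift H f w \<in> carrier H"
proof -
  interpret H: group H by fact
  show ?thesis using assms(3) by (induction w) (auto simp: free_lift_Cons assms(2))
qed

text \<open>Cancelling inverse letters does not change the value in a group; this is what makes
  \<open>free_lift\<close> multiplicative.\<close>

lemma free_lift_letter_mult:
  assumes H: "group H" and f: "\<And>x. x \<in> S \<Longrightarrow> f x \<in> carrier H" and aw: "snd ` set (a # w) \<subseteq> S"
  shows "free_lift H f (letter_mult a w) = free_lift H f (a # w)"
proof (cases w)
  case (Cons b v)
  interpret H: group H by fact
  have v: "free_lift H f v \<in> carrier H" and "f (snd b) \<in> carrier H"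
    using aw by (auto simp: Cons f intro!: free_lift_closed[OF H f])
  then have "free_lift H f (a # b # v) = free_lift H f v" if "inverse_letters a b"
    using that by (auto simp: free_lift_Cons inverse_letters_def H.word_simps)
  then show ?thesis by (auto simp: letter_mult_def Cons)
qed (simp add: letter_mult_def)

lemma free_lift_hom:
  assumes H: "group H" and f: "\<And>x. x \<in> S \<Longrightarrow> f x \<in> carrier H"
  shows "free_lift H f \<in> hom (free_group S) H"
proof (rule homI)
  interpret H: group H by fact
  have c: "free_lift H f w \<in> carrier H" if "snd ` set w \<subseteq> S" for w
    by (rule free_lift_closed[OF H f that])
  show "free_lift H f x \<in> carrier H" if "x \<in> carrier (free_group S)" for x
    using that c by (simp add: free_group_def)
  fix x y assume "x \<in> carrier (free_group S)" "y \<in> carrier (free_group S)"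
  then have "snd ` set x \<subseteq> S" "snd ` set y \<subseteq> S" by (auto simp: free_group_def)
  then have "free_lift H f (foldr letter_mult x y) = free_lift H f x \<otimes>\<^bsub>H\<^esub> free_lift H f y"
  proof (induction x)
    case Nil
    then show ?case using c by simp
  next
    case (Cons a x)
    have sub: "snd ` set (a # foldr letter_mult x y) \<subseteq> S"
      using snd_set_foldr_letter_mult[of x S y] Cons.prems by auto
    have "free_lift H f (foldr letter_mult (a # x) y) = free_lift H f (a # foldr letter_mult x y)"
      using free_lift_letter_mult[OF H f sub] by simp
    also have "\<dots> = free_lift H f (a # x) \<otimes>\<^bsub>H\<^esub> free_lift H f y"
      using Cons c[of x] c[of y] f[of "snd a"] by (simp add: free_lift_Cons H.m_assoc)
    finally show ?case .
  qed
  then show "free_lift H f (x \<otimes>\<^bsub>free_group S\<^esub> y) = free_lift H f x \<otimes>\<^bsub>H\<^esub> free_lift H f y"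
    by (simp add: free_group_def)
qed

lemma free_lift_gen: "\<lbrakk>group H; f x \<in> carrier H\<rbrakk> \<Longrightarrow> free_lift H f [(True, x)] = f x"
  by (simp add: free_lift_def group.is_monoid monoid.r_one)

lemma generate_free_group:
  "generate (free_group S) ((\<lambda>x. [(True, x)]) ` S) = carrier (free_group S)"
proof
  interpret F: group "free_group S" by (rule free_group_group)
  have sub: "(\<lambda>x. [(True, x)]) ` S \<subseteq> carrier (free_group S)" by (auto simp: free_group_def)
  then show "generate (free_group S) ((\<lambda>x. [(True, x)]) ` S) \<subseteq> carrier (free_group S)"
    by (rule F.generate_incl)
  have inv: "inv\<^bsub>free_group S\<^esub> [(True, x)] = [(False, x)]" if "x \<in> S" for x
    by (rule F.inv_equality) (use that in \<open>auto simp: free_group_def letter_mult_def inverse_letters_def\<close>)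
  show "carrier (free_group S) \<subseteq> generate (free_group S) ((\<lambda>x. [(True, x)]) ` S)"
  proof
    fix w assume "w \<in> carrier (free_group S)"
    then have "snd ` set w \<subseteq> S" "reduced w" by (auto simp: free_group_def)
    then show "w \<in> generate (free_group S) ((\<lambda>x. [(True, x)]) ` S)"
    proof (induction w)
      case Nil
      then show ?case using generate.one[of "free_group S"] by (simp add: free_group_def)
    next
      case (Cons a w)
      have "[a] \<in> generate (free_group S) ((\<lambda>x. [(True, x)]) ` S)"
        using Cons.prems inv generate.incl[of "[(True, snd a)]" "(\<lambda>x. [(True, x)]) ` S" "free_group S"]
          generate.inv[of "[(True, snd a)]" "(\<lambda>x. [(True, x)]) ` S" "free_group S"]
        by (cases a; cases "fst a") auto
      moreover have "w \<in> generate (free_group S) ((\<lambda>x. [(True, x)]) ` S)"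
        using Cons by (simp add: reduced_Cons)
      moreover have "[a] \<otimes>\<^bsub>free_group S\<^esub> w = a # w"
        using Cons.prems by (cases w) (auto simp: free_group_def letter_mult_def)
      ultimately show ?case by (metis generate.eng)
    qed
  qed
qed

lemma self_free_free_group: "self_free (free_group S) ((\<lambda>x. [(True, x)]) ` S)"
proof -
  interpret F: group "free_group S" by (rule free_group_group)
  show ?thesis
  proof
    fix \<phi> :: "'a fword \<Rightarrow> 'a fword"
    assume *: "\<And>b. b \<in> (\<lambda>x. [(True, x)]) ` S \<Longrightarrow> \<phi> b \<in> carrier (free_group S)"
    then show "\<exists>h\<in>hom (free_group S) (free_group S). \<forall>b\<in>(\<lambda>x. [(True, x)]) ` S. h b = \<phi> b"
      by (intro bexI[of _ "free_lift (free_group S) (\<lambda>x. \<phi> [(True, x)])"] free_lift_hom)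
        (auto simp: free_lift_gen F.group_axioms)
  next
    show "(\<lambda>x. [(True, x)]) ` S \<subseteq> carrier (free_group S)" by (auto simp: free_group_def)
  qed (rule generate_free_group)
qed

section \<open>The fundamental group of W-bar of a simplicial group\<close>

locale simplicial_group_low =
  d0: group_hom K1 K0 d0 + d1: group_hom K1 K0 d1 + s0: group_hom K0 K1 s0
  for K :: "'a sgroup" and K0 K1 :: "'a monoid" and d0 d1 s0 :: "'a \<Rightarrow> 'a" +
  assumes K0: "K0 = level K 0" and K1: "K1 = level K (Suc 0)"
    and d0: "d0 = gface K (Suc 0) 0" and d1: "d1 = gface K (Suc 0) (Suc 0)"
    and d0s0: "\<And>x. x \<in> carrier K0 \<Longrightarrow> d0 (s0 x) = x"
    and d1s0: "\<And>x. x \<in> carrier K0 \<Longrightarrow> d1 (s0 x) = x"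
begin

text \<open>The boundaries in degree 0 of the Moore complex, so that \<open>K0\<close> modulo B is
  pi_0 of the simplicial group.\<close>

definition B where "B = d0 ` kernel K1 K0 d1"

definition cl where "cl x = (\<lambda>k. [k]) ` (B #>\<^bsub>K0\<^esub> x)"

lemma B_normal: "B \<lhd> K0"
proof -
  interpret k: normal "kernel K1 K0 d1" K1 by (rule d1.normal_kernel)
  have "x \<in> d0 ` carrier K1" if "x \<in> carrier K0" for x
    using d0s0[OF that] s0.hom_closed[OF that] by (metis imageI)
  then have "d0 ` carrier K1 = carrier K0" using d0.hom_closed by blast
  then show ?thesis unfolding B_def by (rule k.surj_hom_normal_subgroup[OF d0.group_hom_axioms])
qed

sublocale B: normal B K0 by (rule B_normal)

text \<open>\<open>pi1\<close> sees only simplices of dimension at most 2, and these involve only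
  the levels 0 and 1 of K; hence the short list of data in the locale.\<close>

lemma simplices: "simplices (wbar K) (Suc 0) = (\<lambda>k. [k]) ` carrier K0"
  "simplices (wbar K) 2 = {[g, k] |g k. g \<in> carrier K1 \<and> k \<in> carrier K0}"
  by (auto simp: wbar_def K0 K1 length_Suc_conv numeral_2_eq_2 less_Suc_eq)

lemma faces: "face (wbar K) (Suc 0) i [k] = []" if "i \<le> 1"
  using that by (cases i) (auto simp: wbar_def)

lemma faces2:
  "face (wbar K) 2 0 [g, k] = [k]"
  "face (wbar K) 2 (Suc 0) [g, k] = [d0 g \<otimes>\<^bsub>K0\<^esub> k]"
  "face (wbar K) 2 2 [g, k] = [d1 g]"
  by (simp_all add: wbar_def K0 d0 d1 numeral_2_eq_2)

lemma degen0: "degen (wbar K) 0 0 [] = [\<one>\<^bsub>K0\<^esub>]"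
  by (simp add: wbar_def K0)

lemma loops: "loops (wbar K) [] = (\<lambda>k. [k]) ` carrier K0"
  by (auto simp: loops_def simplices faces)

text \<open>Dividing g by the degenerate element s0(d1 g) moves it into the kernel of d1, and d0 of
  the result is the quotient of the two faces of g.\<close>

lemma cong_d: "d0 g \<otimes>\<^bsub>K0\<^esub> inv\<^bsub>K0\<^esub> d1 g \<in> B" if "g \<in> carrier K1"
proof -
  have "g \<otimes>\<^bsub>K1\<^esub> inv\<^bsub>K1\<^esub> s0 (d1 g) \<in> kernel K1 K0 d1"
    using that by (simp add: kernel_def d1s0)
  moreover have "d0 (g \<otimes>\<^bsub>K1\<^esub> inv\<^bsub>K1\<^esub> s0 (d1 g)) = d0 g \<otimes>\<^bsub>K0\<^esub> inv\<^bsub>K0\<^esub> d1 g"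
    using that by (simp add: d0s0)
  ultimately show ?thesis unfolding B_def by (metis imageI)
qed

text \<open>Converse of \<open>cong_d\<close>: translate an element of the kernel of d1 by a
  degenerate one.\<close>

lemma ex_d: "\<exists>g\<in>carrier K1. d0 g = b \<otimes>\<^bsub>K0\<^esub> x \<and> d1 g = x" if b: "b \<in> B" and x: "x \<in> carrier K0"
proof -
  obtain k where "k \<in> carrier K1" "d1 k = \<one>\<^bsub>K0\<^esub>" "b = d0 k" using b by (auto simp: B_def kernel_def)
  then show ?thesis using x by (intro bexI[of _ "k \<otimes>\<^bsub>K1\<^esub> s0 x"]) (auto simp: d0s0 d1s0)
qed

text \<open>A homotopy is a 2-simplex [g, 1], whose remaining faces are given by d0 g and d1 g. By
  \<open>cong_d\<close> and \<open>ex_d\<close> the pairs that occur are those with equal cosets of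
  B.\<close>

lemma loop_homotopy: "(u, v) \<in> loop_homotopy (wbar K) [] \<longleftrightarrow>
    (\<exists>a b. u = [a] \<and> v = [b] \<and> a \<in> carrier K0 \<and> b \<in> carrier K0 \<and> B #>\<^bsub>K0\<^esub> a = B #>\<^bsub>K0\<^esub> b)"
proof
  assume "(u, v) \<in> loop_homotopy (wbar K) []"
  then obtain g where "g \<in> carrier K1" "u = [d0 g]" "v = [d1 g]"
    by (auto simp: loop_homotopy_def loops simplices faces2 degen0)
  then show "\<exists>a b. u = [a] \<and> v = [b] \<and> a \<in> carrier K0 \<and> b \<in> carrier K0 \<and> B #>\<^bsub>K0\<^esub> a = B #>\<^bsub>K0\<^esub> b"
    using cong_d by (auto simp: B.Mod_eq_iff)
next
  assume "\<exists>a b. u = [a] \<and> v = [b] \<and> a \<in> carrier K0 \<and> b \<in> carrier K0 \<and> B #>\<^bsub>K0\<^esub> a = B #>\<^bsub>K0\<^esub> b"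
  then obtain a b where ab: "u = [a]" "v = [b]" "a \<in> carrier K0" "b \<in> carrier K0" "a \<otimes>\<^bsub>K0\<^esub> inv\<^bsub>K0\<^esub> b \<in> B"
    by (auto simp: B.Mod_eq_iff)
  then obtain g where "g \<in> carrier K1" "d0 g = a" "d1 g = b" using ex_d[OF ab(5,4)] by (auto simp: d0.H.m_assoc)
  then show "(u, v) \<in> loop_homotopy (wbar K) []"
    using ab by (auto simp: loop_homotopy_def loops simplices degen0 faces2 intro!: exI[of _ "[g, \<one>\<^bsub>K0\<^esub>]"])
qed

lemma coset_eq: "y \<in> B #>\<^bsub>K0\<^esub> x \<longleftrightarrow> y \<in> carrier K0 \<and> B #>\<^bsub>K0\<^esub> y = B #>\<^bsub>K0\<^esub> x" if "x \<in> carrier K0"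
  using that d0.H.repr_independence[OF _ that B.subgroup_axioms, of y] d0.H.rcos_self[OF _ B.subgroup_axioms, of y]
    d0.H.r_coset_subset_G[OF B.subset that] by blast

lemma homotopy_class: "x \<in> carrier K0 \<Longrightarrow> loop_homotopy (wbar K) [] `` {[x]} = cl x"
  by (auto simp: loop_homotopy cl_def coset_eq image_iff)

lemma cl_eq_iff: "\<lbrakk>x \<in> carrier K0; y \<in> carrier K0\<rbrakk> \<Longrightarrow> cl x = cl y \<longleftrightarrow> x \<otimes>\<^bsub>K0\<^esub> inv\<^bsub>K0\<^esub> y \<in> B"
  unfolding cl_def by (simp add: inj_image_eq_iff inj_def B.Mod_eq_iff)

lemma pi1_carrier: "carrier (pi1 (wbar K) []) = cl ` carrier K0"
  by (auto simp: pi1_def quotient_def loops homotopy_class)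

lemma pi1_one: "\<one>\<^bsub>pi1 (wbar K) []\<^esub> = cl \<one>\<^bsub>K0\<^esub>"
  by (simp add: pi1_def degen0 homotopy_class)

text \<open>A 2-simplex [g, k] exhibits d0 g times k as a product of d1 g and k, and d0 g and d1 g
  agree modulo B. As the product in \<open>pi1\<close> collects the results of all fillers, the
  whole coset has to be reached as well; \<open>ex_d\<close> supplies the fillers.\<close>

lemma pi1_mult:
  assumes x: "x \<in> carrier K0" and y: "y \<in> carrier K0"
  shows "cl x \<otimes>\<^bsub>pi1 (wbar K) []\<^esub> cl y = cl (x \<otimes>\<^bsub>K0\<^esub> y)"
proof -
  have mem: "[a] \<in> cl w \<longleftrightarrow> a \<in> B #>\<^bsub>K0\<^esub> w" for a w by (auto simp: cl_def)
  have "cl x \<otimes>\<^bsub>pi1 (wbar K) []\<^esub> cl y =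
      {[d0 g \<otimes>\<^bsub>K0\<^esub> k] |g k. g \<in> carrier K1 \<and> k \<in> carrier K0 \<and> d1 g \<in> B #>\<^bsub>K0\<^esub> x \<and> k \<in> B #>\<^bsub>K0\<^esub> y}"
  proof (intro equalityI subsetI)
    fix z assume "z \<in> cl x \<otimes>\<^bsub>pi1 (wbar K) []\<^esub> cl y"
    then obtain s where "s \<in> simplices (wbar K) 2" "face (wbar K) 2 2 s \<in> cl x" "face (wbar K) 2 0 s \<in> cl y"
      "z = face (wbar K) 2 (Suc 0) s" by (auto simp: pi1_def)
    then show "z \<in> {[d0 g \<otimes>\<^bsub>K0\<^esub> k] |g k. g \<in> carrier K1 \<and> k \<in> carrier K0 \<and> d1 g \<in> B #>\<^bsub>K0\<^esub> x \<and> k \<in> B #>\<^bsub>K0\<^esub> y}"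
      unfolding simplices by (auto simp: faces2 mem) blast
  next
    fix z assume "z \<in> {[d0 g \<otimes>\<^bsub>K0\<^esub> k] |g k. g \<in> carrier K1 \<and> k \<in> carrier K0 \<and> d1 g \<in> B #>\<^bsub>K0\<^esub> x \<and> k \<in> B #>\<^bsub>K0\<^esub> y}"
    then obtain g k where "z = [d0 g \<otimes>\<^bsub>K0\<^esub> k]" "g \<in> carrier K1" "k \<in> carrier K0" "d1 g \<in> B #>\<^bsub>K0\<^esub> x" "k \<in> B #>\<^bsub>K0\<^esub> y"
      by blast
    then have "[g, k] \<in> simplices (wbar K) 2 \<and> face (wbar K) 2 2 [g, k] \<in> cl x \<and> face (wbar K) 2 0 [g, k] \<in> cl y
        \<and> z = face (wbar K) 2 (Suc 0) [g, k]"
      by (simp add: simplices faces2 mem)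
    then show "z \<in> cl x \<otimes>\<^bsub>pi1 (wbar K) []\<^esub> cl y" unfolding pi1_def by auto
  qed
  also have "\<dots> = cl (x \<otimes>\<^bsub>K0\<^esub> y)"
  proof (intro equalityI subsetI)
    fix z assume "z \<in> {[d0 g \<otimes>\<^bsub>K0\<^esub> k] |g k. g \<in> carrier K1 \<and> k \<in> carrier K0 \<and> d1 g \<in> B #>\<^bsub>K0\<^esub> x \<and> k \<in> B #>\<^bsub>K0\<^esub> y}"
    then obtain g k where g: "z = [d0 g \<otimes>\<^bsub>K0\<^esub> k]" "g \<in> carrier K1" "k \<in> carrier K0"
      "B #>\<^bsub>K0\<^esub> d1 g = B #>\<^bsub>K0\<^esub> x" "B #>\<^bsub>K0\<^esub> k = B #>\<^bsub>K0\<^esub> y" using x y by (auto simp: coset_eq)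
    have "B #>\<^bsub>K0\<^esub> d0 g = B #>\<^bsub>K0\<^esub> d1 g" using cong_d[OF g(2)] g(2) by (simp add: B.Mod_eq_iff)
    then have "B #>\<^bsub>K0\<^esub> (d0 g \<otimes>\<^bsub>K0\<^esub> k) = B #>\<^bsub>K0\<^esub> (x \<otimes>\<^bsub>K0\<^esub> y)"
      using B.rcos_sum[of "d0 g" k] B.rcos_sum[OF x y] g by simp
    then show "z \<in> cl (x \<otimes>\<^bsub>K0\<^esub> y)" using g x y by (auto simp: cl_def coset_eq)
  next
    fix z assume "z \<in> cl (x \<otimes>\<^bsub>K0\<^esub> y)"
    then obtain b where b: "b \<in> B" "z = [b \<otimes>\<^bsub>K0\<^esub> (x \<otimes>\<^bsub>K0\<^esub> y)]" by (auto simp: cl_def r_coset_def)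
    obtain g where g: "g \<in> carrier K1" "d0 g = b \<otimes>\<^bsub>K0\<^esub> x" "d1 g = x" using ex_d[OF b(1) x] by blast
    have "z = [d0 g \<otimes>\<^bsub>K0\<^esub> y]" using b g x y by (simp add: d0.H.m_assoc)
    moreover have "d1 g \<in> B #>\<^bsub>K0\<^esub> x" "y \<in> B #>\<^bsub>K0\<^esub> y" using g x y by (simp_all add: coset_eq)
    ultimately show "z \<in> {[d0 g \<otimes>\<^bsub>K0\<^esub> k] |g k. g \<in> carrier K1 \<and> k \<in> carrier K0 \<and> d1 g \<in> B #>\<^bsub>K0\<^esub> x \<and> k \<in> B #>\<^bsub>K0\<^esub> y}"
      using g(1) y by blast
  qed
  finally show ?thesis .
qed

text \<open>The group axioms for \<open>pi1\<close> are transported along the surjection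
  \<open>cl\<close>, which avoids horn filling in \<open>wbar\<close>.\<close>

lemma cl_group_hom: "group_hom K0 (pi1 (wbar K) []) cl"
proof -
  have h: "cl \<in> hom K0 (pi1 (wbar K) [])"
    by (auto simp: hom_def pi1_carrier pi1_mult)
  have "group ((pi1 (wbar K) [])\<lparr>carrier := cl ` carrier K0, one := cl \<one>\<^bsub>K0\<^esub>\<rparr>)"
    by (rule d0.H.hom_imp_img_group[OF h])
  moreover have "(pi1 (wbar K) [])\<lparr>carrier := cl ` carrier K0, one := cl \<one>\<^bsub>K0\<^esub>\<rparr> = pi1 (wbar K) []"
    by (simp add: pi1_carrier[symmetric] pi1_one[symmetric])
  ultimately show ?thesis using h d0.H.group_axioms by (simp add: group_hom_def group_hom_axioms_def)
qed

end

section \<open>The loop group of a nerve\<close>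

lemma (in group) coherent_mono:
  assumes "U \<subseteq> V" "coherent G U u"
  shows "coherent G V u"
  using assms rel_lcs_mono[OF assms(1)] unfolding coherent_def by blast

lemma (in group) coset_seq_mono:
  assumes "U \<lhd> G" "V \<lhd> G" "U \<subseteq> V" "\<And>n. u n \<in> carrier G" "\<And>n. v n \<in> carrier G" "coset_seq G U u = coset_seq G U v"
  shows "coset_seq G V u = coset_seq G V v"
  using assms(6) rel_lcs_mono[OF assms(3)]
  unfolding coset_seq_eq_iff[OF assms(1,4,5)] coset_seq_eq_iff[OF assms(2,4,5)] by blast

text \<open>An element killed by the completed d1 has representatives in the kernel of d1 by
  \<open>kernel_coherent_split\<close>, since s0 is a section of d1; applying d0 gives one
  inclusion. For the other, coherent sequences in the image of that kernel lift along the surjection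
  d0 by \<open>ex_coherent_lift\<close>.\<close>

lemma completed_boundary:
  assumes "group_hom F1 F0 d0" "group_hom F1 F0 d1" "group_hom F0 F1 s0"
    and d0s0: "\<And>x. x \<in> carrier F0 \<Longrightarrow> d0 (s0 x) = x"
    and d1s0: "\<And>x. x \<in> carrier F0 \<Longrightarrow> d1 (s0 x) = x"
  shows "completion_map F0 (carrier F0) d0 ` kernel (hat F1) (hat F0) (completion_map F0 (carrier F0) d1)
    = coset_seq F0 (carrier F0) ` {u. coherent F0 (d0 ` kernel F1 F0 d1) u}"
proof -
  interpret d0: group_hom F1 F0 d0 by fact
  interpret d1: group_hom F1 F0 d1 by fact
  interpret s0: group_hom F0 F1 s0 by fact
  let ?K = "kernel F1 F0 d1"
  have K: "?K \<lhd> F1" by (rule d1.normal_kernel)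
  then interpret K: normal ?K F1 .
  note n0 = d0.H.normal_self and n1 = d0.G.normal_self
  have d0surj: "d0 ` carrier F1 = carrier F0"
  proof -
    have "x \<in> d0 ` carrier F1" if "x \<in> carrier F0" for x
      using d0s0[OF that] s0.hom_closed[OF that] by (metis imageI)
    then show ?thesis using d0.hom_closed by blast
  qed
  have dK: "d0 ` ?K \<lhd> F0" by (rule K.surj_hom_normal_subgroup[OF d0.group_hom_axioms d0surj])
  have Kc: "?K \<subseteq> carrier F1" by (rule K.subset)
  have dKc: "d0 ` ?K \<subseteq> carrier F0" using Kc by auto
  have sub: "d0 ` carrier F1 \<subseteq> carrier F0" "d1 ` carrier F1 \<subseteq> carrier F0" by auto
  note cm0 = d0.completion_map_coset_seq[OF n1 n0 sub(1)]
  note cm1 = d1.completion_map_coset_seq[OF n1 n0 sub(2)]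
  show ?thesis
  proof (intro equalityI subsetI)
    fix x assume "x \<in> completion_map F0 (carrier F0) d0 ` kernel (hat F1) (hat F0) (completion_map F0 (carrier F0) d1)"
    then obtain u where u: "coherent F1 (carrier F1) u" "x = completion_map F0 (carrier F0) d0 (coset_seq F1 (carrier F1) u)"
      "completion_map F0 (carrier F0) d1 (coset_seq F1 (carrier F1) u) = \<one>\<^bsub>hat F0\<^esub>"
      by (auto simp: kernel_def d0.G.completion_carrier[OF n1])
    have uc: "u n \<in> carrier F1" for n by (rule d0.G.coherent_carrier[OF n1 u(1)])
    have "coset_seq F0 (carrier F0) (\<lambda>n. d1 (u n)) = coset_seq F0 (carrier F0) (\<lambda>n. \<one>\<^bsub>F0\<^esub>)"
      using u(3) unfolding cm1[OF u(1)] d0.H.completion_one[OF n0] .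
    then have "d1 (u n) \<in> rel_lcs F0 (carrier F0) n" for n
      using uc d0.H.coset_seq_eq_iff[OF n0, of "\<lambda>n. d1 (u n)" "\<lambda>n. \<one>\<^bsub>F0\<^esub>"] by simp
    then obtain v where v: "coherent F1 ?K v" "coset_seq F1 (carrier F1) v = coset_seq F1 (carrier F1) u"
      using d1.kernel_coherent_split[OF s0.homh d1s0 u(1)] by blast
    have "x = coset_seq F0 (carrier F0) (\<lambda>n. d0 (v n))"
      using u(2) cm0[OF d0.G.coherent_mono[OF Kc v(1)]] v(2) by simp
    moreover have "coherent F0 (d0 ` ?K) (\<lambda>n. d0 (v n))" by (rule d0.hom_coherent[OF K dK order_refl v(1)])
    ultimately show "x \<in> coset_seq F0 (carrier F0) ` {u. coherent F0 (d0 ` ?K) u}" by blast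
  next
    fix x assume "x \<in> coset_seq F0 (carrier F0) ` {u. coherent F0 (d0 ` ?K) u}"
    then obtain w where w: "coherent F0 (d0 ` ?K) w" "x = coset_seq F0 (carrier F0) w" by blast
    obtain v where v: "coherent F1 ?K v" "coset_seq F0 (d0 ` ?K) (\<lambda>n. d0 (v n)) = coset_seq F0 (d0 ` ?K) w"
      using d0.ex_coherent_lift[OF K d0surj w(1)] by blast
    have vc: "v n \<in> carrier F1" for n by (rule d0.G.coherent_carrier[OF K v(1)])
    have v1: "d1 (v n) = \<one>\<^bsub>F0\<^esub>" for n
    proof -
      have "v n \<in> ?K" using v(1) unfolding coherent_def by blast
      then show ?thesis unfolding kernel_def by blast
    qed
    have v': "coherent F1 (carrier F1) v" by (rule d0.G.coherent_mono[OF Kc v(1)])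
    have "x = coset_seq F0 (carrier F0) (\<lambda>n. d0 (v n))"
      unfolding w(2) by (rule d0.H.coset_seq_mono[OF dK n0 dKc, symmetric])
        (use v(2) vc d0.H.coherent_carrier[OF dK w(1)] in auto)
    then have "x = completion_map F0 (carrier F0) d0 (coset_seq F1 (carrier F1) v)" using cm0[OF v'] by simp
    moreover have "coset_seq F1 (carrier F1) v \<in> kernel (hat F1) (hat F0) (completion_map F0 (carrier F0) d1)"
      using v' by (auto simp: kernel_def d0.G.completion_carrier[OF n1] cm1[OF v'] v1 d0.H.completion_one[OF n0])
    ultimately show "x \<in> completion_map F0 (carrier F0) d0 ` kernel (hat F1) (hat F0) (completion_map F0 (carrier F0) d1)"
      by blast
  qed
qed

locale loop_nerve = group G for G :: "'a monoid" (structure)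
begin

abbreviation F0 where "F0 \<equiv> loop_level (BG G) 0"
abbreviation F1 where "F1 \<equiv> loop_level (BG G) (Suc 0)"
abbreviation d0 where "d0 \<equiv> gface (loop_group (BG G)) (Suc 0) 0"
abbreviation d1 where "d1 \<equiv> gface (loop_group (BG G)) (Suc 0) (Suc 0)"
abbreviation s0 where "s0 \<equiv> gdegen (loop_group (BG G)) 0 0"
abbreviation aug where "aug \<equiv> augmentation G 0"
abbreviation gen where "gen g \<equiv> loop_gen (BG G) 0 [g]"
abbreviation gen2 where "gen2 g k \<equiv> loop_gen (BG G) (Suc 0) [g, k]"

lemma nerve_simplices: "simplices (BG G) n = {gs. length gs = n \<and> set gs \<subseteq> carrier G}"
  by (auto simp: wbar_def const_sgroup_def in_set_conv_nth subset_iff)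

lemma nerve_simplices_low:
  "simplices (BG G) 0 = {[]}" "simplices (BG G) (Suc 0) = (\<lambda>g. [g]) ` carrier G"
  "simplices (BG G) (Suc (Suc 0)) = {[g, k] |g k. g \<in> carrier G \<and> k \<in> carrier G}"
  by (auto simp: nerve_simplices length_Suc_conv)

lemma nerve_face2:
  "face (BG G) n 0 [g, k] = [k]" "face (BG G) n (Suc 0) [g, k] = [g \<otimes> k]"
  "face (BG G) n (Suc (Suc 0)) [g, k] = [g]"
  by (simp_all add: wbar_def const_sgroup_def)

lemma nerve_degen: "degen (BG G) n 0 gs = \<one> # gs" "degen (BG G) n (Suc 0) [g] = [g, \<one>]"
  by (simp_all add: wbar_def const_sgroup_def)

lemma gen_eq: "g \<in> carrier G \<Longrightarrow> gen g = (if g = \<one> then [] else [(True, [g])])"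
  by (auto simp: loop_gen_def nerve_simplices_low nerve_degen)

lemma gen2_eq: "\<lbrakk>g \<in> carrier G; k \<in> carrier G\<rbrakk> \<Longrightarrow> gen2 g k = (if g = \<one> then [] else [(True, [g, k])])"
  by (auto simp: loop_gen_def nerve_simplices_low nerve_degen)

lemma F0_eq: "F0 = free_group ((\<lambda>g. [g]) ` (carrier G - {\<one>}))"
  unfolding loop_level_def nerve_simplices_low by (rule arg_cong[where f=free_group]) (auto simp: nerve_degen)

lemma F1_eq: "F1 = free_group ((\<lambda>(g, k). [g, k]) ` ((carrier G - {\<one>}) \<times> carrier G))"
  unfolding loop_level_def nerve_simplices_low by (rule arg_cong[where f=free_group]) (force simp: nerve_degen)

lemma F0_group: "group F0" and F1_group: "group F1"
  by (simp_all add: loop_level_def free_group_group)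

lemma Nil_one: "[] = \<one>\<^bsub>F0\<^esub>" "[] = \<one>\<^bsub>F1\<^esub>"
  by (simp_all add: loop_level_def free_group_def)

lemma gen_closed: "g \<in> carrier G \<Longrightarrow> gen g \<in> carrier F0"
  by (auto simp: gen_eq F0_eq free_group_def)

lemma gen2_closed: "\<lbrakk>g \<in> carrier G; k \<in> carrier G\<rbrakk> \<Longrightarrow> gen2 g k \<in> carrier F1"
  by (auto simp: gen2_eq F1_eq free_group_def)

lemma gen_one: "gen \<one> = \<one>\<^bsub>F0\<^esub>"
  using Nil_one by (simp add: gen_eq)

lemma generate_gen: "generate F0 (gen ` carrier G) = carrier F0"
proof
  interpret F0: group F0 by (rule F0_group)
  show "generate F0 (gen ` carrier G) \<subseteq> carrier F0" by (rule F0.generate_incl) (auto simp: gen_closed)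
  have "carrier F0 = generate F0 ((\<lambda>x. [(True, x)]) ` (\<lambda>g. [g]) ` (carrier G - {\<one>}))"
    unfolding F0_eq by (rule generate_free_group[symmetric])
  also have "\<dots> \<subseteq> generate F0 (gen ` carrier G)"
    by (rule F0.mono_generate) (auto simp: gen_eq image_iff intro!: bexI)
  finally show "carrier F0 \<subseteq> generate F0 (gen ` carrier G)" .
qed

lemma generate_gen2: "generate F1 ((\<lambda>(g, k). gen2 g k) ` (carrier G \<times> carrier G)) = carrier F1"
proof
  interpret F1: group F1 by (rule F1_group)
  show "generate F1 ((\<lambda>(g, k). gen2 g k) ` (carrier G \<times> carrier G)) \<subseteq> carrier F1"
    by (rule F1.generate_incl) (auto simp: gen2_closed)
  have "carrier F1 = generate F1 ((\<lambda>x. [(True, x)]) ` (\<lambda>(g, k). [g, k]) ` ((carrier G - {\<one>}) \<times> carrier G))"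
    unfolding F1_eq by (rule generate_free_group[symmetric])
  also have "\<dots> \<subseteq> generate F1 ((\<lambda>(g, k). gen2 g k) ` (carrier G \<times> carrier G))"
  proof (rule F1.mono_generate, rule subsetI)
    fix y assume "y \<in> (\<lambda>x. [(True, x)]) ` (\<lambda>(g, k). [g, k]) ` ((carrier G - {\<one>}) \<times> carrier G)"
    then obtain g k where gk: "g \<in> carrier G" "g \<noteq> \<one>" "k \<in> carrier G" "y = [(True, [g, k])]" by auto
    then have "y = (case (g, k) of (g, k) \<Rightarrow> gen2 g k)" by (simp add: gen2_eq)
    then show "y \<in> (\<lambda>(g, k). gen2 g k) ` (carrier G \<times> carrier G)"
      by (rule image_eqI) (use gk in simp)
  qed
  finally show "carrier F1 \<subseteq> generate F1 ((\<lambda>(g, k). gen2 g k) ` (carrier G \<times> carrier G))" .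
qed

lemma self_free_F0: "self_free F0 ((\<lambda>g. [(True, [g])]) ` (carrier G - {\<one>}))"
  unfolding F0_eq using self_free_free_group[of "(\<lambda>g. [g]) ` (carrier G - {\<one>})"] by (simp add: image_image)

lemma free_lift_F0:
  assumes "group H" "\<And>g. g \<in> carrier G \<Longrightarrow> f [g] \<in> carrier H" "f [\<one>] = \<one>\<^bsub>H\<^esub>"
  shows "free_lift H f \<in> hom F0 H" "\<And>g. g \<in> carrier G \<Longrightarrow> free_lift H f (gen g) = f [g]"
proof -
  show "free_lift H f \<in> hom F0 H" unfolding F0_eq by (rule free_lift_hom[OF assms(1)]) (use assms(2) in auto)
  show "free_lift H f (gen g) = f [g]" if "g \<in> carrier G" for g
    using that assms by (auto simp: gen_eq free_lift_gen)
qed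

lemma free_lift_F1:
  assumes "group H" "\<And>g k. \<lbrakk>g \<in> carrier G; k \<in> carrier G\<rbrakk> \<Longrightarrow> f [g, k] \<in> carrier H"
    "\<And>k. k \<in> carrier G \<Longrightarrow> f [\<one>, k] = \<one>\<^bsub>H\<^esub>"
  shows "free_lift H f \<in> hom F1 H"
    "\<And>g k. \<lbrakk>g \<in> carrier G; k \<in> carrier G\<rbrakk> \<Longrightarrow> free_lift H f (gen2 g k) = f [g, k]"
proof -
  show "free_lift H f \<in> hom F1 H" unfolding F1_eq by (rule free_lift_hom[OF assms(1)]) (use assms(2) in auto)
  show "free_lift H f (gen2 g k) = f [g, k]" if "g \<in> carrier G" "k \<in> carrier G" for g k
    using that assms by (auto simp: gen2_eq free_lift_gen)
qed

lemma aug_hom: "group_hom F0 G aug" and aug_gen: "g \<in> carrier G \<Longrightarrow> aug (gen g) = g"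
  using free_lift_F0[of G hd] F0_group
  by (simp_all add: augmentation_def group_hom_def group_hom_axioms_def)

lemma d0_hom: "group_hom F1 F0 d0"
  and d0_gen2: "\<lbrakk>g \<in> carrier G; k \<in> carrier G\<rbrakk> \<Longrightarrow> d0 (gen2 g k) = gen (g \<otimes> k) \<otimes>\<^bsub>F0\<^esub> inv\<^bsub>F0\<^esub> gen k"
proof -
  interpret F0: group F0 by (rule F0_group)
  have f: "loop_face_gen (BG G) (Suc 0) 0 [g, k] = gen (g \<otimes> k) \<otimes>\<^bsub>F0\<^esub> inv\<^bsub>F0\<^esub> gen k" for g k
    by (simp add: loop_face_gen_def nerve_face2)
  note L = free_lift_F1[OF F0_group, of "loop_face_gen (BG G) (Suc 0) 0"]
  show "group_hom F1 F0 d0"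
    using L(1) F0_group F1_group by (simp add: f gen_closed loop_group_def group_hom_def group_hom_axioms_def)
  show "d0 (gen2 g k) = gen (g \<otimes> k) \<otimes>\<^bsub>F0\<^esub> inv\<^bsub>F0\<^esub> gen k" if "g \<in> carrier G" "k \<in> carrier G"
    using L(2) that by (simp add: f gen_closed loop_group_def)
qed

lemma d1_hom: "group_hom F1 F0 d1"
  and d1_gen2: "\<lbrakk>g \<in> carrier G; k \<in> carrier G\<rbrakk> \<Longrightarrow> d1 (gen2 g k) = gen g"
proof -
  have f: "loop_face_gen (BG G) (Suc 0) (Suc 0) [g, k] = gen g" for g k
    by (simp add: loop_face_gen_def nerve_face2)
  note L = free_lift_F1[OF F0_group, of "loop_face_gen (BG G) (Suc 0) (Suc 0)"]
  show "group_hom F1 F0 d1"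
    using L(1) F0_group F1_group by (simp add: f gen_closed gen_one loop_group_def group_hom_def group_hom_axioms_def)
  show "d1 (gen2 g k) = gen g" if "g \<in> carrier G" "k \<in> carrier G"
    using L(2) that by (simp add: f gen_closed gen_one loop_group_def)
qed

lemma s0_hom: "group_hom F0 F1 s0" and s0_gen: "g \<in> carrier G \<Longrightarrow> s0 (gen g) = gen2 g \<one>"
proof -
  have f: "degen (BG G) (Suc 0) (Suc 0) [g] = [g, \<one>]" for g by (simp add: nerve_degen)
  have g1: "gen2 \<one> \<one> = \<one>\<^bsub>F1\<^esub>" using Nil_one by (simp add: gen2_eq)
  note L = free_lift_F0[OF F1_group, of "\<lambda>x. loop_gen (BG G) (Suc 0) (degen (BG G) (Suc 0) (Suc 0) x)"]
  show "group_hom F0 F1 s0"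
    using L(1) F0_group F1_group by (simp add: f gen2_closed g1 loop_group_def group_hom_def group_hom_axioms_def)
  show "s0 (gen g) = gen2 g \<one>" if "g \<in> carrier G"
    using L(2) that by (simp add: f gen2_closed g1 loop_group_def)
qed

sublocale F0: group F0 by (rule F0_group)
sublocale F1: group F1 by (rule F1_group)
sublocale aug: group_hom F0 G aug by (rule aug_hom)
sublocale d0: group_hom F1 F0 d0 by (rule d0_hom)
sublocale d1: group_hom F1 F0 d1 by (rule d1_hom)
sublocale s0: group_hom F0 F1 s0 by (rule s0_hom)

lemma F0_hom_eqI:
  assumes "group_hom F0 H a" "group_hom F0 H b" "\<And>g. g \<in> carrier G \<Longrightarrow> a (gen g) = b (gen g)" "x \<in> carrier F0"
  shows "a x = b x"
proof (rule F0.hom_eq_on_generate[of H a b "gen ` carrier G"])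
  show "group H" "a \<in> hom F0 H" "b \<in> hom F0 H" using assms(1,2) by (auto simp: group_hom_def group_hom_axioms_def)
qed (use assms generate_gen gen_closed in auto)

lemma group_hom_comp: "\<lbrakk>group_hom A A' f; group_hom A' A'' f'\<rbrakk> \<Longrightarrow> group_hom A A'' (\<lambda>x. f' (f x))"
  using Group.hom_compose[of f A A' f' A''] by (simp add: group_hom_def group_hom_axioms_def comp_def)

lemma group_hom_id: "group A \<Longrightarrow> group_hom A A (\<lambda>x. x)"
  by (simp add: group_hom_def group_hom_axioms_def hom_def)

lemma d0_s0: "x \<in> carrier F0 \<Longrightarrow> d0 (s0 x) = x"
  by (rule F0_hom_eqI[OF group_hom_comp[OF s0_hom d0_hom] group_hom_id[OF F0_group]])
    (simp_all add: s0_gen d0_gen2 gen_one gen_closed)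

lemma d1_s0: "x \<in> carrier F0 \<Longrightarrow> d1 (s0 x) = x"
  by (rule F0_hom_eqI[OF group_hom_comp[OF s0_hom d1_hom] group_hom_id[OF F0_group]])
    (simp_all add: s0_gen d1_gen2)

lemma aug_surj: "aug ` carrier F0 = carrier G"
proof -
  have "x \<in> aug ` carrier F0" if "x \<in> carrier G" for x using aug_gen[OF that] gen_closed[OF that] by (metis imageI)
  then show ?thesis using aug.hom_closed by blast
qed

abbreviation R where "R \<equiv> kernel F0 G aug"

text \<open>Modulo N the map g -> \<open>gen g\<close> is a homomorphism on G, so every word w is
  congruent to \<open>gen (aug w)\<close>, which is trivial for w in R. In other words, the
  multiplication relations generate R as a normal subgroup.\<close>

lemma kernel_aug_subset:
  assumes N: "N \<lhd> F0" and rel: "\<And>g k. \<lbrakk>g \<in> carrier G; k \<in> carrier G\<rbrakk> \<Longrightarrow> gen g \<otimes>\<^bsub>F0\<^esub> gen k \<otimes>\<^bsub>F0\<^esub> inv\<^bsub>F0\<^esub> gen (g \<otimes> k) \<in> N"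
  shows "R \<subseteq> N"
proof -
  interpret N: normal N F0 by fact
  let ?Q = "F0 Mod N" and ?q = "\<lambda>x. N #>\<^bsub>F0\<^esub> x"
  interpret q: group_hom F0 ?Q ?q by (rule N.group_hom_Mod)
  have qgen: "?q (gen (g \<otimes> k)) = ?q (gen g) \<otimes>\<^bsub>?Q\<^esub> ?q (gen k)" if "g \<in> carrier G" "k \<in> carrier G" for g k
  proof -
    have "?q (gen g \<otimes>\<^bsub>F0\<^esub> gen k) = ?q (gen (g \<otimes> k))"
      using rel[OF that] that gen_closed N.Mod_eq_iff[of "gen g \<otimes>\<^bsub>F0\<^esub> gen k" "gen (g \<otimes> k)"] by (simp del: q.hom_mult)
    then show ?thesis using q.hom_mult[OF gen_closed gen_closed, OF that] by (simp only:)
  qed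
  have "(\<lambda>g. ?q (gen g)) \<in> hom G ?Q"
    using qgen gen_closed q.hom_closed by (intro homI) blast+
  then have "group_hom G ?Q (\<lambda>g. ?q (gen g))"
    using N.factorgroup_is_group group_axioms by (simp add: group_hom_def group_hom_axioms_def)
  then have "?q w = ?q (gen (aug w))" if "w \<in> carrier F0" for w
    by (intro F0_hom_eqI[OF q.group_hom_axioms group_hom_comp[OF aug_hom] _ that]) (simp_all add: aug_gen)
  then have "?q w = ?q \<one>\<^bsub>F0\<^esub>" if "w \<in> R" for w using that gen_one by (auto simp: kernel_def)
  then show ?thesis
    using N.Mod_eq_one_iff q.hom_one by (auto simp: kernel_def)
qed

text \<open>The augmentation equalizes d0 and d1, which gives one inclusion. Conversely,
  s0(\<open>gen g\<close>) divided by \<open>gen2 g k\<close> lies in the kernel of d1, and d0 maps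
  it to the multiplication relation of g and k, so \<open>kernel_aug_subset\<close> applies.\<close>

lemma d0_kernel: "d0 ` kernel F1 F0 d1 = R"
proof
  interpret K: normal "kernel F1 F0 d1" F1 by (rule d1.normal_kernel)
  have eq: "aug (d0 x) = aug (d1 x)" if x: "x \<in> carrier F1" for x
  proof (rule F1.hom_eq_on_generate[of G "\<lambda>x. aug (d0 x)" "\<lambda>x. aug (d1 x)"])
    show "(\<lambda>x. aug (d0 x)) \<in> hom F1 G" "(\<lambda>x. aug (d1 x)) \<in> hom F1 G"
      using group_hom_comp[OF d0_hom aug_hom] group_hom_comp[OF d1_hom aug_hom]
      by (simp_all add: group_hom_def group_hom_axioms_def)
    show "x \<in> generate F1 ((\<lambda>(g, k). gen2 g k) ` (carrier G \<times> carrier G))" using x generate_gen2 by simp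
  qed (auto simp: d0_gen2 d1_gen2 gen_closed gen2_closed aug_gen m_assoc)
  show "d0 ` kernel F1 F0 d1 \<subseteq> R"
  proof (rule image_subsetI)
    fix x assume "x \<in> kernel F1 F0 d1"
    then have x: "x \<in> carrier F1" "d1 x = \<one>\<^bsub>F0\<^esub>" unfolding kernel_def by blast+
    have "aug (d0 x) = \<one>" unfolding eq[OF x(1)] x(2) by (rule aug.hom_one)
    then show "d0 x \<in> R" using d0.hom_closed[OF x(1)] unfolding kernel_def by blast
  qed
  have "d0 ` carrier F1 = carrier F0"
  proof -
    have "x \<in> d0 ` carrier F1" if "x \<in> carrier F0" for x
      using d0_s0[OF that] s0.hom_closed[OF that] by (metis imageI)
    then show ?thesis using d0.hom_closed by blast
  qed
  then have "d0 ` kernel F1 F0 d1 \<lhd> F0" by (rule K.surj_hom_normal_subgroup[OF d0_hom])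
  then show "R \<subseteq> d0 ` kernel F1 F0 d1"
  proof (rule kernel_aug_subset)
    fix g k assume gk: "g \<in> carrier G" "k \<in> carrier G"
    let ?x = "s0 (gen g) \<otimes>\<^bsub>F1\<^esub> inv\<^bsub>F1\<^esub> gen2 g k"
    have "?x \<in> carrier F1" "d1 ?x = \<one>\<^bsub>F0\<^esub>" using gk by (simp_all add: gen2_closed gen_closed d1_s0 d1_gen2)
    then have "?x \<in> kernel F1 F0 d1" unfolding kernel_def by blast
    moreover have "d0 ?x = gen g \<otimes>\<^bsub>F0\<^esub> gen k \<otimes>\<^bsub>F0\<^esub> inv\<^bsub>F0\<^esub> gen (g \<otimes> k)"
      using gk by (simp add: gen2_closed gen_closed d0_s0 d0_gen2 F0.word_simps)
    ultimately show "gen g \<otimes>\<^bsub>F0\<^esub> gen k \<otimes>\<^bsub>F0\<^esub> inv\<^bsub>F0\<^esub> gen (g \<otimes> k) \<in> d0 ` kernel F1 F0 d1" by (metis imageI)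
  qed
qed

abbreviation hatK where "hatK \<equiv> completion_sgroup (loop_group (BG G))"
abbreviation hd0 where "hd0 \<equiv> completion_map F0 (carrier F0) d0"
abbreviation hd1 where "hd1 \<equiv> completion_map F0 (carrier F0) d1"
abbreviation hs0 where "hs0 \<equiv> completion_map F1 (carrier F1) s0"

sublocale hat: simplicial_group_low hatK "hat F0" "hat F1" hd0 hd1 hs0
proof -
  note n = F0.normal_self F1.normal_self
  have i: "d0 ` carrier F1 \<subseteq> carrier F0" "d1 ` carrier F1 \<subseteq> carrier F0" "s0 ` carrier F0 \<subseteq> carrier F1" by auto
  interpret hd0: group_hom "hat F1" "hat F0" hd0 by (rule d0.completion_map_hom[OF n(2,1) i(1)])
  interpret hd1: group_hom "hat F1" "hat F0" hd1 by (rule d1.completion_map_hom[OF n(2,1) i(2)])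
  interpret hs0: group_hom "hat F0" "hat F1" hs0 by (rule s0.completion_map_hom[OF n i(3)])
  show "simplicial_group_low hatK (hat F0) (hat F1) hd0 hd1 hs0"
  proof
    show "hat F0 = level hatK 0" "hat F1 = level hatK (Suc 0)" "hd0 = gface hatK (Suc 0) 0" "hd1 = gface hatK (Suc 0) (Suc 0)"
      by (simp_all add: completion_sgroup_def loop_group_def)
    fix x assume "x \<in> carrier (hat F0)"
    then obtain u where u: "coherent F0 (carrier F0) u" "x = coset_seq F0 (carrier F0) u"
      by (auto simp: F0.completion_carrier[OF n(1)])
    have uc: "u n \<in> carrier F0" for n by (rule F0.coherent_carrier[OF n(1) u(1)])
    have su: "coherent F1 (carrier F1) (\<lambda>n. s0 (u n))" by (rule s0.hom_coherent[OF n i(3) u(1)])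
    show "hd0 (hs0 x) = x" "hd1 (hs0 x) = x"
      using uc by (simp_all add: u(2) s0.completion_map_coset_seq[OF n i(3) u(1)] d0_s0 d1_s0
          d0.completion_map_coset_seq[OF n(2,1) i(1) su] d1.completion_map_coset_seq[OF n(2,1) i(2) su])
  qed
qed

text \<open>Identifies the boundaries with the image of the relative completion of R in the
  completion of \<open>F0\<close>.\<close>

lemma hat_B: "hat.B = coset_seq F0 (carrier F0) ` {u. coherent F0 R u}"
  unfolding hat.B_def
  using completed_boundary[OF d0_hom d1_hom s0_hom d0_s0 d1_s0] by (simp add: d0_kernel)

lemma Z_inf_eq: "Z_inf G = pi1 (wbar hatK) []"
  by (simp add: Z_inf_def Z_completion_def)

end

section \<open>Low-dimensional homology\<close>

lemma free_Abelian_hom_eqI: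
  assumes "group H" "f \<in> hom (free_Abelian_group S) H" "h \<in> hom (free_Abelian_group S) H"
    "\<And>x. x \<in> S \<Longrightarrow> f (frag_of x) = h (frag_of x)" "Poly_Mapping.keys c \<subseteq> S"
  shows "f c = h c"
proof -
  interpret f: group_hom "free_Abelian_group S" H f using assms by (simp add: group_hom_def group_hom_axioms_def)
  interpret h: group_hom "free_Abelian_group S" H h using assms by (simp add: group_hom_def group_hom_axioms_def)
  have diff: "k (x - y) = k x \<otimes>\<^bsub>H\<^esub> inv\<^bsub>H\<^esub> k y"
    if k: "group_hom (free_Abelian_group S) H k" and xy: "Poly_Mapping.keys x \<subseteq> S" "Poly_Mapping.keys y \<subseteq> S" for k x y
  proof -
    interpret k: group_hom "free_Abelian_group S" H k by (rule k)
    show ?thesis using k.hom_mult[of x "- y"] k.hom_inv[of y] xy by simp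
  qed
  show ?thesis
  proof (rule free_Abelian_group_induct[OF assms(5), where P="\<lambda>c. f c = h c"])
    show "f 0 = h 0" using f.hom_one h.hom_one by simp
    fix x y assume "Poly_Mapping.keys x \<subseteq> S" "Poly_Mapping.keys y \<subseteq> S" "f x = h x" "f y = h y"
    then show "f (x - y) = h (x - y)" using diff[OF f.group_hom_axioms] diff[OF h.group_hom_axioms] by simp
  qed (use assms(4) in blast)
qed

lemma simplicial_boundary_add:
  "simplicial_boundary X n (c + d) = simplicial_boundary X n c + simplicial_boundary X n d"
  by (simp add: simplicial_boundary_def frag_extend_add)

lemma simplicial_boundary_diff:
  "simplicial_boundary X n (c - d) = simplicial_boundary X n c - simplicial_boundary X n d"
  by (simp add: simplicial_boundary_def frag_extend_diff)

lemma simplicial_boundary_hom: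
  assumes "\<And>x i. \<lbrakk>x \<in> simplices X (Suc n); i \<le> Suc n\<rbrakk> \<Longrightarrow> face X (Suc n) i x \<in> simplices X n"
  shows "simplicial_boundary X (Suc n) \<in> hom (free_Abelian_group (simplices X (Suc n))) (free_Abelian_group (simplices X n))"
proof (rule homI)
  fix c assume "c \<in> carrier (free_Abelian_group (simplices X (Suc n)))"
  moreover have "Poly_Mapping.keys (\<Sum>i\<le>Suc n. frag_cmul ((-1) ^ i) (frag_of (face X (Suc n) i x))) \<subseteq> simplices X n"
    if "x \<in> simplices X (Suc n)" for x
  proof -
    have "Poly_Mapping.keys (\<Sum>i\<le>Suc n. frag_cmul ((-1) ^ i) (frag_of (face X (Suc n) i x)))
        \<subseteq> (\<Union>i\<in>{..Suc n}. Poly_Mapping.keys (frag_cmul ((-1) ^ i) (frag_of (face X (Suc n) i x))))"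
      by (rule keys_sum)
    also have "\<dots> \<subseteq> simplices X n" using assms[OF that] by (auto simp: subset_iff dest!: keys_cmul[THEN subsetD])
    finally show ?thesis .
  qed
  ultimately show "simplicial_boundary X (Suc n) c \<in> carrier (free_Abelian_group (simplices X n))"
    using keys_frag_extend[of "\<lambda>x. \<Sum>i\<le>Suc n. frag_cmul ((-1) ^ i) (frag_of (face X (Suc n) i x))" c]
    by (fastforce simp: simplicial_boundary_def)
qed (simp add: simplicial_boundary_add)

context loop_nerve
begin

lemma nerve_face3:
  "face (BG G) n 0 [a, b, c] = [b, c]" "face (BG G) n (Suc 0) [a, b, c] = [a \<otimes> b, c]"
  "face (BG G) n (Suc (Suc 0)) [a, b, c] = [a, b \<otimes> c]" "face (BG G) n (Suc (Suc (Suc 0))) [a, b, c] = [a, b]"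
  by (simp_all add: wbar_def const_sgroup_def)

lemma nerve_boundary1: "simplicial_boundary (BG G) (Suc 0) c = 0" if "Poly_Mapping.keys c \<subseteq> simplices (BG G) (Suc 0)"
proof -
  have "face (BG G) (Suc 0) i [g] = []" if "i \<le> 1" for i g
    using that by (cases i) (auto simp: wbar_def)
  then show ?thesis
    using that unfolding simplicial_boundary_def nerve_simplices_low
    by (auto intro!: frag_extend_eq_0)
qed

lemma nerve_boundary2:
  "simplicial_boundary (BG G) (Suc (Suc 0)) (frag_of [g, k]) = frag_of [k] - frag_of [g \<otimes> k] + frag_of [g]"
  by (simp add: simplicial_boundary_def nerve_face2)

lemma nerve_boundary3:
  "simplicial_boundary (BG G) (Suc (Suc (Suc 0))) (frag_of [a, b, c])
    = frag_of [b, c] - frag_of [a \<otimes> b, c] + frag_of [a, b \<otimes> c] - frag_of [a, b]"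
  by (simp add: simplicial_boundary_def nerve_face3)

lemma nerve_simplices3: "simplices (BG G) (Suc (Suc (Suc 0))) =
    {[a, b, c] |a b c. a \<in> carrier G \<and> b \<in> carrier G \<and> c \<in> carrier G}"
  by (auto simp: nerve_simplices length_Suc_conv)

lemma boundary2_hom: "simplicial_boundary (BG G) (Suc (Suc 0))
    \<in> hom (free_Abelian_group (simplices (BG G) (Suc (Suc 0)))) (free_Abelian_group (simplices (BG G) (Suc 0)))"
  by (rule simplicial_boundary_hom) (auto simp: nerve_simplices_low nerve_face2 le_Suc_eq)

lemma boundary3_hom: "simplicial_boundary (BG G) (Suc (Suc (Suc 0)))
    \<in> hom (free_Abelian_group (simplices (BG G) (Suc (Suc (Suc 0))))) (free_Abelian_group (simplices (BG G) (Suc (Suc 0))))"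
  by (rule simplicial_boundary_hom) (auto simp: nerve_simplices3 nerve_simplices_low nerve_face3 le_Suc_eq)

text \<open>The 1-simplices give a surjection from H_1 onto the abelianization of G, and Y consists
  of elements of G representing the images of generators of H_1. It generates G only modulo
  commutators.\<close>

lemma H1_finitely_generated:
  assumes "finitely_generated_group (group_homology 1 G)"
  shows "\<exists>Y. finite Y \<and> Y \<subseteq> carrier G \<and>
    (\<forall>x\<in>carrier G. \<exists>y\<in>generate G Y. inv y \<otimes> x \<in> rel_lcs G (carrier G) (Suc 0))"
proof -
  let ?C1 = "free_Abelian_group (simplices (BG G) (Suc 0))" and ?C2 = "free_Abelian_group (simplices (BG G) (Suc (Suc 0)))"
  let ?N = "simplicial_boundaries (BG G) (Suc 0)"
  interpret C1: comm_group ?C1 by (rule abelian_free_Abelian_group)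
  interpret bd: group_hom ?C2 ?C1 "simplicial_boundary (BG G) (Suc (Suc 0))"
    using boundary2_hom by (simp add: group_hom_def group_hom_axioms_def)
  have N: "?N \<lhd> ?C1" unfolding simplicial_boundaries_def by (rule C1.subgroup_imp_normal[OF bd.img_is_subgroup])
  interpret N: normal ?N ?C1 by (rule N)
  have "simplicial_cycles (BG G) (Suc 0) = carrier ?C1"
    using nerve_boundary1 by (auto simp: simplicial_cycles_def)
  then have H1: "group_homology 1 G = ?C1 Mod ?N"
    by (simp add: group_homology_def simplicial_homology_def)
  let ?G1 = "rel_lcs G (carrier G) (Suc 0)"
  interpret G1: normal ?G1 G by (rule rel_lcs_normal[OF normal_self])
  let ?A = "G Mod ?G1" and ?q = "\<lambda>x. ?G1 #> x"
  interpret A: comm_group ?A by (rule Mod_lcs_comm_group)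
  interpret q: group_hom G ?A ?q by (rule G1.group_hom_Mod)
  have "(\<lambda>x. ?q (hd x)) ` simplices (BG G) (Suc 0) \<subseteq> carrier ?A"
    using q.hom_closed by (auto simp: nerve_simplices_low simp del: carrier_FactGroup)
  then obtain f where f: "f \<in> hom ?C1 ?A" "\<And>x. x \<in> simplices (BG G) (Suc 0) \<Longrightarrow> f (frag_of x) = ?q (hd x)"
    using A.free_Abelian_group_universal by metis
  interpret f: group_hom ?C1 ?A f using f(1) by (simp add: group_hom_def group_hom_axioms_def)
  have fgen: "f (frag_of [g]) = ?q g" if "g \<in> carrier G" for g
    using f(2)[of "[g]"] that by (simp add: nerve_simplices_low)
  have fbd: "f (simplicial_boundary (BG G) (Suc (Suc 0)) c) = \<one>\<^bsub>?A\<^esub>" if "c \<in> carrier ?C2" for c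
  proof (rule free_Abelian_hom_eqI[of ?A "\<lambda>c. f (simplicial_boundary (BG G) (Suc (Suc 0)) c)" "simplices (BG G) (Suc (Suc 0))" "\<lambda>c. \<one>\<^bsub>?A\<^esub>"])
    show "(\<lambda>c. f (simplicial_boundary (BG G) (Suc (Suc 0)) c)) \<in> hom ?C2 ?A"
      using Group.hom_compose[OF boundary2_hom f(1)] by (simp add: comp_def)
    show "(\<lambda>c. \<one>\<^bsub>?A\<^esub>) \<in> hom ?C2 ?A" by (rule homI) (simp_all del: one_FactGroup mult_FactGroup)
    fix x assume "x \<in> simplices (BG G) (Suc (Suc 0))"
    then obtain g k where gk: "x = [g, k]" "g \<in> carrier G" "k \<in> carrier G" by (auto simp: nerve_simplices_low)
    have mem: "frag_of [g] \<in> carrier ?C1" if "g \<in> carrier G" for g using that by (simp add: nerve_simplices_low)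
    have "frag_of [k] - frag_of [g \<otimes> k] + frag_of [g]
        = frag_of [k] \<otimes>\<^bsub>?C1\<^esub> inv\<^bsub>?C1\<^esub> frag_of [g \<otimes> k] \<otimes>\<^bsub>?C1\<^esub> frag_of [g]"
      using gk by (simp add: nerve_simplices_low)
    then have "f (frag_of [k] - frag_of [g \<otimes> k] + frag_of [g]) = ?q k \<otimes>\<^bsub>?A\<^esub> inv\<^bsub>?A\<^esub> ?q (g \<otimes> k) \<otimes>\<^bsub>?A\<^esub> ?q g"
      using gk mem f.hom_mult f.hom_inv C1.m_closed C1.inv_closed fgen m_closed by metis
    also have "\<dots> = ?q (k \<otimes> inv (g \<otimes> k) \<otimes> g)"
      using gk by (simp del: mult_FactGroup)
    also have "\<dots> = \<one>\<^bsub>?A\<^esub>" using gk by (simp add: word_simps G1.subset coset_mult_one)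
    finally show "f (simplicial_boundary (BG G) (Suc (Suc 0)) (frag_of x)) = \<one>\<^bsub>?A\<^esub>"
      unfolding gk(1) nerve_boundary2 .
  qed (use that A.group_axioms in auto)
  obtain h where h: "h \<in> hom (?C1 Mod ?N) ?A" "\<And>c. c \<in> carrier ?C1 \<Longrightarrow> h (?N #>\<^bsub>?C1\<^esub> c) = f c"
  proof (rule f.FactGroup_universal_kernel[OF N])
    have "x \<in> kernel ?C1 ?A f" if "x \<in> ?N" for x
      using that fbd N.subset unfolding simplicial_boundaries_def kernel_def by blast
    then show "?N \<subseteq> kernel ?C1 ?A f" by blast
  qed blast
  interpret h: group_hom "?C1 Mod ?N" ?A h
    using h(1) N.factorgroup_is_group by (simp add: group_hom_def group_hom_axioms_def)
  obtain S where S: "finite S" "S \<subseteq> carrier (?C1 Mod ?N)" "generate (?C1 Mod ?N) S = carrier (?C1 Mod ?N)"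
    using assms unfolding H1 finitely_generated_group_def by blast
  have "h ` S \<subseteq> carrier ?A" using S(2) h.hom_closed by blast
  then have "h ` S \<subseteq> ?q ` carrier G" by (simp only: carrier_FactGroup)
  then obtain Y where Y: "Y \<subseteq> carrier G" "finite Y" "h ` S = ?q ` Y"
    using finite_subset_image[of "h ` S" ?q "carrier G"] S(1) by blast
  have "\<exists>y\<in>generate G Y. inv y \<otimes> x \<in> ?G1" if x: "x \<in> carrier G" for x
  proof -
    have fx: "frag_of [x] \<in> carrier ?C1" using x by (simp add: nerve_simplices_low)
    have "?q x = h (?N #>\<^bsub>?C1\<^esub> frag_of [x])" using h(2)[OF fx] fgen[OF x] by simp
    moreover have "?N #>\<^bsub>?C1\<^esub> frag_of [x] \<in> generate (?C1 Mod ?N) S" unfolding S(3) carrier_FactGroup using fx by blast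
    ultimately have "?q x \<in> generate ?A (h ` S)" using h.generate_img[OF S(2)] by blast
    then obtain y where y: "y \<in> generate G Y" "?q y = ?q x" using q.generate_img[OF Y(1)] Y(3) by (metis imageE)
    then show ?thesis using G1.Mod_eq_iff_left[of y x] x generate_in_carrier[OF Y(1)] by blast
  qed
  then show ?thesis using Y by blast
qed

text \<open>The half of Hopf's formula that is needed for finiteness. f sends a 2-simplex [g, k] to
  the class of its multiplication relation in R/[R, F] and kills boundaries, so its values on cycles
  depend only on the class in H_2. Each w in R has a chain c such that f(c) is the class of w and
  the boundary of c is \<open>ab w\<close>; for w in [F, F] this c is a cycle.\<close>

lemma H2_finite:
  assumes "finite (carrier (group_homology 2 G))"
  shows "finite ((\<lambda>t. rel_lcs F0 R (Suc 0) #>\<^bsub>F0\<^esub> t) ` (R \<inter> rel_lcs F0 (carrier F0) (Suc 0)))"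
proof -
  let ?C1 = "free_Abelian_group (simplices (BG G) (Suc 0))" and ?C2 = "free_Abelian_group (simplices (BG G) (Suc (Suc 0)))"
    and ?C3 = "free_Abelian_group (simplices (BG G) (Suc (Suc (Suc 0))))"
  let ?bd = "simplicial_boundary (BG G) (Suc (Suc 0))" and ?bd3 = "simplicial_boundary (BG G) (Suc (Suc (Suc 0)))"
  let ?M = "rel_lcs F0 R (Suc 0)"
  have Rn: "R \<lhd> F0" by (rule aug.normal_kernel)
  interpret R: normal R F0 by (rule Rn)
  interpret M: normal ?M F0 by (rule F0.rel_lcs_normal[OF Rn])
  let ?Q = "F0 Mod ?M" and ?q = "\<lambda>x. ?M #>\<^bsub>F0\<^esub> x"
  interpret q: group_hom F0 ?Q ?q by (rule M.group_hom_Mod)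
  interpret C1: comm_group ?C1 by (rule abelian_free_Abelian_group)
  have cen: "?q r \<otimes>\<^bsub>?Q\<^esub> x = x \<otimes>\<^bsub>?Q\<^esub> ?q r" if "r \<in> R" "x \<in> carrier ?Q" for r x
    using F0.Mod_rel_lcs_central[OF Rn, of r 0 x] that by simp
  \<comment> \<open>R/[R, F] as a group of its own: it is central in the quotient and hence abelian,
    as the universal property of the chain groups requires of a target.\<close>
  define Z where "Z = ?Q\<lparr>carrier := ?q ` R\<rparr>"
  have qR: "subgroup (?q ` R) ?Q" by (rule q.subgroup_img_is_subgroup[OF R.subgroup_axioms])
  interpret Z: comm_group Z
  proof (rule group.group_comm_groupI)
    show "group Z" unfolding Z_def by (rule q.H.subgroup_imp_group[OF qR])
    fix x y assume "x \<in> carrier Z" "y \<in> carrier Z"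
    then obtain r where "r \<in> R" "x = ?q r" "y \<in> carrier ?Q" using subgroup.subset[OF qR] by (auto simp: Z_def)
    then show "x \<otimes>\<^bsub>Z\<^esub> y = y \<otimes>\<^bsub>Z\<^esub> x" using cen by (simp add: Z_def del: mult_FactGroup)
  qed
  have Zs: "carrier Z = ?q ` R" "\<one>\<^bsub>Z\<^esub> = \<one>\<^bsub>?Q\<^esub>" "\<And>x y. x \<otimes>\<^bsub>Z\<^esub> y = x \<otimes>\<^bsub>?Q\<^esub> y" by (simp_all add: Z_def)
  define rel where "rel g k = gen g \<otimes>\<^bsub>F0\<^esub> gen k \<otimes>\<^bsub>F0\<^esub> inv\<^bsub>F0\<^esub> gen (g \<otimes> k)" for g k
  have relR: "rel g k \<in> R" if "g \<in> carrier G" "k \<in> carrier G" for g k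
  proof -
    have "rel g k \<in> carrier F0" "aug (rel g k) = \<one>" using that by (simp_all add: rel_def gen_closed aug_gen)
    then show ?thesis unfolding kernel_def by blast
  qed
  have relc: "rel g k \<in> carrier F0" if "g \<in> carrier G" "k \<in> carrier G" for g k using relR[OF that] R.subset by blast
  have im: "(\<lambda>x. ?q (rel (hd x) (hd (tl x)))) ` simplices (BG G) (Suc (Suc 0)) \<subseteq> carrier Z"
    using relR by (auto simp: nerve_simplices_low Zs)
  obtain f where f: "f \<in> hom ?C2 Z" "\<And>x. x \<in> simplices (BG G) (Suc (Suc 0)) \<Longrightarrow> f (frag_of x) = ?q (rel (hd x) (hd (tl x)))"
    using Z.free_Abelian_group_universal[OF im] by blast
  interpret f: group_hom ?C2 Z f using f(1) by (simp add: group_hom_def group_hom_axioms_def)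
  have fgen: "f (frag_of [g, k]) = ?q (rel g k)" if "g \<in> carrier G" "k \<in> carrier G" for g k
    using f(2)[of "[g, k]"] that by (simp add: nerve_simplices_low)
  have mem2: "frag_of [g, k] \<in> carrier ?C2" if "g \<in> carrier G" "k \<in> carrier G" for g k
    using that by (simp add: nerve_simplices_low)
  have fadd: "f (c + d) = f c \<otimes>\<^bsub>Z\<^esub> f d" if "c \<in> carrier ?C2" "d \<in> carrier ?C2" for c d
    using f.hom_mult[OF that] by simp
  have fdiff: "f (c - d) = f c \<otimes>\<^bsub>Z\<^esub> inv\<^bsub>Z\<^esub> f d" if "c \<in> carrier ?C2" "d \<in> carrier ?C2" for c d
    using f.hom_mult[of c "inv\<^bsub>?C2\<^esub> d"] f.hom_inv[OF that(2)] that by simp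
  have fbd: "f (?bd3 c) = \<one>\<^bsub>Z\<^esub>" if "c \<in> carrier ?C3" for c
  proof (rule free_Abelian_hom_eqI[of Z "\<lambda>c. f (?bd3 c)" "simplices (BG G) (Suc (Suc (Suc 0)))" "\<lambda>c. \<one>\<^bsub>Z\<^esub>"])
    show "(\<lambda>c. f (?bd3 c)) \<in> hom ?C3 Z" using Group.hom_compose[OF boundary3_hom f(1)] by (simp add: comp_def)
    show "(\<lambda>c. \<one>\<^bsub>Z\<^esub>) \<in> hom ?C3 Z" by (rule homI) simp_all
    fix x assume "x \<in> simplices (BG G) (Suc (Suc (Suc 0)))"
    then obtain a b c where x: "x = [a, b, c]" and abc: "a \<in> carrier G" "b \<in> carrier G" "c \<in> carrier G"
      by (auto simp: nerve_simplices3)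
    have mem: "?q (rel g k) \<in> carrier Z" if "g \<in> carrier G" "k \<in> carrier G" for g k using relR[OF that] by (simp add: Zs)
    have ga: "gen a \<in> carrier F0" by (rule gen_closed[OF abc(1)])
    \<comment> \<open>The nonabelian cocycle identity of the relations, a consequence of
      associativity in G.\<close>
    have ww: "gen a \<otimes>\<^bsub>F0\<^esub> rel b c \<otimes>\<^bsub>F0\<^esub> inv\<^bsub>F0\<^esub> gen a \<otimes>\<^bsub>F0\<^esub> rel a (b \<otimes> c) = rel a b \<otimes>\<^bsub>F0\<^esub> rel (a \<otimes> b) c"
      using abc by (simp add: rel_def gen_closed F0.word_simps m_assoc)
    have "?q (gen a \<otimes>\<^bsub>F0\<^esub> rel b c \<otimes>\<^bsub>F0\<^esub> inv\<^bsub>F0\<^esub> gen a) = ?q (rel b c)"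
    proof -
      have "?q (gen a \<otimes>\<^bsub>F0\<^esub> rel b c \<otimes>\<^bsub>F0\<^esub> inv\<^bsub>F0\<^esub> gen a) = ?q (gen a) \<otimes>\<^bsub>?Q\<^esub> ?q (rel b c) \<otimes>\<^bsub>?Q\<^esub> inv\<^bsub>?Q\<^esub> ?q (gen a)"
        using ga relc abc by (simp del: mult_FactGroup)
      also have "?q (gen a) \<otimes>\<^bsub>?Q\<^esub> ?q (rel b c) = ?q (rel b c) \<otimes>\<^bsub>?Q\<^esub> ?q (gen a)"
        by (rule cen[OF relR[OF abc(2,3)] q.hom_closed[OF ga], symmetric])
      also have "?q (rel b c) \<otimes>\<^bsub>?Q\<^esub> ?q (gen a) \<otimes>\<^bsub>?Q\<^esub> inv\<^bsub>?Q\<^esub> ?q (gen a) = ?q (rel b c)"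
        using q.hom_closed[OF ga] q.hom_closed[OF relc[OF abc(2,3)]] by (simp add: q.H.m_assoc del: mult_FactGroup one_FactGroup)
      finally show ?thesis .
    qed
    then have eq: "?q (rel b c) \<otimes>\<^bsub>Z\<^esub> ?q (rel a (b \<otimes> c)) = ?q (rel a b) \<otimes>\<^bsub>Z\<^esub> ?q (rel (a \<otimes> b) c)"
      using arg_cong[OF ww, of ?q] abc ga relc unfolding Zs
      by (metis (no_types, lifting) F0.inv_closed F0.m_closed m_closed q.hom_mult)
    define A B C D where "A = ?q (rel b c)" and "B = ?q (rel (a \<otimes> b) c)" and "C = ?q (rel a (b \<otimes> c))" and "D = ?q (rel a b)"
    have cl: "A \<in> carrier Z" "B \<in> carrier Z" "C \<in> carrier Z" "D \<in> carrier Z"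
      using abc by (auto simp: A_def B_def C_def D_def intro!: mem)
    have "f (frag_of [b, c] - frag_of [a \<otimes> b, c] + frag_of [a, b \<otimes> c] - frag_of [a, b])
        = A \<otimes>\<^bsub>Z\<^esub> inv\<^bsub>Z\<^esub> B \<otimes>\<^bsub>Z\<^esub> C \<otimes>\<^bsub>Z\<^esub> inv\<^bsub>Z\<^esub> D"
    proof -
      have k: "c + d \<in> carrier ?C2" "c - d \<in> carrier ?C2" if "c \<in> carrier ?C2" "d \<in> carrier ?C2" for c d
        using that keys_add[of c d] keys_diff[of c d] by auto
      show ?thesis
        using abc by (simp only: fadd fdiff mem2 k m_closed fgen A_def B_def C_def D_def)
    qed
    also have "\<dots> = (A \<otimes>\<^bsub>Z\<^esub> C) \<otimes>\<^bsub>Z\<^esub> inv\<^bsub>Z\<^esub> (D \<otimes>\<^bsub>Z\<^esub> B)" using cl by (simp add: Z.inv_mult Z.m_ac)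
    also have "A \<otimes>\<^bsub>Z\<^esub> C = D \<otimes>\<^bsub>Z\<^esub> B" unfolding A_def B_def C_def D_def by (rule eq)
    also have "(D \<otimes>\<^bsub>Z\<^esub> B) \<otimes>\<^bsub>Z\<^esub> inv\<^bsub>Z\<^esub> (D \<otimes>\<^bsub>Z\<^esub> B) = \<one>\<^bsub>Z\<^esub>" using cl by simp
    finally show "f (?bd3 (frag_of x)) = \<one>\<^bsub>Z\<^esub>" unfolding x nerve_boundary3 .
  qed (use that Z.group_axioms in auto)
  \<comment> \<open>\<open>gen \<one>\<close> is trivial but \<open>frag_of [\<one>]\<close> is not, hence the shift by \<open>frag_of [\<one>] = ?bd (frag_of [\<one>, \<one>])\<close>.\<close>
  define ab where "ab = free_lift ?C1 (\<lambda>x. frag_of x - frag_of [\<one>])"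
  have fl: "free_lift ?C1 (\<lambda>x. frag_of x - frag_of [\<one>]) \<in> hom F0 ?C1"
    "\<And>g. g \<in> carrier G \<Longrightarrow> free_lift ?C1 (\<lambda>x. frag_of x - frag_of [\<one>]) (gen g) = frag_of [g] - frag_of [\<one>]"
    by (rule free_lift_F0; auto simp: nerve_simplices_low dest!: keys_diff[THEN subsetD])+
  interpret ab: group_hom F0 ?C1 ab using fl(1) unfolding ab_def by (simp add: group_hom_def group_hom_axioms_def)
  have abgen: "ab (gen g) = frag_of [g] - frag_of [\<one>]" if "g \<in> carrier G" for g using fl(2)[OF that] by (simp add: ab_def)
  have abG1: "ab w = 0" if w: "w \<in> rel_lcs F0 (carrier F0) (Suc 0)" for w
  proof -
    have "rel_lcs F0 (carrier F0) (Suc 0) \<subseteq> kernel F0 ?C1 ab"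
    proof (rule F0.rel_lcs_Suc_subsetI[OF ab.subgroup_kernel])
      fix t x assume tx: "t \<in> rel_lcs F0 (carrier F0) 0" "x \<in> carrier F0"
      then have "ab (commutator F0 t x) = \<one>\<^bsub>?C1\<^esub>"
        using C1.commutator_eq_one_iff[of "ab t" "ab x"] C1.m_comm by (simp del: mult_free_Abelian_group one_free_Abelian_group carrier_free_Abelian_group_iff)
      moreover have "commutator F0 t x \<in> carrier F0" using tx by simp
      ultimately show "commutator F0 t x \<in> kernel F0 ?C1 ab" unfolding kernel_def by blast
    qed
    then have "ab w = \<one>\<^bsub>?C1\<^esub>" using w unfolding kernel_def by blast
    then show ?thesis by simp
  qed
  \<comment> \<open>The elements matched by a chain simultaneously in R/[R, F] and under
    \<open>ab\<close>. N is normal and contains the multiplication relations, hence all of R by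
    \<open>kernel_aug_subset\<close>.\<close>
  define N where "N = {w \<in> R. \<exists>c\<in>carrier ?C2. ?q w = f c \<and> ab w = ?bd c}"
  have bd0: "?bd 0 = 0" by (simp add: simplicial_boundary_def)
  have qinv: "inv\<^bsub>Z\<^esub> ?q w = ?q (inv\<^bsub>F0\<^esub> w)" if "w \<in> R" for w
  proof -
    have "?q w \<in> carrier Z" unfolding Zs by (rule imageI[OF that])
    moreover have "?q (inv\<^bsub>F0\<^esub> w) \<in> carrier Z" unfolding Zs by (rule imageI[OF R.m_inv_closed[OF that]])
    moreover have "?q (inv\<^bsub>F0\<^esub> w) \<otimes>\<^bsub>Z\<^esub> ?q w = \<one>\<^bsub>Z\<^esub>"
    proof -
      have wc: "w \<in> carrier F0" by (rule R.mem_carrier[OF that])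
      have "?q (inv\<^bsub>F0\<^esub> w) \<otimes>\<^bsub>?Q\<^esub> ?q w = ?q (inv\<^bsub>F0\<^esub> w \<otimes>\<^bsub>F0\<^esub> w)"
        by (rule q.hom_mult[OF F0.inv_closed[OF wc] wc, symmetric])
      also have "\<dots> = \<one>\<^bsub>?Q\<^esub>" unfolding F0.l_inv[OF wc] by (rule q.hom_one)
      finally show ?thesis unfolding Zs .
    qed
    ultimately show ?thesis by (metis Z.inv_equality)
  qed
  have Nsub: "subgroup N F0"
  proof (rule F0.subgroupI)
    show "N \<subseteq> carrier F0" using R.subset by (auto simp: N_def)
    have "\<one>\<^bsub>F0\<^esub> \<in> N"
      unfolding N_def using R.one_closed q.hom_one f.hom_one ab.hom_one bd0
      by (intro CollectI conjI bexI[of _ 0]) (simp_all add: Zs)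
    then show "N \<noteq> {}" by blast
    fix v assume "v \<in> N"
    then obtain c where v: "v \<in> R" "c \<in> carrier ?C2" "?q v = f c" "ab v = ?bd c" by (auto simp: N_def)
    have vc: "v \<in> carrier F0" using v R.subset by blast
    have "f (- c) = inv\<^bsub>Z\<^esub> f c" using f.hom_inv[OF v(2)] v(2) by simp
    then have "?q (inv\<^bsub>F0\<^esub> v) = f (- c)" using qinv[OF v(1)] v(3) by simp
    moreover have "ab (inv\<^bsub>F0\<^esub> v) = ?bd (- c)"
    proof -
      have "ab v \<in> carrier ?C1" using vc by (rule ab.hom_closed)
      then have "ab (inv\<^bsub>F0\<^esub> v) = - ab v" using ab.hom_inv[OF vc] by simp
      then show ?thesis using v(4) simplicial_boundary_diff[of "BG G" "Suc (Suc 0)" 0 c] bd0 by simp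
    qed
    ultimately show "inv\<^bsub>F0\<^esub> v \<in> N" unfolding N_def using v(1,2) by (intro CollectI conjI bexI[of _ "- c"]) auto
    fix w assume "w \<in> N"
    then obtain d where w: "w \<in> R" "d \<in> carrier ?C2" "?q w = f d" "ab w = ?bd d" by (auto simp: N_def)
    have wc: "w \<in> carrier F0" using w R.subset by blast
    have "?q (v \<otimes>\<^bsub>F0\<^esub> w) = f (c + d)" using q.hom_mult[OF vc wc] fadd[OF v(2) w(2)] v(3) w(3) by (simp add: Zs)
    moreover have "ab (v \<otimes>\<^bsub>F0\<^esub> w) = ?bd (c + d)" using ab.hom_mult[OF vc wc] v(4) w(4) by (simp add: simplicial_boundary_add)
    moreover have "c + d \<in> carrier ?C2" using v(2) w(2) keys_add[of c d] by auto
    ultimately show "v \<otimes>\<^bsub>F0\<^esub> w \<in> N" unfolding N_def using v(1) w(1) by blast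
  qed
  have "N \<lhd> F0"
  proof -
    have "x \<otimes>\<^bsub>F0\<^esub> w \<otimes>\<^bsub>F0\<^esub> inv\<^bsub>F0\<^esub> x \<in> N" if x: "x \<in> carrier F0" and w: "w \<in> N" for x w
    proof -
      obtain c where c: "w \<in> R" "c \<in> carrier ?C2" "?q w = f c" "ab w = ?bd c" using w by (auto simp: N_def)
      have wc: "w \<in> carrier F0" using c R.subset by blast
      have "?q (x \<otimes>\<^bsub>F0\<^esub> w) = ?q (w \<otimes>\<^bsub>F0\<^esub> x)" using cen[OF c(1) q.hom_closed[OF x]] q.hom_mult[OF x wc] q.hom_mult[OF wc x] by simp
      then have "?q (x \<otimes>\<^bsub>F0\<^esub> w \<otimes>\<^bsub>F0\<^esub> inv\<^bsub>F0\<^esub> x) = ?q (w \<otimes>\<^bsub>F0\<^esub> x \<otimes>\<^bsub>F0\<^esub> inv\<^bsub>F0\<^esub> x)"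
        using q.hom_mult[of "x \<otimes>\<^bsub>F0\<^esub> w" "inv\<^bsub>F0\<^esub> x"] q.hom_mult[of "w \<otimes>\<^bsub>F0\<^esub> x" "inv\<^bsub>F0\<^esub> x"] x wc by simp
      then have "?q (x \<otimes>\<^bsub>F0\<^esub> w \<otimes>\<^bsub>F0\<^esub> inv\<^bsub>F0\<^esub> x) = f c" using x wc c(3) by (simp add: F0.m_assoc)
      moreover have "ab (x \<otimes>\<^bsub>F0\<^esub> w \<otimes>\<^bsub>F0\<^esub> inv\<^bsub>F0\<^esub> x) = ab w"
      proof -
        have "ab (x \<otimes>\<^bsub>F0\<^esub> w \<otimes>\<^bsub>F0\<^esub> inv\<^bsub>F0\<^esub> x) = ab x + ab w + ab (inv\<^bsub>F0\<^esub> x)" using x wc by simp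
        moreover have "ab x + ab (inv\<^bsub>F0\<^esub> x) = 0" using ab.hom_mult[of x "inv\<^bsub>F0\<^esub> x"] ab.hom_one x by simp
        ultimately show ?thesis by (simp add: algebra_simps)
      qed
      ultimately show ?thesis unfolding N_def using c R.inv_op_closed2[OF x c(1)] by (intro CollectI conjI bexI[of _ c]) simp_all
    qed
    then show ?thesis using Nsub by (simp add: F0.normal_inv_iff)
  qed
  then have RN: "R \<subseteq> N"
  proof (rule kernel_aug_subset)
    fix g k assume gk: "g \<in> carrier G" "k \<in> carrier G"
    have r1: "rel \<one> \<one> = \<one>\<^bsub>F0\<^esub>" by (simp add: rel_def gen_one)
    \<comment> \<open>Subtracting [1, 1] leaves f unchanged, as the relation of 1 and 1 is trivial,
      and its boundary accounts for the shift in \<open>ab\<close>.\<close>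
    let ?c = "frag_of [g, k] - frag_of [\<one>, \<one>]"
    have c: "?c \<in> carrier ?C2" using gk by (auto simp: nerve_simplices_low dest!: keys_diff[THEN subsetD])
    have "f ?c = ?q (rel g k) \<otimes>\<^bsub>Z\<^esub> inv\<^bsub>Z\<^esub> \<one>\<^bsub>Z\<^esub>"
      using fdiff[OF mem2[OF gk] mem2[OF one_closed one_closed]] gk q.hom_one by (simp add: fgen r1 Zs)
    then have "?q (rel g k) = f ?c" using Z.r_one[of "?q (rel g k)"] relR[OF gk] by (simp add: Zs(1))
    moreover have "ab (rel g k) = ?bd ?c"
    proof -
      have cl: "ab (gen h) \<in> carrier ?C1" if "h \<in> carrier G" for h using gen_closed[OF that] by (rule ab.hom_closed)
      have "ab (rel g k) = ab (gen g) + ab (gen k) - ab (gen (g \<otimes> k))"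
        using gk gen_closed cl[of "g \<otimes> k"] by (simp add: rel_def)
      then show ?thesis using gk by (simp add: abgen simplicial_boundary_diff nerve_boundary2)
    qed
    ultimately show "gen g \<otimes>\<^bsub>F0\<^esub> gen k \<otimes>\<^bsub>F0\<^esub> inv\<^bsub>F0\<^esub> gen (g \<otimes> k) \<in> N"
      unfolding rel_def[symmetric] N_def using relR[OF gk] c by blast
  qed
  let ?cyc = "simplicial_cycles (BG G) (Suc (Suc 0))" and ?bds = "simplicial_boundaries (BG G) (Suc (Suc 0))"
  have cyc: "c \<in> ?cyc \<longleftrightarrow> c \<in> carrier ?C2 \<and> ?bd c = 0" for c by (simp add: simplicial_cycles_def)
  have "?q ` (R \<inter> rel_lcs F0 (carrier F0) (Suc 0)) \<subseteq> f ` ?cyc"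
  proof
    fix y assume "y \<in> ?q ` (R \<inter> rel_lcs F0 (carrier F0) (Suc 0))"
    then obtain w where w: "w \<in> R" "w \<in> rel_lcs F0 (carrier F0) (Suc 0)" "y = ?q w" by blast
    then obtain c where c: "c \<in> carrier ?C2" "?q w = f c" "ab w = ?bd c" using RN by (auto simp: N_def)
    then have "c \<in> ?cyc" using abG1[OF w(2)] by (simp add: cyc)
    then show "y \<in> f ` ?cyc" using c(2) w(3) by blast
  qed
  moreover have "finite (f ` ?cyc)"
  proof -
    have H2: "carrier (group_homology 2 G) = (\<lambda>c. \<Union>b\<in>?bds. {b + c}) ` ?cyc"
      by (simp add: group_homology_def simplicial_homology_def numeral_2_eq_2 carrier_FactGroup r_coset_def)
    \<comment> \<open>f is constant on homology classes, so its value can be read off from an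
      arbitrary element of the class.\<close>
    have "f ` ?cyc \<subseteq> (\<lambda>C. f (SOME c. c \<in> C)) ` carrier (group_homology 2 G)"
    proof
      fix y assume "y \<in> f ` ?cyc"
      then obtain c where c: "c \<in> ?cyc" "y = f c" by blast
      let ?C = "\<Union>b\<in>?bds. {b + c}"
      have "0 \<in> carrier ?C3" by simp
      then obtain b0 where "b0 \<in> ?bds" unfolding simplicial_boundaries_def by blast
      then have "b0 + c \<in> ?C" by blast
      then have "(SOME c. c \<in> ?C) \<in> ?C" by (rule someI[where P="\<lambda>x. x \<in> ?C"])
      then obtain b where b: "b \<in> ?bds" "(SOME c. c \<in> ?C) = b + c" by blast
      obtain d where d: "d \<in> carrier ?C3" "b = ?bd3 d" using b(1) by (auto simp: simplicial_boundaries_def)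
      have bc: "b \<in> carrier ?C2" unfolding d(2) by (rule hom_in_carrier[OF boundary3_hom d(1)])
      have cc: "c \<in> carrier ?C2" using c(1) cyc by blast
      have "f (b + c) = f c" using fadd[OF bc cc] fbd[OF d(1)] d(2) f.hom_closed[OF cc] by simp
      then have y: "y = f (SOME c. c \<in> ?C)" unfolding b(2) c(2) by (rule sym)
      have "?C \<in> carrier (group_homology 2 G)" unfolding H2 by (rule imageI[OF c(1)])
      with y show "y \<in> (\<lambda>C. f (SOME c. c \<in> C)) ` carrier (group_homology 2 G)" by (rule image_eqI)
    qed
    then show ?thesis using assms finite_surj by blast
  qed
  ultimately show ?thesis by (rule finite_subset)
qed

end

section \<open>The exact sequence\<close>

context loop_nerve
begin

abbreviation haug where "haug \<equiv> completion_map G (carrier G) aug"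

lemma haug_hom: "group_hom (hat F0) (hat G) haug"
  by (rule aug.completion_map_hom[OF F0.normal_self normal_self]) auto

lemma haug_surj: "haug ` carrier (hat F0) = carrier (hat G)"
  using aug.completion_map_image[OF F0.normal_self aug_surj] by (simp add: aug_surj)

lemma haug_coset_seq:
  "coherent F0 (carrier F0) u \<Longrightarrow> haug (coset_seq F0 (carrier F0) u) = coset_seq G (carrier G) (\<lambda>n. aug (u n))"
  by (rule aug.completion_map_coset_seq[OF F0.normal_self normal_self]) auto

lemma haug_B:
  assumes "x \<in> hat.B"
  shows "haug x = \<one>\<^bsub>hat G\<^esub>"
proof -
  obtain u where u: "coherent F0 R u" "x = coset_seq F0 (carrier F0) u" using assms by (auto simp: hat_B)
  have "coherent F0 (carrier F0) u" by (rule F0.coherent_mono[OF _ u(1)]) (auto simp: kernel_def)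
  moreover have "aug (u n) = \<one>" for n
  proof -
    have "u n \<in> R" using u(1) unfolding coherent_def by blast
    then show ?thesis unfolding kernel_def by blast
  qed
  ultimately show ?thesis by (simp add: u(2) haug_coset_seq completion_one[OF normal_self])
qed

text \<open>The completed augmentation kills \<open>hat.B\<close>, so it is constant on the class of
  x and \<open>the_elem\<close> is applied to a singleton.\<close>

lemma Z_inf_to_hat_cl:
  assumes x: "x \<in> carrier (hat F0)"
  shows "Z_inf_to_hat G (hat.cl x) = haug x"
proof -
  interpret haug: group_hom "hat F0" "hat G" haug by (rule haug_hom)
  have "haug y = haug x" if "y \<in> hat.B #>\<^bsub>hat F0\<^esub> x" for y
  proof -
    obtain b where b: "b \<in> hat.B" "y = b \<otimes>\<^bsub>hat F0\<^esub> x" using \<open>y \<in> _\<close> by (auto simp: r_coset_def)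
    have bc: "b \<in> carrier (hat F0)" using b(1) hat.B.subset by blast
    show ?thesis unfolding b(2) haug.hom_mult[OF bc x] haug_B[OF b(1)]
      using haug.hom_closed[OF x] by (rule haug.H.l_one)
  qed
  moreover have "x \<in> hat.B #>\<^bsub>hat F0\<^esub> x" using hat.coset_eq[OF x] x by blast
  ultimately have "haug ` (hat.B #>\<^bsub>hat F0\<^esub> x) = {haug x}" by blast
  then have "(\<lambda>ks. haug (hd ks)) ` hat.cl x = {haug x}"
    unfolding hat.cl_def image_image list.sel(1) .
  then show ?thesis by (simp add: Z_inf_to_hat_def)
qed

text \<open>The point where the homology hypotheses enter: \<open>multiplier_finite\<close> makes
  all the D_n finite, and \<open>kernel_coherent_finite\<close> then represents x by a sequence in R
  that is coherent relative to the free group.\<close>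

lemma kernel_haug:
  assumes "finitely_generated_group (group_homology 1 G)" "finite (carrier (group_homology 2 G))"
    and x: "x \<in> carrier (hat F0)" "haug x = \<one>\<^bsub>hat G\<^esub>"
  shows "x \<in> hat.B"
proof -
  interpret sf: self_free F0 "(\<lambda>g. [(True, [g])]) ` (carrier G - {\<one>})" by (rule self_free_F0)
  obtain Y where Y: "finite Y" "Y \<subseteq> carrier G"
    "\<And>x. x \<in> carrier G \<Longrightarrow> \<exists>y\<in>generate G Y. inv y \<otimes> x \<in> rel_lcs G (carrier G) (Suc 0)"
    using H1_finitely_generated[OF assms(1)] by blast
  note fin = sf.multiplier_finite[OF aug_hom aug_surj refl Y H2_finite[OF assms(2)]]
  obtain u where u: "coherent F0 (carrier F0) u" "x = coset_seq F0 (carrier F0) u"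
    using x(1) by (auto simp: F0.completion_carrier[OF F0.normal_self])
  have uc: "u n \<in> carrier F0" for n by (rule F0.coherent_carrier[OF F0.normal_self u(1)])
  have "coset_seq G (carrier G) (\<lambda>n. aug (u n)) = coset_seq G (carrier G) (\<lambda>n. \<one>)"
    using x(2) unfolding u(2) haug_coset_seq[OF u(1)] completion_one[OF normal_self] .
  then have "aug (u n) \<in> rel_lcs G (carrier G) n" for n
    using uc coset_seq_eq_iff[OF normal_self, of "\<lambda>n. aug (u n)" "\<lambda>n. \<one>"] by simp
  then obtain v where "coherent F0 R v" "coset_seq F0 (carrier F0) v = coset_seq F0 (carrier F0) u"
    using aug.kernel_coherent_finite[OF aug_surj fin u(1)] by blast
  then show ?thesis unfolding hat_B u(2) by (metis (mono_tags, lifting) imageI mem_Collect_eq)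
qed

text \<open>Injectivity is \<open>kernel_haug\<close>; surjectivity comes from that of the completed
  augmentation.\<close>

lemma Z_inf_to_hat_iso:
  assumes "finitely_generated_group (group_homology 1 G)" "finite (carrier (group_homology 2 G))"
  shows "Z_inf_to_hat G \<in> iso (Z_inf G) (hat G)"
proof -
  interpret haug: group_hom "hat F0" "hat G" haug by (rule haug_hom)
  interpret cl: group_hom "hat F0" "Z_inf G" hat.cl using hat.cl_group_hom by (simp add: Z_inf_eq)
  have car: "carrier (Z_inf G) = hat.cl ` carrier (hat F0)" using hat.pi1_carrier by (simp add: Z_inf_eq)
  have h: "Z_inf_to_hat G \<in> hom (Z_inf G) (hat G)"
  proof (rule homI)
    fix A assume "A \<in> carrier (Z_inf G)"
    then obtain x where x: "x \<in> carrier (hat F0)" "A = hat.cl x" by (auto simp: car)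
    show "Z_inf_to_hat G A \<in> carrier (hat G)" unfolding x(2) Z_inf_to_hat_cl[OF x(1)] by (rule haug.hom_closed[OF x(1)])
    fix C assume "C \<in> carrier (Z_inf G)"
    then obtain y where y: "y \<in> carrier (hat F0)" "C = hat.cl y" by (auto simp: car)
    show "Z_inf_to_hat G (A \<otimes>\<^bsub>Z_inf G\<^esub> C) = Z_inf_to_hat G A \<otimes>\<^bsub>hat G\<^esub> Z_inf_to_hat G C"
      unfolding x(2) y(2) cl.hom_mult[OF x(1) y(1), symmetric] Z_inf_to_hat_cl[OF x(1)] Z_inf_to_hat_cl[OF y(1)]
        Z_inf_to_hat_cl[OF hat.d0.H.m_closed[OF x(1) y(1)]]
      by (rule haug.hom_mult[OF x(1) y(1)])
  qed
  interpret Z: group_hom "Z_inf G" "hat G" "Z_inf_to_hat G"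
    using h cl.H.group_axioms haug.H.group_axioms by (simp add: group_hom_def group_hom_axioms_def)
  have "A = \<one>\<^bsub>Z_inf G\<^esub>" if A: "A \<in> carrier (Z_inf G)" "Z_inf_to_hat G A = \<one>\<^bsub>hat G\<^esub>" for A
  proof -
    obtain x where x: "x \<in> carrier (hat F0)" "A = hat.cl x" using A(1) by (auto simp: car)
    have "x \<in> hat.B" using kernel_haug[OF assms x(1)] A(2) unfolding x(2) Z_inf_to_hat_cl[OF x(1)] .
    then have "hat.cl x = hat.cl \<one>\<^bsub>hat F0\<^esub>" using x(1) by (subst hat.cl_eq_iff) simp_all
    then show ?thesis using x(2) cl.hom_one by simp
  qed
  moreover have "carrier (hat G) \<subseteq> Z_inf_to_hat G ` carrier (Z_inf G)"
  proof
    fix y assume "y \<in> carrier (hat G)"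
    then obtain x where x: "x \<in> carrier (hat F0)" "y = haug x" using haug_surj by blast
    then show "y \<in> Z_inf_to_hat G ` carrier (Z_inf G)"
      using Z_inf_to_hat_cl[OF x(1)] cl.hom_closed[OF x(1)] by (metis imageI)
  qed
  ultimately show ?thesis using Z.iso_iff by blast
qed

end

section \<open>Comparison of the free groups on E and on G\<close>

locale loop_nerve_epi = E: loop_nerve E + G: loop_nerve G
  for E :: "'a monoid" and G :: "'b monoid" and U :: "'a set" and p :: "'a \<Rightarrow> 'b" +
  assumes p: "p \<in> epi E G" and U: "U = kernel E G p"
begin

sublocale p: group_hom E G p
  using p E.group_axioms G.group_axioms by (simp add: epi_def group_hom_def group_hom_axioms_def)

lemma p_surj: "p ` carrier E = carrier G"
  using p by (simp add: epi_def)

abbreviation lp where "lp \<equiv> loop_group_map (BG G) (wbar_map (\<lambda>n. p)) 0"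

lemma lp_hom: "group_hom E.F0 G.F0 lp" and lp_gen: "g \<in> carrier E \<Longrightarrow> lp (E.gen g) = G.gen (p g)"
  using E.free_lift_F0[OF G.F0_group, of "\<lambda>x. loop_gen (BG G) 0 (wbar_map (\<lambda>n. p) (Suc 0) x)"]
    E.F0_group G.F0_group
  by (simp_all add: loop_group_map_def wbar_map_def G.gen_closed G.gen_one group_hom_def group_hom_axioms_def)

sublocale lp: group_hom E.F0 G.F0 lp by (rule lp_hom)

lemma aug_lp: "x \<in> carrier E.F0 \<Longrightarrow> G.aug (lp x) = p (E.aug x)"
  by (rule E.F0_hom_eqI[OF E.group_hom_comp[OF lp_hom G.aug_hom] E.group_hom_comp[OF E.aug_hom p.group_hom_axioms]])
    (simp_all add: lp_gen G.aug_gen E.aug_gen)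

text \<open>\<open>G.F0\<close> is free, so a choice of preimages of the elements of G extends to a
  section. The choice has to send 1 to 1, because the generator belonging to 1 is trivial;
  \<open>\<tau>\<close> adjusts it there.\<close>

lemma ex_section: "\<exists>s. s \<in> hom G.F0 E.F0 \<and> (\<forall>x\<in>carrier G.F0. lp (s x) = x)"
proof -
  have "\<forall>g\<in>carrier G. \<exists>x\<in>carrier E. p x = g" using p_surj by (metis imageE)
  then obtain \<sigma> where \<sigma>: "\<And>g. g \<in> carrier G \<Longrightarrow> \<sigma> g \<in> carrier E \<and> p (\<sigma> g) = g" by metis
  define \<tau> where "\<tau> g = (if g = \<one>\<^bsub>G\<^esub> then \<one>\<^bsub>E\<^esub> else \<sigma> g)" for g
  have \<tau>: "\<tau> g \<in> carrier E" "p (\<tau> g) = g" if "g \<in> carrier G" for g using \<sigma>[OF that] by (auto simp: \<tau>_def)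
  have \<tau>1: "\<tau> \<one>\<^bsub>G\<^esub> = \<one>\<^bsub>E\<^esub>" by (simp add: \<tau>_def)
  let ?s = "free_lift E.F0 (\<lambda>x. E.gen (\<tau> (hd x)))"
  have s: "?s \<in> hom G.F0 E.F0" "\<And>g. g \<in> carrier G \<Longrightarrow> ?s (G.gen g) = E.gen (\<tau> g)"
    using G.free_lift_F0[OF E.F0_group, of "\<lambda>x. E.gen (\<tau> (hd x))"] \<tau> E.gen_closed by (simp_all add: \<tau>1 E.gen_one)
  have sh: "group_hom G.F0 E.F0 ?s" using s(1) E.F0_group G.F0_group by (simp add: group_hom_def group_hom_axioms_def)
  have "lp (?s x) = x" if "x \<in> carrier G.F0" for x
    by (rule G.F0_hom_eqI[OF G.group_hom_comp[OF sh lp_hom] G.group_hom_id[OF G.F0_group] _ that])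
      (simp add: s(2) lp_gen \<tau>)
  then show ?thesis using s(1) by blast
qed

lemma lp_surj: "lp ` carrier E.F0 = carrier G.F0"
proof -
  obtain s where s: "s \<in> hom G.F0 E.F0" "\<And>x. x \<in> carrier G.F0 \<Longrightarrow> lp (s x) = x" using ex_section by blast
  have "x \<in> lp ` carrier E.F0" if "x \<in> carrier G.F0" for x
    using s(2)[OF that] hom_in_carrier[OF s(1) that] by (metis imageI)
  then show ?thesis using lp.hom_closed by blast
qed

text \<open>S mediates between the two ends of the sequence: \<open>E.aug\<close> maps it onto U and
  \<open>lp\<close> maps it onto \<open>G.R\<close>.\<close>

abbreviation S where "S \<equiv> kernel E.F0 G (\<lambda>x. p (E.aug x))"

lemma S_hom: "group_hom E.F0 G (\<lambda>x. p (E.aug x))"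
  by (rule E.group_hom_comp[OF E.aug_hom p.group_hom_axioms])

lemma S_normal: "S \<lhd> E.F0"
  by (rule group_hom.normal_kernel[OF S_hom])

lemma S_subset: "S \<subseteq> carrier E.F0"
  by (auto simp: kernel_def)

lemma U_normal: "U \<lhd> E"
  unfolding U by (rule p.normal_kernel)

lemma aug_S: "E.aug ` S = U"
proof (intro equalityI subsetI)
  fix y assume "y \<in> U"
  then have y: "y \<in> carrier E" "p y = \<one>\<^bsub>G\<^esub>" by (auto simp: U kernel_def)
  then obtain x where "x \<in> carrier E.F0" "E.aug x = y" using E.aug_surj by (metis imageE)
  then show "y \<in> E.aug ` S" using y(2) unfolding kernel_def by blast
qed (auto simp: U kernel_def)

lemma lp_S: "lp ` S = G.R"
proof (intro equalityI subsetI)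
  fix y assume "y \<in> G.R"
  then have y: "y \<in> carrier G.F0" "G.aug y = \<one>\<^bsub>G\<^esub>" by (auto simp: kernel_def)
  have "y \<in> lp ` carrier E.F0" unfolding lp_surj by (rule y(1))
  then obtain x where x: "x \<in> carrier E.F0" "y = lp x" by (rule imageE)
  then have "p (E.aug x) = \<one>\<^bsub>G\<^esub>" using aug_lp[OF x(1)] y(2) by simp
  then have "x \<in> S" using x(1) unfolding kernel_def by blast
  then show "y \<in> lp ` S" unfolding x(2) by (rule imageI)
qed (auto simp: kernel_def aug_lp)

abbreviation hlp where "hlp \<equiv> completion_map G.F0 (carrier G.F0) lp"

lemma hlp_hom: "group_hom (hat E.F0) (hat G.F0) hlp"
  by (rule lp.completion_map_hom[OF E.F0.normal_self G.F0.normal_self]) auto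

lemma hlp_surj: "hlp ` carrier (hat E.F0) = carrier (hat G.F0)"
  using lp.completion_map_image[OF E.F0.normal_self lp_surj] by (simp add: lp_surj)

lemma hlp_coset_seq:
  "coherent E.F0 (carrier E.F0) u \<Longrightarrow> hlp (coset_seq E.F0 (carrier E.F0) u) = coset_seq G.F0 (carrier G.F0) (\<lambda>n. lp (u n))"
  by (rule lp.completion_map_coset_seq[OF E.F0.normal_self G.F0.normal_self]) auto

text \<open>Stands for the image of the relative completion of S in the absolute one, without
  introducing the map between them.\<close>

definition IS where "IS = coset_seq E.F0 (carrier E.F0) ` {u. coherent E.F0 S u}"

lemma IS_subset: "IS \<subseteq> carrier (hat E.F0)"
  using E.F0.coherent_mono[OF S_subset] by (auto simp: IS_def E.F0.completion_carrier[OF E.F0.normal_self])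

lemma IS_mult: "\<lbrakk>x \<in> IS; y \<in> IS\<rbrakk> \<Longrightarrow> x \<otimes>\<^bsub>hat E.F0\<^esub> y \<in> IS"
  using E.F0.coherent_mult[OF S_normal] E.F0.coherent_carrier[OF S_normal]
  by (auto simp: IS_def E.F0.completion_mult[OF E.F0.normal_self] intro!: imageI)

lemma hlp_IS: "hlp ` IS = G.hat.B"
proof (intro equalityI subsetI)
  fix y assume "y \<in> hlp ` IS"
  then obtain u where u: "coherent E.F0 S u" "y = hlp (coset_seq E.F0 (carrier E.F0) u)" by (auto simp: IS_def)
  have "coherent G.F0 G.R (\<lambda>n. lp (u n))"
    by (rule lp.hom_coherent[OF S_normal G.aug.normal_kernel _ u(1)]) (simp add: lp_S)
  then show "y \<in> G.hat.B" unfolding u(2) hlp_coset_seq[OF E.F0.coherent_mono[OF S_subset u(1)]] G.hat_B by blast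
next
  fix y assume "y \<in> G.hat.B"
  then obtain w where w: "coherent G.F0 G.R w" "y = coset_seq G.F0 (carrier G.F0) w" by (auto simp: G.hat_B)
  obtain u where u: "coherent E.F0 S u" "coset_seq G.F0 G.R (\<lambda>n. lp (u n)) = coset_seq G.F0 G.R w"
    using lp.ex_coherent_lift[OF S_normal lp_surj, of w] w(1) unfolding lp_S by blast
  have "coset_seq G.F0 (carrier G.F0) (\<lambda>n. lp (u n)) = y" unfolding w(2)
    by (rule G.F0.coset_seq_mono[OF G.aug.normal_kernel G.F0.normal_self _ _ _ u(2)])
      (use E.F0.coherent_carrier[OF S_normal u(1)] G.F0.coherent_carrier[OF G.aug.normal_kernel w(1)] in \<open>auto simp: kernel_def\<close>)
  then have "y = hlp (coset_seq E.F0 (carrier E.F0) u)"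
    using hlp_coset_seq[OF E.F0.coherent_mono[OF S_subset u(1)]] by simp
  then show "y \<in> hlp ` IS" using u(1) by (auto simp: IS_def)
qed

text \<open>As \<open>lp\<close> splits, an element killed by its completion has representatives in
  the kernel of \<open>lp\<close> by \<open>kernel_coherent_split\<close>, and that kernel is
  contained in S.\<close>

lemma hlp_kernel:
  assumes x: "x \<in> carrier (hat E.F0)" "hlp x = \<one>\<^bsub>hat G.F0\<^esub>"
  shows "x \<in> IS"
proof -
  obtain s where s: "s \<in> hom G.F0 E.F0" "\<And>x. x \<in> carrier G.F0 \<Longrightarrow> lp (s x) = x" using ex_section by blast
  obtain u where u: "coherent E.F0 (carrier E.F0) u" "x = coset_seq E.F0 (carrier E.F0) u"
    using x(1) by (auto simp: E.F0.completion_carrier[OF E.F0.normal_self])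
  have uc: "u n \<in> carrier E.F0" for n by (rule E.F0.coherent_carrier[OF E.F0.normal_self u(1)])
  have "coset_seq G.F0 (carrier G.F0) (\<lambda>n. lp (u n)) = coset_seq G.F0 (carrier G.F0) (\<lambda>n. \<one>\<^bsub>G.F0\<^esub>)"
    using x(2) unfolding u(2) hlp_coset_seq[OF u(1)] G.F0.completion_one[OF G.F0.normal_self] .
  then have "lp (u n) \<in> rel_lcs G.F0 (carrier G.F0) n" for n
    using uc G.F0.coset_seq_eq_iff[OF G.F0.normal_self, of "\<lambda>n. lp (u n)" "\<lambda>n. \<one>\<^bsub>G.F0\<^esub>"] by simp
  then obtain v where v: "coherent E.F0 (kernel E.F0 G.F0 lp) v" "coset_seq E.F0 (carrier E.F0) v = x"
    using lp.kernel_coherent_split[OF s u(1)] u(2) by blast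
  have "kernel E.F0 G.F0 lp \<subseteq> S"
  proof
    fix x assume "x \<in> kernel E.F0 G.F0 lp"
    then have x: "x \<in> carrier E.F0" "lp x = \<one>\<^bsub>G.F0\<^esub>" unfolding kernel_def by blast+
    then have "p (E.aug x) = \<one>\<^bsub>G\<^esub>" using aug_lp[OF x(1)] G.aug.hom_one by simp
    then show "x \<in> S" using x(1) unfolding kernel_def by blast
  qed
  then show ?thesis using E.F0.coherent_mono[OF _ v(1)] v(2) unfolding IS_def by blast
qed

text \<open>By \<open>hlp_IS\<close>, x can be divided by an element of \<open>IS\<close> with the
  same image; the quotient is killed by \<open>hlp\<close> and lies in \<open>IS\<close> by
  \<open>hlp_kernel\<close>.\<close>

lemma hlp_B_iff:
  assumes x: "x \<in> carrier (hat E.F0)"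
  shows "hlp x \<in> G.hat.B \<longleftrightarrow> x \<in> IS"
proof
  interpret hlp: group_hom "hat E.F0" "hat G.F0" hlp by (rule hlp_hom)
  assume "hlp x \<in> G.hat.B"
  then have "hlp x \<in> hlp ` IS" unfolding hlp_IS .
  then obtain y where y: "hlp x = hlp y" "y \<in> IS" by (rule imageE)
  have yc: "y \<in> carrier (hat E.F0)" using y(2) IS_subset by blast
  have "hlp (x \<otimes>\<^bsub>hat E.F0\<^esub> inv\<^bsub>hat E.F0\<^esub> y) = \<one>\<^bsub>hat G.F0\<^esub>"
    using hlp.hom_mult[OF x E.hat.d0.H.inv_closed[OF yc]] hlp.hom_inv[OF yc] y(1)[symmetric] G.hat.d0.H.r_inv[OF hlp.hom_closed[OF x]] by simp
  then have "x \<otimes>\<^bsub>hat E.F0\<^esub> inv\<^bsub>hat E.F0\<^esub> y \<in> IS" by (intro hlp_kernel E.hat.d0.H.m_closed x E.hat.d0.H.inv_closed yc)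
  then have "x \<otimes>\<^bsub>hat E.F0\<^esub> inv\<^bsub>hat E.F0\<^esub> y \<otimes>\<^bsub>hat E.F0\<^esub> y \<in> IS" using y(2) by (rule IS_mult)
  then show "x \<in> IS" using E.hat.d0.H.m_assoc[OF x E.hat.d0.H.inv_closed[OF yc] yc] E.hat.d0.H.l_inv[OF yc] E.hat.d0.H.r_one[OF x] by simp
next
  assume "x \<in> IS"
  then show "hlp x \<in> G.hat.B" unfolding hlp_IS[symmetric] by (rule imageI)
qed

abbreviation incl where "incl \<equiv> completion_map E (carrier E) (\<lambda>u. u)"

lemma incl_hom: "group_hom (completion E U) (hat E) incl"
proof -
  interpret i: group_hom E E "\<lambda>u. u" by (rule E.group_hom_id[OF E.group_axioms])
  show ?thesis using U_normal E.rel_lcs_carrier[OF U_normal, of 0] by (intro i.completion_map_hom E.normal_self) auto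
qed

text \<open>\<open>E.aug\<close> maps S onto U, so coherent sequences in U lift to coherent
  sequences in S, and those in S push forward to U.\<close>

lemma incl_image: "incl ` carrier (completion E U) = E.haug ` IS"
proof -
  interpret i: group_hom E E "\<lambda>u. u" by (rule E.group_hom_id[OF E.group_axioms])
  have Uc: "U \<subseteq> carrier E" using E.rel_lcs_carrier[OF U_normal, of 0] by simp
  have incl: "incl (coset_seq E U u) = coset_seq E (carrier E) u" if "coherent E U u" for u
    by (rule i.completion_map_coset_seq[OF U_normal E.normal_self _ that]) (use Uc in auto)
  show ?thesis
  proof (intro equalityI subsetI)
    fix y assume "y \<in> incl ` carrier (completion E U)"
    then obtain w where w: "coherent E U w" "y = coset_seq E (carrier E) w"
      using incl by (auto simp: E.completion_carrier[OF U_normal])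
    obtain u where u: "coherent E.F0 S u" "coset_seq E U (\<lambda>n. E.aug (u n)) = coset_seq E U w"
      using E.aug.ex_coherent_lift[OF S_normal E.aug_surj, of w] w(1) unfolding aug_S by blast
    have "coset_seq E (carrier E) (\<lambda>n. E.aug (u n)) = y" unfolding w(2)
      by (rule E.coset_seq_mono[OF U_normal E.normal_self Uc _ _ u(2)])
        (use E.F0.coherent_carrier[OF S_normal u(1)] E.coherent_carrier[OF U_normal w(1)] in auto)
    then have "y = E.haug (coset_seq E.F0 (carrier E.F0) u)"
      using E.haug_coset_seq[OF E.F0.coherent_mono[OF S_subset u(1)]] by simp
    then show "y \<in> E.haug ` IS" using u(1) by (auto simp: IS_def)
  next
    fix y assume "y \<in> E.haug ` IS"
    then obtain u where u: "coherent E.F0 S u" "y = E.haug (coset_seq E.F0 (carrier E.F0) u)" by (auto simp: IS_def)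
    have au: "coherent E U (\<lambda>n. E.aug (u n))"
      by (rule E.aug.hom_coherent[OF S_normal U_normal _ u(1)]) (simp add: aug_S)
    then have "y = incl (coset_seq E U (\<lambda>n. E.aug (u n)))"
      using E.haug_coset_seq[OF E.F0.coherent_mono[OF S_subset u(1)]] incl[OF au] u(2) by simp
    then show "y \<in> incl ` carrier (completion E U)" using au by (auto simp: E.completion_carrier[OF U_normal])
  qed
qed

text \<open>\<open>E.R\<close> is contained in S, so \<open>hlp\<close> maps \<open>E.hat.B\<close>
  into \<open>G.hat.B\<close> and all representatives of a class land in a single class.\<close>

lemma Z_inf_map_cl:
  assumes x: "x \<in> carrier (hat E.F0)"
  shows "Z_inf_map G p (E.hat.cl x) = G.hat.cl (hlp x)"
proof -
  interpret hlp: group_hom "hat E.F0" "hat G.F0" hlp by (rule hlp_hom)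
  have map1: "Z_completion_map (BG G) (wbar_map (\<lambda>n. p)) 1 [k] = [hlp k]" for k
    by (simp add: Z_completion_map_def wbar_map_def completion_sgroup_map_def loop_group_def)
  have "x \<in> E.hat.B #>\<^bsub>hat E.F0\<^esub> x" using E.hat.coset_eq[OF x] x by blast
  then have ne: "E.hat.B #>\<^bsub>hat E.F0\<^esub> x \<noteq> {}" by blast
  have "loop_homotopy (wbar G.hatK) [] `` {[hlp k]} = G.hat.cl (hlp x)" if k: "k \<in> E.hat.B #>\<^bsub>hat E.F0\<^esub> x" for k
  proof -
    obtain b where b: "b \<in> E.hat.B" "k = b \<otimes>\<^bsub>hat E.F0\<^esub> x" using k by (auto simp: r_coset_def)
    have bc: "b \<in> carrier (hat E.F0)" using b(1) E.hat.B.subset by blast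
    have RS: "E.R \<subseteq> S" by (auto simp: kernel_def)
    have "b \<in> IS" using b(1) E.F0.coherent_mono[OF RS] unfolding E.hat_B IS_def by blast
    then have hb: "hlp b \<in> G.hat.B" using hlp_B_iff[OF bc] by blast
    have kc: "k \<in> carrier (hat E.F0)" using b(2) bc x by simp
    have c: "hlp k \<in> carrier (hat G.F0)" "hlp x \<in> carrier (hat G.F0)" "hlp b \<in> carrier (hat G.F0)"
      using kc x bc hlp.hom_closed by blast+
    have "hlp k = hlp b \<otimes>\<^bsub>hat G.F0\<^esub> hlp x" unfolding b(2) by (rule hlp.hom_mult[OF bc x])
    then have "hlp k \<otimes>\<^bsub>hat G.F0\<^esub> inv\<^bsub>hat G.F0\<^esub> hlp x = hlp b"
      using c G.hat.d0.H.m_assoc G.hat.d0.H.r_inv G.hat.d0.H.r_one G.hat.d0.H.inv_closed by metis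
    then have "G.hat.cl (hlp k) = G.hat.cl (hlp x)" using hb G.hat.cl_eq_iff[OF c(1,2)] by simp
    then show ?thesis using G.hat.homotopy_class[OF c(1)] by simp
  qed
  then have "(\<Union>k\<in>E.hat.B #>\<^bsub>hat E.F0\<^esub> x. loop_homotopy (wbar G.hatK) [] `` {[hlp k]}) = G.hat.cl (hlp x)"
    using ne by auto
  moreover have "Z_inf_map G p (E.hat.cl x) = (\<Union>k\<in>E.hat.B #>\<^bsub>hat E.F0\<^esub> x. loop_homotopy (wbar G.hatK) [] `` {[hlp k]})"
    unfolding Z_inf_map_def pi1_map_def E.hat.cl_def image_image map1 by (auto simp: Z_completion_def)
  ultimately show ?thesis by simp
qed

lemma exact_sequence:
  assumes H: "finitely_generated_group (group_homology 1 E)" "finite (carrier (group_homology 2 E))"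
  shows "group_hom (hat E) (Z_inf G) (hat_to_Z_inf E G p)
    \<and> incl ` carrier (completion E U) = kernel (hat E) (Z_inf G) (hat_to_Z_inf E G p)
    \<and> hat_to_Z_inf E G p ` carrier (hat E) = carrier (Z_inf G)"
proof -
  interpret haug: group_hom "hat E.F0" "hat E" E.haug by (rule E.haug_hom)
  interpret hlp: group_hom "hat E.F0" "hat G.F0" hlp by (rule hlp_hom)
  interpret clE: group_hom "hat E.F0" "Z_inf E" E.hat.cl using E.hat.cl_group_hom by (simp add: E.Z_inf_eq)
  interpret clG: group_hom "hat G.F0" "Z_inf G" G.hat.cl using G.hat.cl_group_hom by (simp add: G.Z_inf_eq)
  have carG: "carrier (Z_inf G) = G.hat.cl ` carrier (hat G.F0)" using G.hat.pi1_carrier by (simp add: G.Z_inf_eq)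
  have inj: "inj_on (Z_inf_to_hat E) (carrier (Z_inf E))"
    using E.Z_inf_to_hat_iso[OF H] by (simp add: iso_def bij_betw_def)
  \<comment> \<open>The isomorphism from \<open>Z_inf E\<close> takes the class of x to
    \<open>E.haug x\<close>, so its inverse returns the class of x. Elements of the completion of E
    are thus handled through preimages in the completed free group.\<close>
  have \<phi>: "hat_to_Z_inf E G p (E.haug x) = G.hat.cl (hlp x)" if x: "x \<in> carrier (hat E.F0)" for x
  proof -
    have "inv_into (carrier (Z_inf E)) (Z_inf_to_hat E) (E.haug x) = E.hat.cl x"
      unfolding E.Z_inf_to_hat_cl[OF x, symmetric] by (rule inv_into_f_f[OF inj clE.hom_closed[OF x]])
    then show ?thesis unfolding hat_to_Z_inf_def by (simp add: Z_inf_map_cl[OF x])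
  qed
  have ex: "\<exists>x\<in>carrier (hat E.F0). y = E.haug x" if "y \<in> carrier (hat E)" for y
    using that E.haug_surj by blast
  have h: "hat_to_Z_inf E G p \<in> hom (hat E) (Z_inf G)"
  proof (rule homI)
    fix y assume "y \<in> carrier (hat E)"
    then obtain x where x: "x \<in> carrier (hat E.F0)" "y = E.haug x" using ex by blast
    show "hat_to_Z_inf E G p y \<in> carrier (Z_inf G)" unfolding x(2) \<phi>[OF x(1)] by (intro clG.hom_closed hlp.hom_closed x(1))
    fix y' assume "y' \<in> carrier (hat E)"
    then obtain x' where x': "x' \<in> carrier (hat E.F0)" "y' = E.haug x'" using ex by blast
    show "hat_to_Z_inf E G p (y \<otimes>\<^bsub>hat E\<^esub> y') = hat_to_Z_inf E G p y \<otimes>\<^bsub>Z_inf G\<^esub> hat_to_Z_inf E G p y'"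
      unfolding x(2) x'(2) haug.hom_mult[OF x(1) x'(1), symmetric] \<phi>[OF x(1)] \<phi>[OF x'(1)] \<phi>[OF E.hat.d0.H.m_closed[OF x(1) x'(1)]]
        hlp.hom_mult[OF x(1) x'(1)]
      by (rule clG.hom_mult[OF hlp.hom_closed[OF x(1)] hlp.hom_closed[OF x'(1)]])
  qed
  \<comment> \<open>By \<open>\<phi>\<close> triviality means that \<open>hlp x\<close> is in
    \<open>G.hat.B\<close>, that is, x is in \<open>IS\<close>. Hence the kernel is the image of
    \<open>IS\<close> under \<open>E.haug\<close>, which \<open>incl_image\<close> identifies with
    the image of the relative completion of U.\<close>
  have one_iff: "hat_to_Z_inf E G p (E.haug x) = \<one>\<^bsub>Z_inf G\<^esub> \<longleftrightarrow> x \<in> IS" if x: "x \<in> carrier (hat E.F0)" for x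
  proof -
    have c: "hlp x \<in> carrier (hat G.F0)" by (rule hlp.hom_closed[OF x])
    have "hat_to_Z_inf E G p (E.haug x) = \<one>\<^bsub>Z_inf G\<^esub> \<longleftrightarrow> G.hat.cl (hlp x) = G.hat.cl \<one>\<^bsub>hat G.F0\<^esub>"
      unfolding \<phi>[OF x] clG.hom_one ..
    also have "\<dots> \<longleftrightarrow> hlp x \<in> G.hat.B" using G.hat.cl_eq_iff[OF c G.hat.d0.H.one_closed] c by simp
    also have "\<dots> \<longleftrightarrow> x \<in> IS" by (rule hlp_B_iff[OF x])
    finally show ?thesis .
  qed
  have "kernel (hat E) (Z_inf G) (hat_to_Z_inf E G p) = E.haug ` IS"
  proof (intro equalityI subsetI)
    fix y assume "y \<in> kernel (hat E) (Z_inf G) (hat_to_Z_inf E G p)"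
    then have y: "y \<in> carrier (hat E)" "hat_to_Z_inf E G p y = \<one>\<^bsub>Z_inf G\<^esub>" unfolding kernel_def by blast+
    then obtain x where "x \<in> carrier (hat E.F0)" "y = E.haug x" using ex by blast
    then show "y \<in> E.haug ` IS" using one_iff y(2) by blast
  next
    fix y assume "y \<in> E.haug ` IS"
    then obtain x where x: "x \<in> IS" "y = E.haug x" by blast
    have xc: "x \<in> carrier (hat E.F0)" using x(1) IS_subset by blast
    then show "y \<in> kernel (hat E) (Z_inf G) (hat_to_Z_inf E G p)"
      unfolding kernel_def using one_iff[OF xc] x haug.hom_closed[OF xc] by blast
  qed
  moreover have "hat_to_Z_inf E G p ` carrier (hat E) = carrier (Z_inf G)"
  proof -
    have "hat_to_Z_inf E G p ` carrier (hat E) = (\<lambda>x. hat_to_Z_inf E G p (E.haug x)) ` carrier (hat E.F0)"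
      unfolding E.haug_surj[symmetric] image_image ..
    also have "\<dots> = (\<lambda>x. G.hat.cl (hlp x)) ` carrier (hat E.F0)" by (rule image_cong[OF refl \<phi>])
    also have "\<dots> = carrier (Z_inf G)" unfolding carG hlp_surj[symmetric] image_image ..
    finally show ?thesis .
  qed
  moreover have "group_hom (hat E) (Z_inf G) (hat_to_Z_inf E G p)"
    using h haug.H.group_axioms clG.H.group_axioms by (simp add: group_hom_def group_hom_axioms_def)
  ultimately show ?thesis by (simp add: incl_image)
qed

end

text \<open>The isomorphism is part of the conclusion because \<open>hat_to_Z_inf\<close> is built
  from \<open>inv_into\<close>, which is an inverse only for a bijection; the homomorphism claims
  give exactness its meaning.\<close>

theorem corollary3p11:
  fixes E :: "'a monoid" and G :: "'b monoid" and U :: "'a set" and p :: "'a \<Rightarrow> 'b"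
  assumes "group E" and "group G"
    and "U \<lhd> E" and "p \<in> epi E G" and "kernel E G p = U"
    and "finitely_generated_group (group_homology 1 E)"
    and "finite (carrier (group_homology 2 E))"
  shows "Z_inf_to_hat E \<in> iso (Z_inf E) (hat E)
    \<and> group_hom (completion E U) (hat E) (completion_map E (carrier E) (\<lambda>u. u))
    \<and> group_hom (hat E) (Z_inf G) (hat_to_Z_inf E G p)
    \<and> completion_map E (carrier E) (\<lambda>u. u) ` carrier (completion E U)
        = kernel (hat E) (Z_inf G) (hat_to_Z_inf E G p)
    \<and> hat_to_Z_inf E G p ` carrier (hat E) = carrier (Z_inf G)"
proof -
  interpret loop_nerve_epi E G U p
    using assms(1,2,4,5) by (simp add: loop_nerve_epi_def loop_nerve_def loop_nerve_epi_axioms_def)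
  show ?thesis
    using E.Z_inf_to_hat_iso[OF assms(6,7)] incl_hom exact_sequence[OF assms(6,7)] by blast
qed

end
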